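(* Let $L,T>0$, let $x=(X,x_3)\in Q_{L,T}$ and let $\mu\in\mathcal A^*_{L,T}$ with $I(\mu)<+\infty$; let $m$ be the optimal measure for $\mu$, i.e. $I(\mu)=I(\mu,m)$. Then there exists a subsystem $\tilde\mu$ of $\mu$ emanating from $x$, meaning that there exists $\tilde\mu\in\mathcal A^*_{L,T}$ such that (i) $\tilde\mu\le\mu$, in the sense that $\mu-\tilde\mu$ is a positive measure; (ii) $\tilde\mu_{x_3}=a\,\delta_X$, where $a=\mu_{x_3}(X)$; (iii) $\displaystyle\partial_3\tilde\mu+\mathrm{div}'\left(\frac{dm}{d\mu}\tilde\mu\right)=0$.
   Context: Notation. $Q_L:=(-\frac L2,\frac L2)^2$, $Q_{L,T}:=Q_L\times(-T,T)$. Everything is $Q_L$-periodic in $x'$ (the first two variables), i.e. $Q_L$ is identified with the torus $\mathbb R^2/L\mathbb Z^2$. $\mathcal M^+$ denotes finite positive Radon measures and $\mathcal M(\cdot;\mathbb R^2)$ finite vector-valued Radon measures. Differential equations for measures are understood distributionally in $Q_{L,T}$, periodically in $x'$. $\mathcal A_{L,T}$ is the set of pairs $\mu\in\mathcal M^+(Q_{L,T})$, $m\in\mathcal M(Q_{L,T};\mathbb R^2)$ with $m\ll\mu$, $\partial_3\mu+\mathrm{div}'m=0$ in $Q_{L,T}$, and $\mu=\mu_{x_3}\otimes dx_3$ where for a.e. $x_3\in(-T,T)$, $\mu_{x_3}=\sum_i\varphi_i\delta_{X_i}$ (at most countable, $\varphi_i>0$, $X_i\in Q_L$). $\mathcal A^*_{L,T}:=\{\mu:\exists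 m,\ (\mu,m)\in\mathcal A_{L,T}\}$. With $K_*:=\frac{8\sqrt\pi}3$ and $\mu_{x_3}(x'):=\mu_{x_3}(\{x'\})$, $$I(\mu,m):=\frac{K_*}{L^2}\int_{-T}^T\sum_{x'\in Q_L}(\mu_{x_3}(x'))^{1/2}dx_3+\frac1{L^2}\int_{Q_{L,T}}\left|\frac{dm}{d\mu}\right|^2d\mu,\qquad I(\mu):=\min\{I(\mu,m):\ m\ll\mu,\ \partial_3\mu+\mathrm{div}'m=0\}.$$ The minimizing $m$ is unique when $I(\mu)<\infty$. When $I(\mu)<\infty$ the map $x_3\mapsto\mu_{x_3}$ has a weakly continuous representative on $[-T,T]$ (and likewise for $\tilde\mu$ satisfying (i) and (iii)), which is always used, so slices are defined for every $x_3$. *)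

theory Defs
  imports "HOL-Probability.Probability"
begin

text \<open>
  The torus \<open>\<real>\<^sup>2 / L \<int>\<^sup>2\<close> is represented by the half-open fundamental domain, so that Borel
  measures on the torus are exactly Borel measures on this set.  The topology of the torus
  enters through the test functions, which are periodic functions on the whole plane.
\<close>

definition QL :: "real \<Rightarrow> (real^2) set" where
  "QL L = {x. \<forall>i. - (L/2) \<le> x $ i \<and> x $ i < L/2}"

definition QLT :: "real \<Rightarrow> real \<Rightarrow> ((real^2) \<times> real) set" where
  "QLT L T = QL L \<times> {-T<..<T}"

abbreviation borel_QL :: "real \<Rightarrow> (real^2) measure" where
  "borel_QL L \<equiv> restrict_space borel (QL L)"

abbreviation borel_QLT :: "real \<Rightarrow> real \<Rightarrow> ((real^2) \<times> real) measure" where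
  "borel_QLT L T \<equiv> restrict_space borel (QLT L T)"

text \<open>Finite positive Borel measures on the \<open>\<sigma>\<close>-algebra of \<open>M\<close>; on the spaces used here these
  are automatically Radon.\<close>

definition pos_measures :: "'a measure \<Rightarrow> 'a measure set" where
  "pos_measures M = {\<mu>. sets \<mu> = sets M \<and> finite_measure \<mu>}"

text \<open>Countably additive set functions; finiteness of the total variation is automatic in finite
  dimension.  Values outside \<open>sets M\<close> are irrelevant.\<close>

definition vector_measure :: "'a measure \<Rightarrow> ('a set \<Rightarrow> real^2) \<Rightarrow> bool" where
  "vector_measure M m \<longleftrightarrow> m {} = 0 \<and>
     (\<forall>A::nat \<Rightarrow> 'a set. range A \<subseteq> sets M \<longrightarrow> disjoint_family A \<longrightarrow>
        (\<lambda>i. m (A i)) sums m (\<Union>i. A i))"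

definition vm_abs_cont :: "('a set \<Rightarrow> real^2) \<Rightarrow> 'a measure \<Rightarrow> bool" where
  "vm_abs_cont m \<mu> \<longleftrightarrow> (\<forall>A\<in>sets \<mu>. emeasure \<mu> A = 0 \<longrightarrow> m A = 0)"

definition vm_density :: "'a measure \<Rightarrow> ('a \<Rightarrow> real^2) \<Rightarrow> 'a set \<Rightarrow> real^2" where
  "vm_density \<mu> v A = (LINT p:A|\<mu>. v p)"

text \<open>The Radon--Nikodym density \<open>dm/d\<mu>\<close>, determined up to \<open>\<mu>\<close>-null sets.\<close>

definition vm_RN :: "'a measure \<Rightarrow> ('a set \<Rightarrow> real^2) \<Rightarrow> 'a \<Rightarrow> real^2" where
  "vm_RN \<mu> m = (SOME v. integrable \<mu> v \<and> (\<forall>A\<in>sets \<mu>. m A = vm_density \<mu> v A))"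

text \<open>The positive part \<open>\<nu>\<^sup>+\<close> of the Jordan decomposition of a signed measure \<open>\<nu>\<close>.  Negative values
  of \<open>\<nu>\<close> are truncated to zero by \<open>ennreal\<close>, which does not affect the supremum because
  \<open>\<nu> {} = 0\<close>.\<close>

definition pos_variation :: "'a measure \<Rightarrow> ('a set \<Rightarrow> real) \<Rightarrow> 'a measure" where
  "pos_variation M \<nu> = measure_of (space M) (sets M)
     (\<lambda>A. SUP B\<in>{B\<in>sets M. B \<subseteq> A}. ennreal (\<nu> B))"

definition signed_integral :: "'a measure \<Rightarrow> ('a set \<Rightarrow> real) \<Rightarrow> ('a \<Rightarrow> real) \<Rightarrow> real" where
  "signed_integral M \<nu> f =
     (LINT p|pos_variation M \<nu>. f p) - (LINT p|pos_variation M (\<lambda>A. - \<nu> A). f p)"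

definition vm_integral :: "'a measure \<Rightarrow> ('a set \<Rightarrow> real^2) \<Rightarrow> ('a \<Rightarrow> real^2) \<Rightarrow> real" where
  "vm_integral M m \<psi> = (\<Sum>i\<in>UNIV. signed_integral M (\<lambda>A. m A $ i) (\<lambda>p. \<psi> p $ i))"

text \<open>\<open>C\<^sup>k\<close> regularity through iterated directional derivatives.\<close>

primrec Ck_fun :: "nat \<Rightarrow> ('a::euclidean_space \<Rightarrow> real) \<Rightarrow> bool" where
  "Ck_fun 0 f \<longleftrightarrow> continuous_on UNIV f"
| "Ck_fun (Suc k) f \<longleftrightarrow> f differentiable_on UNIV \<and>
     (\<forall>h. Ck_fun k (\<lambda>x. frechet_derivative f (at x) h))"

definition periodic :: "real \<Rightarrow> (real^2 \<Rightarrow> 'b) \<Rightarrow> bool" where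
  "periodic L f \<longleftrightarrow> (\<forall>x i. f (x + L *\<^sub>R axis i 1) = f x)"

text \<open>Smooth functions that are periodic in \<open>x'\<close> and compactly supported in \<open>x\<^sub>3 \<in> (-T, T)\<close>,
  extended by zero to all \<open>x\<^sub>3\<close>.\<close>

definition test_functions :: "real \<Rightarrow> real \<Rightarrow> ((real^2) \<times> real \<Rightarrow> real) set" where
  "test_functions L T = {\<phi>. (\<forall>k. Ck_fun k \<phi>) \<and> (\<forall>t. periodic L (\<lambda>x. \<phi> (x, t))) \<and>
     (\<exists>r<T. \<forall>x t. r \<le> \<bar>t\<bar> \<longrightarrow> \<phi> (x, t) = 0)}"

definition deriv3 :: "((real^2) \<times> real \<Rightarrow> real) \<Rightarrow> (real^2) \<times> real \<Rightarrow> real" where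
  "deriv3 \<phi> p = frechet_derivative \<phi> (at p) (0, 1)"

definition grad' :: "((real^2) \<times> real \<Rightarrow> real) \<Rightarrow> (real^2) \<times> real \<Rightarrow> real^2" where
  "grad' \<phi> p = (\<chi> i. frechet_derivative \<phi> (at p) (axis i 1, 0))"

text \<open>\<open>\<partial>\<^sub>3 \<mu> + div' m = 0\<close> in the sense of distributions, with the overall sign dropped.\<close>

definition continuity_eq ::
  "real \<Rightarrow> real \<Rightarrow> ((real^2) \<times> real) measure \<Rightarrow> (((real^2) \<times> real) set \<Rightarrow> real^2) \<Rightarrow> bool" where
  "continuity_eq L T \<mu> m \<longleftrightarrow> (\<forall>\<phi>\<in>test_functions L T.
     (LINT p|\<mu>. deriv3 \<phi> p) + vm_integral (borel_QLT L T) m (grad' \<phi>) = 0)"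

text \<open>\<open>\<mu> = \<sigma>\<^sub>t \<otimes> dt\<close>; the values of \<open>\<sigma>\<close> outside \<open>[-T, T]\<close> are irrelevant.\<close>

definition disintegration ::
  "real \<Rightarrow> real \<Rightarrow> ((real^2) \<times> real) measure \<Rightarrow> (real \<Rightarrow> (real^2) measure) \<Rightarrow> bool" where
  "disintegration L T \<mu> \<sigma> \<longleftrightarrow>
     (\<forall>t\<in>{-T..T}. \<sigma> t \<in> pos_measures (borel_QL L)) \<and>
     (\<forall>B\<in>sets (borel_QL L). (\<lambda>t. emeasure (\<sigma> t) B) \<in> borel_measurable (restrict_space borel {-T..T})) \<and>
     (\<forall>A\<in>sets (borel_QLT L T).
        emeasure \<mu> A = (\<integral>\<^sup>+t\<in>{-T<..<T}. emeasure (\<sigma> t) {x. (x, t) \<in> A} \<partial>lborel))"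

definition weakly_continuous :: "real \<Rightarrow> real \<Rightarrow> (real \<Rightarrow> (real^2) measure) \<Rightarrow> bool" where
  "weakly_continuous L T \<sigma> \<longleftrightarrow> (\<forall>f::real^2 \<Rightarrow> real. continuous_on UNIV f \<longrightarrow> periodic L f \<longrightarrow>
     continuous_on {-T..T} (\<lambda>t. LINT x|\<sigma> t. f x))"

text \<open>The slices \<open>\<mu>\<^sub>t\<close>.  The weakly continuous representative is taken whenever there is one, and it is
  then unique on \<open>[-T, T]\<close>; otherwise the slices are only determined for almost every \<open>t\<close>.\<close>

definition slices ::
  "real \<Rightarrow> real \<Rightarrow> ((real^2) \<times> real) measure \<Rightarrow> real \<Rightarrow> (real^2) measure" where
  "slices L T \<mu> = (SOME \<sigma>. disintegration L T \<mu> \<sigma> \<and>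
     ((\<exists>\<rho>. disintegration L T \<mu> \<rho> \<and> weakly_continuous L T \<rho>) \<longrightarrow> weakly_continuous L T \<sigma>))"

text \<open>\<open>\<nu> = \<Sum>\<^sub>i \<phi>\<^sub>i \<delta>\<^bsub>X\<^sub>i\<^esub>\<close>, indexed by the atoms themselves.\<close>

definition purely_atomic :: "real \<Rightarrow> (real^2) measure \<Rightarrow> bool" where
  "purely_atomic L \<nu> \<longleftrightarrow> (\<exists>S \<phi>. countable S \<and> S \<subseteq> QL L \<and> (\<forall>x\<in>S. 0 < (\<phi> x :: real)) \<and>
     (\<forall>B\<in>sets (borel_QL L). emeasure \<nu> B = (\<Sum>\<^sub>\<infinity>x\<in>S. ennreal (\<phi> x) * indicator B x)))"

definition fluxes ::
  "real \<Rightarrow> real \<Rightarrow> ((real^2) \<times> real) measure \<Rightarrow> (((real^2) \<times> real) set \<Rightarrow> real^2) set" where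
  "fluxes L T \<mu> = {m. vector_measure (borel_QLT L T) m \<and> vm_abs_cont m \<mu> \<and> continuity_eq L T \<mu> m}"

definition A_LT ::
  "real \<Rightarrow> real \<Rightarrow> (((real^2) \<times> real) measure \<times> (((real^2) \<times> real) set \<Rightarrow> real^2)) set" where
  "A_LT L T = {(\<mu>, m). \<mu> \<in> pos_measures (borel_QLT L T) \<and> m \<in> fluxes L T \<mu> \<and>
     (\<exists>\<sigma>. disintegration L T \<mu> \<sigma> \<and>
        (AE t in lborel. t \<in> {-T<..<T} \<longrightarrow> purely_atomic L (\<sigma> t)))}"

definition A_star :: "real \<Rightarrow> real \<Rightarrow> ((real^2) \<times> real) measure set" where
  "A_star L T = {\<mu>. \<exists>m. (\<mu>, m) \<in> A_LT L T}"

definition K_star :: real where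
  "K_star = 8 * sqrt pi / 3"

definition energy ::
  "real \<Rightarrow> real \<Rightarrow> ((real^2) \<times> real) measure \<Rightarrow> (((real^2) \<times> real) set \<Rightarrow> real^2) \<Rightarrow> ennreal" where
  "energy L T \<mu> m =
     ennreal (K_star / L\<^sup>2) * (\<integral>\<^sup>+t\<in>{-T<..<T}.
        (\<Sum>\<^sub>\<infinity>x\<in>QL L. ennreal (sqrt (measure (slices L T \<mu> t) {x}))) \<partial>lborel) +
     ennreal (1 / L\<^sup>2) * (\<integral>\<^sup>+p. ennreal ((norm (vm_RN \<mu> m p))\<^sup>2) \<partial>\<mu>)"

text \<open>The minimum over \<open>m\<close>; it is attained whenever it is finite, and it is \<open>\<infinity>\<close> if there is no
  admissible \<open>m\<close>.\<close>

definition min_energy :: "real \<Rightarrow> real \<Rightarrow> ((real^2) \<times> real) measure \<Rightarrow> ennreal" where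
  "min_energy L T \<mu> = (INF m\<in>fluxes L T \<mu>. energy L T \<mu> m)"

definition optimal_flux ::
  "real \<Rightarrow> real \<Rightarrow> ((real^2) \<times> real) measure \<Rightarrow> (((real^2) \<times> real) set \<Rightarrow> real^2) \<Rightarrow> bool" where
  "optimal_flux L T \<mu> m \<longleftrightarrow> m \<in> fluxes L T \<mu> \<and> min_energy L T \<mu> = energy L T \<mu> m"

end

theory Submission
  imports Defs
begin

text \<open>
  Let \<open>v = dm/d\<mu>\<close> be the velocity and write \<open>D \<phi> = \<partial>\<^sub>3
  \<phi> + v \<bullet> \<nabla>' \<phi>\<close> for the derivative of a function along the
  transport. The continuity equation of \<open>\<mu>\<close> says that \<open>\<integral> D \<phi>
  d\<mu> = 0\<close> for all test functions. A measure below \<open>\<mu>\<close> that is carried by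
  the same velocity is a measure \<open>g \<mu>\<close> with a density \<open>0 \<le> g \<le>
  1\<close> and \<open>\<integral> g D \<phi> d\<mu> = 0\<close>.

  A slice is determined by the future of the measure or by its past: for a test function,
  \<open>\<integral> \<phi>(x, s) d\<mu>\<^sub>s = - \<integral>\<^bsub>t > s\<^esub> D \<phi>
  d\<mu> = \<integral>\<^bsub>t < s\<^esub> D \<phi> d\<mu>\<close> (trace_formula). So all
  requirements on the subsystem are linear in \<open>g\<close>: with \<open>s = x\<^sub>3\<close>
  and \<open>a = \<mu>\<^sub>s(X)\<close>, they say that \<open>\<integral>\<^bsub>t > s\<^esub> g D
  \<phi> d\<mu> = - a \<phi>(X, s)\<close> and \<open>\<integral>\<^bsub>t < s\<^esub> g D \<phi>
  d\<mu> = a \<phi>(X, s)\<close> for every \<open>\<phi>\<close>. The functional \<open>f \<mapsto>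
  \<integral> g f d\<mu>\<close> is sought among the linear functionals below \<open>p f =
  \<integral> f\<^sup>+ d\<mu>\<close>; every such functional has a density in \<open>[0, 1]\<close>
  (dominated_functional_density). By the Hahn-Banach theorem the prescribed values extend to such a
  functional if and only if they are below \<open>p\<close> themselves, which means \<open>a
  \<phi>(X, s) \<le> \<integral>\<^bsub>t > s\<^esub> (D \<phi>)\<^sup>- d\<mu>\<close> and \<open>a
  \<phi>(X, s) \<le> \<integral>\<^bsub>t < s\<^esub> (D \<phi>)\<^sup>+ d\<mu>\<close>. Both bounds
  (point_mass_bounds) hold because transport is compatible with composition: if
  \<open>\<beta>\<close> is a smooth approximation of the positive part with \<open>0 \<le> \<beta>'
  \<le> 1\<close>, then \<open>\<beta>(\<phi>)\<close> is again a test function and \<open>D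
  (\<beta>(\<phi>)) = \<beta>'(\<phi>) D \<phi>\<close>, so that the trace formula for
  \<open>\<beta>(\<phi>)\<close> gives \<open>a \<beta>(\<phi>(X, s)) \<le> \<integral>
  \<beta>(\<phi>(x, s)) d\<mu>\<^sub>s \<le> \<integral>\<^bsub>t > s\<^esub> (D \<phi>)\<^sup>-
  d\<mu>\<close>, and likewise for the past.

  Slices at a given time make sense only through a weakly continuous disintegration, which has to be
  constructed (weakly_continuous_disintegration_exists). For a smooth periodic \<open>f\<close> the
  value of the slice at \<open>s\<close> is read off from \<open>\<mu>\<close>: it is the limit of
  \<open>\<integral> \<zeta>\<^sub>n(t) f(x) d\<mu>\<close> for bumps \<open>\<zeta>\<^sub>n\<close>
  that concentrate at \<open>s\<close>, and the continuity equation turns this limit into an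
  integral of \<open>D f\<close> over the future of \<open>s\<close>, which is linear in
  \<open>f\<close> and continuous in \<open>s\<close> (trace_functional). A Riesz theorem for
  positive functionals on smooth functions on the torus (riesz_torus) makes these functionals
  measures. It is proved by a second use of the Hahn-Banach theorem, which extends the functional to
  all bounded functions, followed by Skorokhod's construction: the values on dyadic cells are the
  lengths of nested intervals, and the measure is the image of Lebesgue measure under the
  corresponding binary expansions.
\<close>

section \<open>Smooth functions and smooth cutoffs\<close>

text \<open>
  The recursion step for \<open>Ck_fun\<close> phrased with an arbitrary derivative, so that no
  \<open>frechet_derivative\<close> has to be computed.
\<close>

lemma Ck_fun_SucI:
  assumes "\<And>x. (f has_derivative D x) (at x)" "\<And>h. Ck_fun k (\<lambda>x. D x h)"
  shows "Ck_fun (Suc k) f"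
proof -
  have "frechet_derivative f (at x) = D x" for x
    using frechet_derivative_at[OF assms(1)] by simp
  then show ?thesis
    using assms by (auto simp: differentiable_on_def intro: differentiableI)
qed

lemma Ck_fun_Suc_has_derivative:
  assumes "Ck_fun (Suc k) f"
  shows "(f has_derivative frechet_derivative f (at x)) (at x)"
  using assms by (simp add: differentiable_on_def frechet_derivative_works)

lemma Ck_fun_Suc_imp: "Ck_fun (Suc k) f \<Longrightarrow> Ck_fun k f"
proof (induction k arbitrary: f)
  case 0 then show ?case by (auto intro: differentiable_imp_continuous_on)
next
  case (Suc k) then show ?case by (metis Ck_fun.simps(2))
qed

lemma Ck_fun_const: "Ck_fun k (\<lambda>x. c)"
proof (induction k arbitrary: c)
  case (Suc k) show ?case by (rule Ck_fun_SucI[where D = "\<lambda>_ _. 0"]) (use Suc in auto)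
qed auto

lemma Ck_fun_add: "Ck_fun k f \<Longrightarrow> Ck_fun k g \<Longrightarrow> Ck_fun k (\<lambda>x. f x + g x)"
proof (induction k arbitrary: f g)
  case 0 then show ?case by (auto intro: continuous_intros)
next
  case (Suc k)
  show ?case
  proof (rule Ck_fun_SucI)
    show "((\<lambda>x. f x + g x) has_derivative
        (\<lambda>h. frechet_derivative f (at x) h + frechet_derivative g (at x) h)) (at x)" for x
      by (intro derivative_intros Ck_fun_Suc_has_derivative[OF Suc.prems(1)]
          Ck_fun_Suc_has_derivative[OF Suc.prems(2)])
    show "Ck_fun k (\<lambda>x. frechet_derivative f (at x) h + frechet_derivative g (at x) h)" for h
      using Suc by auto
  qed
qed

lemma Ck_fun_mult: "Ck_fun k f \<Longrightarrow> Ck_fun k g \<Longrightarrow> Ck_fun k (\<lambda>x. f x * g x)"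
proof (induction k arbitrary: f g)
  case 0 then show ?case by (auto intro: continuous_intros)
next
  case (Suc k)
  show ?case
  proof (rule Ck_fun_SucI)
    show "((\<lambda>x. f x * g x) has_derivative
        (\<lambda>h. f x * frechet_derivative g (at x) h + frechet_derivative f (at x) h * g x)) (at x)" for x
      by (intro derivative_intros Ck_fun_Suc_has_derivative[OF Suc.prems(1)]
          Ck_fun_Suc_has_derivative[OF Suc.prems(2)])
    show "Ck_fun k (\<lambda>x. f x * frechet_derivative g (at x) h + frechet_derivative f (at x) h * g x)" for h
      using Suc Ck_fun_Suc_imp by (intro Ck_fun_add Suc.IH) auto
  qed
qed

definition smooth :: "('a::euclidean_space \<Rightarrow> real) \<Rightarrow> bool" where
  "smooth f \<longleftrightarrow> (\<forall>k. Ck_fun k f)"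

lemma smooth_const [intro, simp]: "smooth (\<lambda>x. c)"
  by (simp add: smooth_def Ck_fun_const)

lemma smooth_add [intro]: "smooth f \<Longrightarrow> smooth g \<Longrightarrow> smooth (\<lambda>x. f x + g x)"
  by (simp add: smooth_def Ck_fun_add)

lemma smooth_mult [intro]: "smooth f \<Longrightarrow> smooth g \<Longrightarrow> smooth (\<lambda>x. f x * g x)"
  by (simp add: smooth_def Ck_fun_mult)

lemma smooth_diff [intro]: "smooth f \<Longrightarrow> smooth g \<Longrightarrow> smooth (\<lambda>x. f x - g x)"
  using smooth_add[of f "\<lambda>x. (-1) * g x"] smooth_mult[of "\<lambda>_. -1" g] by simp

lemma smooth_has_derivative:
  "smooth f \<Longrightarrow> (f has_derivative frechet_derivative f (at x)) (at x)"
  unfolding smooth_def using Ck_fun_Suc_has_derivative by blast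

lemma smooth_frechet_derivative: "smooth f \<Longrightarrow> smooth (\<lambda>x. frechet_derivative f (at x) h)"
  unfolding smooth_def by (metis Ck_fun.simps(2))

lemma smooth_continuous: "smooth f \<Longrightarrow> continuous_on A f"
  unfolding smooth_def by (metis Ck_fun.simps(1) continuous_on_subset top_greatest)

lemma smooth_borel [measurable_dest]: "smooth f \<Longrightarrow> f \<in> borel_measurable borel"
  by (intro borel_measurable_continuous_onI smooth_continuous)

text \<open>
  A family of functions on the line that is closed under differentiation consists of smooth
  functions; this replaces an explicit formula for all derivatives of trigonometric functions and of
  \<open>exp (- 1 / t)\<close>.
\<close>

lemma smooth_family:
  fixes F :: "(real \<Rightarrow> real) set"
  assumes F: "\<And>f. f \<in> F \<Longrightarrow> \<exists>g\<in>F. \<forall>x. (f has_real_derivative g x) (at x)" and f: "f \<in> F"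
  shows "smooth f"
proof -
  have "Ck_fun k f" if "f \<in> F" for k f
    using that
  proof (induction k arbitrary: f)
    case 0
    then obtain g where "\<forall>x. (f has_real_derivative g x) (at x)" using F by blast
    then show ?case by (auto intro!: continuous_at_imp_continuous_on DERIV_isCont)
  next
    case (Suc k)
    obtain g where g: "g \<in> F" "\<forall>x. (f has_real_derivative g x) (at x)" using F Suc by blast
    show ?case
    proof (rule Ck_fun_SucI)
      show "(f has_derivative (\<lambda>h. g x * h)) (at x)" for x
        using g(2) by (simp add: has_field_derivative_def)
      show "Ck_fun k (\<lambda>x. g x * h)" for h by (intro Ck_fun_mult Ck_fun_const Suc.IH g)
    qed
  qed
  then show ?thesis using f by (simp add: smooth_def)
qed

lemma smooth_primitive:
  fixes H :: "real \<Rightarrow> real"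
  assumes "\<And>x. (H has_real_derivative g x) (at x)" "smooth g"
  shows "smooth H"
  unfolding smooth_def
proof
  fix k
  have "Ck_fun (Suc k) H"
  proof (rule Ck_fun_SucI)
    show "(H has_derivative (\<lambda>h. g x * h)) (at x)" for x
      using assms(1) by (simp add: has_field_derivative_def)
    show "Ck_fun k (\<lambda>x. g x * h)" for h
      using assms(2) by (intro Ck_fun_mult Ck_fun_const) (auto simp: smooth_def)
  qed
  then show "Ck_fun k H" by (rule Ck_fun_Suc_imp)
qed

lemma smooth_compose_linear:
  fixes A :: "'a::euclidean_space \<Rightarrow> 'b::euclidean_space"
  assumes A: "bounded_linear A" and f: "smooth f"
  shows "smooth (\<lambda>x. f (A x))"
proof -
  have "Ck_fun k (\<lambda>x. f (A x))" if "Ck_fun k f" for k f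
    using that
  proof (induction k arbitrary: f)
    case 0
    then have "continuous_on UNIV f" by simp
    then have "continuous_on UNIV (\<lambda>x. f (A x))"
      by (rule continuous_on_compose2[OF _ linear_continuous_on[OF A]]) auto
    then show ?case by simp
  next
    case (Suc k)
    show ?case
    proof (rule Ck_fun_SucI)
      show "((\<lambda>x. f (A x)) has_derivative (\<lambda>h. frechet_derivative f (at (A x)) (A h))) (at x)" for x
        by (rule has_derivative_compose[OF bounded_linear_imp_has_derivative[OF A]
              Ck_fun_Suc_has_derivative[OF Suc.prems]])
      show "Ck_fun k (\<lambda>x. frechet_derivative f (at (A x)) (A h))" for h
        by (rule Suc.IH) (use Suc.prems in auto)
    qed
  qed
  then show ?thesis using f by (simp add: smooth_def)
qed

lemma smooth_linear: "bounded_linear (A :: 'a::euclidean_space \<Rightarrow> real) \<Longrightarrow> smooth A"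
proof -
  assume A: "bounded_linear A"
  have "smooth (\<lambda>x::real. x)"
    by (rule smooth_primitive[where g = "\<lambda>_. 1"]) auto
  from smooth_compose_linear[OF A this] show ?thesis .
qed

lemma smooth_compose:
  fixes f :: "'a::euclidean_space \<Rightarrow> real" and \<beta> :: "real \<Rightarrow> real"
  assumes "smooth \<beta>" "smooth f"
  shows "smooth (\<lambda>x. \<beta> (f x))"
proof -
  have "Ck_fun k (\<lambda>x. \<beta> (f x))" if "smooth \<beta>" "Ck_fun k f" for k and \<beta> :: "real \<Rightarrow> real"
    using that
  proof (induction k arbitrary: \<beta>)
    case 0
    then have f: "continuous_on UNIV f" by simp
    have "continuous_on UNIV (\<lambda>x. \<beta> (f x))"
      by (rule continuous_on_compose2[OF smooth_continuous[OF 0(1)] f]) auto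
    then show ?case by simp
  next
    case (Suc k)
    show ?case
    proof (rule Ck_fun_SucI)
      show "((\<lambda>x. \<beta> (f x)) has_derivative
          (\<lambda>h. frechet_derivative \<beta> (at (f x)) 1 * frechet_derivative f (at x) h)) (at x)" for x
      proof -
        have d: "(\<beta> has_derivative frechet_derivative \<beta> (at (f x))) (at (f x))"
          by (rule smooth_has_derivative[OF Suc.prems(1)])
        define c where "c = frechet_derivative \<beta> (at (f x)) 1"
        have eq: "frechet_derivative \<beta> (at (f x)) = (\<lambda>y. c * y)"
        proof
          fix y :: real
          have "frechet_derivative \<beta> (at (f x)) (y *\<^sub>R 1) = y *\<^sub>R frechet_derivative \<beta> (at (f x)) 1"
            by (rule linear.scaleR[OF has_derivative_linear[OF d]])
          then show "frechet_derivative \<beta> (at (f x)) y = c * y" by (simp add: c_def)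
        qed
        show ?thesis
          using has_derivative_compose[OF Ck_fun_Suc_has_derivative[OF Suc.prems(2)] d[unfolded eq]]
          unfolding c_def .
      qed
      show "Ck_fun k (\<lambda>x. frechet_derivative \<beta> (at (f x)) 1 * frechet_derivative f (at x) h)" for h
      proof (rule Ck_fun_mult)
        show "Ck_fun k (\<lambda>x. frechet_derivative \<beta> (at (f x)) 1)"
          by (rule Suc.IH[OF smooth_frechet_derivative[OF Suc.prems(1)] Ck_fun_Suc_imp[OF Suc.prems(2)]])
        show "Ck_fun k (\<lambda>x. frechet_derivative f (at x) h)" using Suc.prems(2) by simp
      qed
    qed
  qed
  then show ?thesis using assms by (simp add: smooth_def)
qed

lemma smooth_sin_cos: "smooth (sin :: real \<Rightarrow> real)" "smooth (cos :: real \<Rightarrow> real)"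
proof -
  define F where "F = (\<lambda>(a, b) x. a * sin x + b * cos x :: real)"
  have s: "smooth (F p)" for p
  proof (rule smooth_family[where F = "range F"])
    fix f assume "f \<in> range F"
    then obtain a b where f: "f = F (a, b)" by auto
    have "(f has_real_derivative F (- b, a) x) (at x)" for x
      unfolding f F_def by (auto intro!: derivative_eq_intros)
    then show "\<exists>g\<in>range F. \<forall>x. (f has_real_derivative g x) (at x)" by auto
  qed auto
  show "smooth (sin :: real \<Rightarrow> real)" using s[of "(1, 0)"] by (simp add: F_def)
  show "smooth (cos :: real \<Rightarrow> real)" using s[of "(0, 1)"] by (simp add: F_def)
qed

text \<open>
  The standard smooth function that is flat at \<open>0\<close>. It serves as a bump, and through
  \<open>exp_flat (n y) \<longlonglongrightarrow> 1\<^bsub>y > 0\<^esub>\<close> also as a smooth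
  replacement of the indicator of a set of positivity.
\<close>

definition exp_flat :: "real \<Rightarrow> real" where
  "exp_flat t = (if 0 < t then exp (- 1 / t) else 0)"

lemma poly_exp_decay: "((\<lambda>y. poly P y * exp (- y)) \<longlongrightarrow> 0) (at_top :: real filter)"
proof -
  have "((\<lambda>y. \<Sum>i\<le>degree P. coeff P i * (y ^ i / exp y)) \<longlongrightarrow> (\<Sum>i\<le>degree P. coeff P i * 0)) at_top"
    by (intro tendsto_intros tendsto_power_div_exp_0)
  moreover have "(\<Sum>i\<le>degree P. coeff P i * (y ^ i / exp y)) = poly P y * exp (- y)" for y :: real
    by (simp add: poly_altdef sum_distrib_right exp_minus divide_inverse mult.assoc)
  ultimately show ?thesis by simp
qed

text \<open>
  All derivatives have the form \<open>P (1/t) exp (- 1 / t)\<close> for a polynomial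
  \<open>P\<close>, and the decay of the exponential makes each of them differentiable at
  \<open>0\<close> with derivative \<open>0\<close>.
\<close>

lemma smooth_exp_flat: "smooth exp_flat"
proof -
  define G where "G P t = (if 0 < t then poly P (1/t) * exp (- 1 / t) else 0)" for P :: "real poly" and t :: real
  have der: "(G P has_real_derivative G ([:0, 0, 1:] * (P - pderiv P)) t) (at t)" (is "(_ has_real_derivative G ?Q t) _") for P t
  proof -
    consider "t < 0" | "t = 0" | "0 < t" by linarith
    then show ?thesis
    proof cases
      case 1
      have "((\<lambda>_. 0) has_real_derivative 0) (at t)" by simp
      then have "(G P has_real_derivative 0) (at t)"
        by (rule has_field_derivative_transform_within_open[where S = "{..<0}"])
          (use 1 in \<open>auto simp: G_def\<close>)
      then show ?thesis using 1 by (simp add: G_def)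
    next
      case 3
      have "((\<lambda>t. poly P (1/t) * exp (- 1 / t)) has_real_derivative
          (poly (pderiv P) (1/t) * (- 1 / (t * t)) * exp (- 1 / t) + (exp (- 1 / t) * (1 / (t * t))) * poly P (1/t))) (at t)"
        using 3 by (auto intro!: derivative_eq_intros DERIV_chain2[OF poly_DERIV] simp: power2_eq_square field_simps)
      then have "(G P has_real_derivative
          (poly (pderiv P) (1/t) * (- 1 / (t * t)) * exp (- 1 / t) + (exp (- 1 / t) * (1 / (t * t))) * poly P (1/t))) (at t)"
        by (rule has_field_derivative_transform_within_open[where S = "{0<..}"])
          (use 3 in \<open>auto simp: G_def\<close>)
      moreover have "poly (pderiv P) (1/t) * (- 1 / (t * t)) * exp (- 1 / t) + (exp (- 1 / t) * (1 / (t * t))) * poly P (1/t)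
          = G ?Q t"
        using 3 by (simp add: G_def field_simps)
      ultimately show ?thesis by simp
    next
      case 2
      have "((\<lambda>h. G P h / h) \<longlongrightarrow> 0) (at_right 0)"
      proof -
        have "((\<lambda>h. poly (pCons 0 P) (inverse h) * exp (- inverse h)) \<longlongrightarrow> 0) (at_right 0)"
          by (rule filterlim_compose[OF poly_exp_decay filterlim_inverse_at_top_right])
        then show ?thesis
          by (rule Lim_transform_eventually)
            (auto simp: eventually_at_filter G_def field_simps)
      qed
      moreover have "((\<lambda>h. G P h / h) \<longlongrightarrow> 0) (at_left 0)"
        by (rule Lim_transform_eventually[OF tendsto_const])
          (auto simp: eventually_at_filter G_def)
      ultimately have "((\<lambda>h. G P h / h) \<longlongrightarrow> 0) (at 0)" by (simp add: filterlim_split_at)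
      then have "(G P has_real_derivative 0) (at 0)"
        by (simp add: has_field_derivative_iff G_def)
      then show ?thesis using 2 by (simp add: G_def)
    qed
  qed
  have "smooth (G P)" for P
    by (rule smooth_family[where F = "range G"]) (use der in \<open>auto\<close>)
  moreover have "exp_flat = G 1" by (auto simp: exp_flat_def G_def)
  ultimately show ?thesis by metis
qed

lemma exp_flat_props: "0 \<le> exp_flat t" "exp_flat t \<le> 1" "exp_flat t = 0 \<longleftrightarrow> t \<le> 0" "0 < exp_flat t \<longleftrightarrow> 0 < t"
  by (auto simp: exp_flat_def)

lemma exp_flat_scaled_LIMSEQ:
  "(\<lambda>n. exp_flat (real n * y)) \<longlonglongrightarrow> indicator {0<..} y"
proof (cases "0 < y")
  case True
  have "(\<lambda>n. exp (- (1 / y) * (1 / real n))) \<longlonglongrightarrow> exp (- (1 / y) * 0)"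
    by (intro tendsto_intros lim_const_over_n)
  moreover have "eventually (\<lambda>n. exp (- (1 / y) * (1 / real n)) = exp_flat (real n * y)) sequentially"
    using eventually_gt_at_top[of 0] by eventually_elim (use True in \<open>auto simp: exp_flat_def field_simps\<close>)
  ultimately show ?thesis using True by (auto intro: Lim_transform_eventually)
next
  case False
  then have "exp_flat (real n * y) = 0" for n by (auto simp: exp_flat_def zero_less_mult_iff)
  then show ?thesis using False by simp
qed

lemma exists_primitive:
  fixes g :: "real \<Rightarrow> real"
  assumes "continuous_on UNIV g"
  shows "\<exists>H. \<forall>x. (H has_real_derivative g x) (at x)"
proof (intro exI allI)
  fix x :: real
  have "((\<lambda>u. LBINT y=ereal 0..ereal u. g y) has_vector_derivative g x) (at x within {-\<bar>x\<bar>-1..\<bar>x\<bar>+1})"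
    by (rule interval_integral_FTC2) (use assms in \<open>auto intro: continuous_on_subset\<close>)
  then have "((\<lambda>u. LBINT y=ereal 0..ereal u. g y) has_vector_derivative g x) (at x)"
    by (subst (asm) at_within_interior) auto
  then show "((\<lambda>u. LBINT y=ereal 0..ereal u. g y) has_real_derivative g x) (at x)"
    by (simp add: has_real_derivative_iff_has_vector_derivative)
qed

text \<open>
  The normalised primitive of a bump supported in \<open>[a, b]\<close>.
\<close>

lemma smooth_step:
  assumes "a < (b::real)"
  obtains H \<zeta> where "smooth H" "smooth \<zeta>" "\<And>t. (H has_real_derivative \<zeta> t) (at t)"
    "\<And>t. 0 \<le> \<zeta> t" "\<And>t. t \<le> a \<or> b \<le> t \<Longrightarrow> \<zeta> t = 0"
    "\<And>t. t \<le> a \<Longrightarrow> H t = 0" "\<And>t. b \<le> t \<Longrightarrow> H t = 1" "\<And>t. 0 \<le> H t" "\<And>t. H t \<le> 1"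
proof -
  define g where "g t = exp_flat (t - a) * exp_flat (b - t)" for t
  have lin: "smooth (\<lambda>t::real. t)" by (intro smooth_linear bounded_linear_ident)
  have sg: "smooth g" unfolding g_def
    by (intro smooth_mult smooth_compose[OF smooth_exp_flat] smooth_diff lin smooth_const)
  obtain G where G: "\<And>x. (G has_real_derivative g x) (at x)"
    using exists_primitive[OF smooth_continuous[OF sg]] by auto
  have g0: "0 \<le> g t" for t by (simp add: g_def exp_flat_props)
  have mono: "G s \<le> G t" if "s \<le> t" for s t
    by (rule DERIV_nonneg_imp_nondecreasing[OF that]) (use G g0 in blast)
  have pos: "G a < G b"
  proof (rule DERIV_pos_imp_increasing_open[OF assms])
    show "\<exists>y. (G has_real_derivative y) (at x) \<and> 0 < y" if "a < x" "x < b" for x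
      using G that by (intro exI[of _ "g x"]) (auto simp: g_def exp_flat_props)
    show "continuous_on {a..b} G" using G by (auto intro!: continuous_at_imp_continuous_on DERIV_isCont)
  qed
  have const: "G s = G t" if "s \<le> t" "t \<le> a \<or> b \<le> s" for s t
  proof (cases "s = t")
    case False
    have "\<exists>z. s < z \<and> z < t \<and> G t - G s = (t - s) * g z"
      by (rule MVT2) (use False that G in auto)
    then show ?thesis using that by (auto simp: g_def exp_flat_def)
  qed simp
  define c where "c = G b - G a"
  have c: "0 < c" using pos by (simp add: c_def)
  define H where "H t = (1 / c) * (G t - G a)" for t
  show thesis
  proof
    show der: "(H has_real_derivative (1 / c) * g t) (at t)" for t
    proof -
      have "((\<lambda>t. G t - G a) has_real_derivative g t - 0) (at t)" by (intro DERIV_diff G DERIV_const)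
      from DERIV_cmult[OF this, of "1 / c"] show ?thesis unfolding H_def by simp
    qed
    show s: "smooth (\<lambda>t. (1 / c) * g t)" by (intro smooth_mult smooth_const sg)
    show "smooth H" by (rule smooth_primitive[OF der s])
    show "0 \<le> (1 / c) * g t" for t using c g0 by auto
    show "(1 / c) * g t = 0" if "t \<le> a \<or> b \<le> t" for t using that by (auto simp: g_def exp_flat_def)
    show "H t = 0" if "t \<le> a" for t using const[of t a] that by (simp add: H_def)
    show H1: "H t = 1" if "b \<le> t" for t using const[of b t] that c by (simp add: H_def c_def)
    show "0 \<le> H t" for t
    proof (cases "t \<le> a")
      case True then show ?thesis using const[of t a] by (simp add: H_def)
    next
      case False then show ?thesis using mono[of a t] c by (simp add: H_def)
    qed
    show "H t \<le> 1" for t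
    proof (cases "b \<le> t")
      case True then show ?thesis using H1[OF True] by simp
    next
      case False
      then have "G t - G a \<le> c" using mono[of t b] by (simp add: c_def)
      then show ?thesis using c by (simp add: H_def)
    qed
  qed
qed

section \<open>Signed measures and Radon-Nikodym densities\<close>

definition signed_measure :: "'a measure \<Rightarrow> ('a set \<Rightarrow> real) \<Rightarrow> bool" where
  "signed_measure M \<nu> \<longleftrightarrow> \<nu> {} = 0 \<and>
     (\<forall>A::nat \<Rightarrow> 'a set. range A \<subseteq> sets M \<longrightarrow> disjoint_family A \<longrightarrow>
        (\<lambda>i. \<nu> (A i)) sums \<nu> (\<Union>i. A i))"

lemma signed_measure_uminus: "signed_measure M \<nu> \<Longrightarrow> signed_measure M (\<lambda>A. - \<nu> A)"
  unfolding signed_measure_def by (auto intro: sums_minus)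

lemma signed_measure_Un:
  assumes \<nu>: "signed_measure M \<nu>" and "A \<in> sets M" "B \<in> sets M" "A \<inter> B = {}"
  shows "\<nu> (A \<union> B) = \<nu> A + \<nu> B"
proof -
  have "(\<lambda>i. \<nu> (binaryset A B i)) sums \<nu> (\<Union>i. binaryset A B i)"
    using assms disjoint_family_on_disjoint_image
    by (intro \<nu>[unfolded signed_measure_def, THEN conjunct2, rule_format])
      (auto simp: range_binaryset_eq disjoint_family_on_def binaryset_def)
  moreover have "(\<lambda>i. \<nu> (binaryset A B i)) sums (\<nu> A + \<nu> B)"
    by (rule binaryset_sums) (use \<nu> in \<open>auto simp: signed_measure_def\<close>)
  ultimately show ?thesis by (simp add: UN_binaryset_eq sums_unique2)
qed

lemma signed_measure_Diff:
  assumes \<nu>: "signed_measure M \<nu>" and "A \<in> sets M" "B \<in> sets M" "B \<subseteq> A"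
  shows "\<nu> (A - B) = \<nu> A - \<nu> B"
proof -
  have "\<nu> (B \<union> (A - B)) = \<nu> B + \<nu> (A - B)"
    by (rule signed_measure_Un[OF \<nu>]) (use assms in auto)
  moreover have "B \<union> (A - B) = A" using assms by auto
  ultimately show ?thesis by simp
qed

text \<open>
  A set on which \<open>\<nu>\<close> is unbounded contains a set \<open>B\<close> with
  \<open>\<bar>\<nu> B\<bar> > \<bar>\<nu> A\<bar> + 1\<close>; then \<open>B\<close> and its
  complement in \<open>A\<close> both have values of modulus greater than \<open>1\<close>, and
  \<open>\<nu>\<close> is unbounded on one of them. Repeating this inside the unbounded half splits
  off infinitely many disjoint sets with values of modulus greater than \<open>1\<close>, which
  contradicts countable additivity.
\<close>

lemma signed_measure_bounded:
  assumes \<nu>: "signed_measure M \<nu>"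
  shows "\<exists>K. \<forall>B\<in>sets M. \<bar>\<nu> B\<bar> \<le> K"
proof (rule ccontr)
  assume contra: "\<nexists>K. \<forall>B\<in>sets M. \<bar>\<nu> B\<bar> \<le> K"
  define unb where "unb A \<longleftrightarrow> A \<in> sets M \<and> (\<forall>K. \<exists>B\<in>sets M. B \<subseteq> A \<and> K < \<bar>\<nu> B\<bar>)" for A
  have "unb (space M)"
    using contra sets.sets_into_space unfolding unb_def by (meson not_le sets.top)
  have step: "\<exists>A'. unb A' \<and> A' \<subseteq> A \<and> 1 < \<bar>\<nu> (A - A')\<bar>" if A: "unb A" for A
  proof -
    obtain B where B: "B \<in> sets M" "B \<subseteq> A" "\<bar>\<nu> A\<bar> + 1 < \<bar>\<nu> B\<bar>" using A unfolding unb_def by blast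
    have Am: "A \<in> sets M" using A by (simp add: unb_def)
    have d: "\<nu> (A - B) = \<nu> A - \<nu> B" by (rule signed_measure_Diff[OF \<nu> Am B(1,2)])
    have "unb B \<or> unb (A - B)"
    proof (rule ccontr)
      assume "\<not> (unb B \<or> unb (A - B))"
      then obtain K1 K2 where K: "\<And>C. C \<in> sets M \<Longrightarrow> C \<subseteq> B \<Longrightarrow> \<bar>\<nu> C\<bar> \<le> K1"
        "\<And>C. C \<in> sets M \<Longrightarrow> C \<subseteq> A - B \<Longrightarrow> \<bar>\<nu> C\<bar> \<le> K2"
        using B Am unfolding unb_def by (metis not_le sets.Diff)
      obtain C where C: "C \<in> sets M" "C \<subseteq> A" "K1 + K2 < \<bar>\<nu> C\<bar>" using A unfolding unb_def by blast
      have "\<nu> ((C \<inter> B) \<union> (C - B)) = \<nu> (C \<inter> B) + \<nu> (C - B)"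
        by (rule signed_measure_Un[OF \<nu>]) (use B C in auto)
      moreover have "(C \<inter> B) \<union> (C - B) = C" by auto
      ultimately have "\<nu> C = \<nu> (C \<inter> B) + \<nu> (C - B)" by metis
      moreover have "\<bar>\<nu> (C \<inter> B)\<bar> \<le> K1" using B C by (intro K) auto
      moreover have "\<bar>\<nu> (C - B)\<bar> \<le> K2" using B C by (intro K) auto
      ultimately show False using C by linarith
    qed
    then show ?thesis
    proof
      assume "unb B" then show ?thesis using B d by (intro exI[of _ B]) auto
    next
      assume "unb (A - B)"
      moreover have "A - (A - B) = B" using B by auto
      ultimately show ?thesis using B d by (intro exI[of _ "A - B"]) auto
    qed
  qed
  \<comment> \<open>Each step keeps a subset on which \<open>\<nu>\<close> is still unbounded and splits off a
    set of mass greater than \<open>1\<close>.\<close>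
  have "\<exists>f. \<forall>n. unb (f n) \<and> (f (Suc n) \<subseteq> f n \<and> 1 < \<bar>\<nu> (f n - f (Suc n))\<bar>)"
    using \<open>unb (space M)\<close> step by (intro dependent_nat_choice) auto
  then obtain f where f: "\<And>n. unb (f n)" "\<And>n. f (Suc n) \<subseteq> f n" "\<And>n. 1 < \<bar>\<nu> (f n - f (Suc n))\<bar>"
    by blast
  have dec: "f n \<subseteq> f m" if "m \<le> n" for m n using that f(2) by (rule lift_Suc_antimono_le[rotated]) 
  have "disjoint_family (\<lambda>n. f n - f (Suc n))"
    unfolding disjoint_family_on_def
  proof (intro ballI impI)
    fix m n :: nat assume "m \<noteq> n"
    then consider "Suc m \<le> n" | "Suc n \<le> m" by linarith
    then show "(f m - f (Suc m)) \<inter> (f n - f (Suc n)) = {}"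
      by cases (use dec in blast)+
  qed
  then have "(\<lambda>n. \<nu> (f n - f (Suc n))) sums \<nu> (\<Union>n. f n - f (Suc n))"
    using f(1) by (intro \<nu>[unfolded signed_measure_def, THEN conjunct2, rule_format]) (auto simp: unb_def)
  then have "(\<lambda>n. \<nu> (f n - f (Suc n))) \<longlonglongrightarrow> 0" by (intro summable_LIMSEQ_zero sums_summable)
  then have "(\<lambda>n. \<bar>\<nu> (f n - f (Suc n))\<bar>) \<longlonglongrightarrow> 0" by (rule tendsto_rabs_zero)
  from order_tendstoD(2)[OF this, of 1]
  have "eventually (\<lambda>n. \<bar>\<nu> (f n - f (Suc n))\<bar> < 1) sequentially" by simp
  then show False using f(3) by (auto simp: eventually_sequentially) (meson less_asym order_refl)
qed

lemma ennreal_add_le: "ennreal (a + b) \<le> ennreal a + ennreal b"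
proof -
  consider "0 \<le> a" "0 \<le> b" | "a \<le> 0" | "b \<le> 0" by linarith
  then show ?thesis
  proof cases
    case 2
    then have "ennreal (a + b) \<le> ennreal b" by (intro ennreal_leI) simp
    then show ?thesis using 2 by (simp add: ennreal_neg)
  next
    case 3
    then have "ennreal (a + b) \<le> ennreal a" by (intro ennreal_leI) simp
    then show ?thesis using 3 by (simp add: ennreal_neg)
  qed (simp add: ennreal_plus)
qed

text \<open>
  \<open>pos_variation\<close> is built by \<open>measure_of\<close>, so its values are known only
  once the supremum is seen to be countably additive: it is superadditive on disjoint unions because
  parts of negative mass may be dropped, and subadditive because \<open>\<nu>\<close> itself is
  additive.
\<close>

lemma emeasure_pos_variation:
  assumes \<nu>: "signed_measure M \<nu>" and A: "A \<in> sets M"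
  shows "emeasure (pos_variation M \<nu>) A = (SUP B\<in>{B\<in>sets M. B \<subseteq> A}. ennreal (\<nu> B))"
proof -
  define P where "P A = (SUP B\<in>{B\<in>sets M. B \<subseteq> A}. ennreal (\<nu> B))" for A
  have le: "ennreal (\<nu> B) \<le> P A" if "B \<in> sets M" "B \<subseteq> A" for A B
    unfolding P_def by (rule SUP_upper) (use that in auto)
  have ge: "P A \<le> c" if "\<And>B. B \<in> sets M \<Longrightarrow> B \<subseteq> A \<Longrightarrow> ennreal (\<nu> B) \<le> c" for A c
    unfolding P_def by (rule SUP_least) (use that in auto)
  have \<nu>0: "\<nu> {} = 0" using \<nu> by (simp add: signed_measure_def)
  have P0: "P {} = 0"
    using ge[of "{}" 0] \<nu>0 by auto
  have super: "P A + P B \<le> P (A \<union> B)" if AB: "A \<in> sets M" "B \<in> sets M" "A \<inter> B = {}" for A B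
  proof -
    have "ennreal (\<nu> C) + ennreal (\<nu> D) \<le> P (A \<union> B)"
      if C: "C \<in> sets M" "C \<subseteq> A" and D: "D \<in> sets M" "D \<subseteq> B" for C D
    proof -
      consider "\<nu> C \<le> 0" | "\<nu> D \<le> 0" | "0 \<le> \<nu> C" "0 \<le> \<nu> D" by linarith
      then show ?thesis
      proof cases
        case 1 then show ?thesis using le[of D "A \<union> B"] D by (simp add: ennreal_neg le_supI2)
      next
        case 2 then show ?thesis using le[of C "A \<union> B"] C by (simp add: ennreal_neg le_supI1)
      next
        case 3
        have "\<nu> (C \<union> D) = \<nu> C + \<nu> D"
          by (rule signed_measure_Un[OF \<nu>]) (use C D AB in auto)
        moreover have "ennreal (\<nu> (C \<union> D)) \<le> P (A \<union> B)" by (rule le) (use C D in auto)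
        ultimately show ?thesis using 3 by (simp add: ennreal_plus)
      qed
    qed
    note main = this
    have "ennreal (\<nu> C) + P B \<le> P (A \<union> B)" if C: "C \<in> sets M" "C \<subseteq> A" for C
      unfolding P_def[of B]
      by (subst ennreal_SUP_add_right) (use main[OF C] in \<open>auto intro!: SUP_least\<close>)
    then show ?thesis
      unfolding P_def[of A]
      by (subst ennreal_SUP_add_left[symmetric]) (auto intro!: SUP_least)
  qed
  have mono: "P A \<le> P B" if "A \<subseteq> B" for A B by (rule ge) (use le that in blast)
  have "countably_additive (sets M) P"
  proof (rule countably_additiveI)
    fix A :: "nat \<Rightarrow> 'a set"
    assume A: "range A \<subseteq> sets M" "disjoint_family A" "\<Union> (range A) \<in> sets M"
    show "(\<Sum>i. P (A i)) = P (\<Union> (range A))"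
    proof (rule antisym)
      have fin: "(\<Sum>i<n. P (A i)) \<le> P (\<Union>i<n. A i)" for n
      proof (induction n)
        case 0 then show ?case using P0 by simp
      next
        case (Suc n)
        have "(\<Sum>i<Suc n. P (A i)) \<le> P (\<Union>i<n. A i) + P (A n)" using Suc by (simp add: add_right_mono)
        also have "\<dots> \<le> P ((\<Union>i<n. A i) \<union> A n)"
        proof (rule super)
          show "(\<Union>i<n. A i) \<inter> A n = {}" using A(2) unfolding disjoint_family_on_def
            by auto (metis IntI empty_iff less_irrefl)
        qed (use A in auto)
        also have "(\<Union>i<n. A i) \<union> A n = (\<Union>i<Suc n. A i)" by (auto simp: less_Suc_eq)
        finally show ?case .
      qed
      show "(\<Sum>i. P (A i)) \<le> P (\<Union> (range A))"
        by (rule suminf_le_const) (auto intro!: order_trans[OF fin] mono)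
      show "P (\<Union> (range A)) \<le> (\<Sum>i. P (A i))"
      proof (rule ge)
        fix B assume B: "B \<in> sets M" "B \<subseteq> \<Union> (range A)"
        have "(\<lambda>i. \<nu> (B \<inter> A i)) sums \<nu> (\<Union>i. B \<inter> A i)"
          using A B by (intro \<nu>[unfolded signed_measure_def, THEN conjunct2, rule_format])
            (auto simp: disjoint_family_on_def)
        moreover have "(\<Union>i. B \<inter> A i) = B" using B by auto
        ultimately have lim: "(\<lambda>n. ennreal (\<Sum>i<n. \<nu> (B \<inter> A i))) \<longlonglongrightarrow> ennreal (\<nu> B)"
          by (auto simp: sums_def)
        have "ennreal (\<Sum>i<n. \<nu> (B \<inter> A i)) \<le> (\<Sum>i<n. P (A i))" for n
        proof (induction n)
          case (Suc n)
          have "ennreal (\<Sum>i<Suc n. \<nu> (B \<inter> A i)) \<le> ennreal (\<Sum>i<n. \<nu> (B \<inter> A i)) + ennreal (\<nu> (B \<inter> A n))"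
            by (simp add: ennreal_add_le)
          also have "\<dots> \<le> (\<Sum>i<n. P (A i)) + P (A n)"
            using A B by (intro add_mono Suc le) auto
          finally show ?case by simp
        qed auto
        then have "ennreal (\<Sum>i<n. \<nu> (B \<inter> A i)) \<le> (\<Sum>i. P (A i))" for n
          by (rule order_trans) (auto intro: sum_le_suminf)
        then show "ennreal (\<nu> B) \<le> (\<Sum>i. P (A i))"
          by (intro LIMSEQ_le_const2[OF lim]) auto
      qed
    qed
  qed
  then show ?thesis
    unfolding pos_variation_def P_def[symmetric]
    by (intro emeasure_measure_of_sigma A sets.sigma_algebra_axioms) (auto simp: positive_def P0)
qed

lemma sets_pos_variation [simp]: "sets (pos_variation M \<nu>) = sets M"
  and space_pos_variation [simp]: "space (pos_variation M \<nu>) = space M"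
  by (simp_all add: pos_variation_def)

lemma finite_measure_pos_variation:
  assumes \<nu>: "signed_measure M \<nu>"
  shows "finite_measure (pos_variation M \<nu>)"
proof
  obtain K where K: "\<forall>B\<in>sets M. \<bar>\<nu> B\<bar> \<le> K" using signed_measure_bounded[OF \<nu>] by auto
  have "emeasure (pos_variation M \<nu>) (space M) \<le> ennreal K"
    unfolding emeasure_pos_variation[OF \<nu> sets.top]
    by (rule SUP_least) (use K in \<open>auto intro!: ennreal_leI simp: abs_le_iff\<close>)
  then show "emeasure (pos_variation M \<nu>) (space (pos_variation M \<nu>)) \<noteq> \<infinity>"
    by (auto simp: top_unique)
qed

text \<open>
  Passing from \<open>B\<close> to \<open>A - B\<close> exchanges the two suprema up to the constant
  \<open>\<nu> A\<close>.
\<close>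

lemma jordan_decomposition:
  assumes \<nu>: "signed_measure M \<nu>" and A: "A \<in> sets M"
  shows "\<nu> A = measure (pos_variation M \<nu>) A - measure (pos_variation M (\<lambda>A. - \<nu> A)) A"
proof -
  have le: "measure (pos_variation M \<nu>) A \<le> \<nu> A + measure (pos_variation M (\<lambda>A. - \<nu> A)) A"
    if \<nu>: "signed_measure M \<nu>" for \<nu>
  proof -
    note \<nu>' = signed_measure_uminus[OF \<nu>]
    interpret N: finite_measure "pos_variation M (\<lambda>A. - \<nu> A)" by (rule finite_measure_pos_variation[OF \<nu>'])
    have *: "- \<nu> B \<le> measure (pos_variation M (\<lambda>A. - \<nu> A)) A" if "B \<in> sets M" "B \<subseteq> A" for B
    proof -
      have "ennreal (- \<nu> B) \<le> emeasure (pos_variation M (\<lambda>A. - \<nu> A)) A"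
        unfolding emeasure_pos_variation[OF \<nu>' A] by (rule SUP_upper) (use that in auto)
      then show ?thesis
        using measure_nonneg[of "pos_variation M (\<lambda>A. - \<nu> A)" A]
        by (cases "- \<nu> B \<le> 0") (auto simp: N.emeasure_eq_measure simp del: measure_nonneg)
    qed
    have n0: "0 \<le> \<nu> A + measure (pos_variation M (\<lambda>A. - \<nu> A)) A" using *[of A] A by simp
    have "emeasure (pos_variation M \<nu>) A \<le> ennreal (\<nu> A + measure (pos_variation M (\<lambda>A. - \<nu> A)) A)"
      unfolding emeasure_pos_variation[OF \<nu> A]
    proof (rule SUP_least)
      fix B assume "B \<in> {B \<in> sets M. B \<subseteq> A}"
      then have B: "B \<in> sets M" "B \<subseteq> A" by auto
      have "\<nu> (A - B) = \<nu> A - \<nu> B" by (rule signed_measure_Diff[OF \<nu> A B])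
      moreover have "- \<nu> (A - B) \<le> measure (pos_variation M (\<lambda>A. - \<nu> A)) A" using A B by (intro *) auto
      ultimately show "ennreal (\<nu> B) \<le> ennreal (\<nu> A + measure (pos_variation M (\<lambda>A. - \<nu> A)) A)"
        by (intro ennreal_leI) simp
    qed
    then show ?thesis using n0 by (simp add: measure_def enn2real_leI)
  qed
  show ?thesis using le[OF \<nu>] le[OF signed_measure_uminus[OF \<nu>]] by simp
qed

lemma pos_variation_density:
  assumes \<nu>: "signed_measure M \<nu>" and M: "sets M = sets \<mu>" and fin: "finite_measure \<mu>"
    and ac: "\<And>A. A \<in> sets \<mu> \<Longrightarrow> emeasure \<mu> A = 0 \<Longrightarrow> \<nu> A = 0"
  obtains h where "integrable \<mu> h" "\<And>x. 0 \<le> h x" "pos_variation M \<nu> = density \<mu> (\<lambda>x. ennreal (h x))"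
proof -
  interpret finite_measure \<mu> by fact
  have fP: "finite_measure (pos_variation M \<nu>)" by (rule finite_measure_pos_variation[OF \<nu>])
  have "absolutely_continuous \<mu> (pos_variation M \<nu>)"
    unfolding absolutely_continuous_def
  proof
    fix A assume A: "A \<in> null_sets \<mu>"
    then have Am: "A \<in> sets M" using M by auto
    have "\<nu> B = 0" if "B \<in> sets M" "B \<subseteq> A" for B
      using that A M by (intro ac) (auto intro: emeasure_eq_0 simp: null_sets_def)
    then have "emeasure (pos_variation M \<nu>) A = 0"
      unfolding emeasure_pos_variation[OF \<nu> Am] by (intro antisym SUP_least) auto
    then show "A \<in> null_sets (pos_variation M \<nu>)" using Am by (auto simp: null_sets_def)
  qed
  moreover have sP: "sets (pos_variation M \<nu>) = sets \<mu>" using M by simp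
  ultimately obtain D where D: "D \<in> borel_measurable \<mu>"
    "AE x in \<mu>. RN_deriv \<mu> (pos_variation M \<nu>) x = ennreal (D x)" "\<And>x. 0 \<le> D x"
    using real_RN_deriv[OF fP] by blast
  have dens: "density \<mu> (\<lambda>x. ennreal (D x)) = pos_variation M \<nu>"
  proof -
    have "density \<mu> (\<lambda>x. ennreal (D x)) = density \<mu> (RN_deriv \<mu> (pos_variation M \<nu>))"
      by (rule density_cong) (use D in auto)
    also have "\<dots> = pos_variation M \<nu>"
      using \<open>absolutely_continuous \<mu> _\<close> M by (intro density_RN_deriv) auto
    finally show ?thesis .
  qed
  have "(\<integral>\<^sup>+x. ennreal (D x) \<partial>\<mu>) = emeasure (density \<mu> (\<lambda>x. ennreal (D x))) (space \<mu>)"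
    using D by (subst emeasure_density) (auto intro!: nn_integral_cong)
  also have "\<dots> < \<infinity>"
    using finite_measure.emeasure_finite[OF fP] by (auto simp: dens top.not_eq_extremum)
  finally have "integrable \<mu> D" using D by (intro integrableI_nonneg) auto
  then show thesis using that D dens by metis
qed

text \<open>
  Both parts of the Jordan decomposition are absolutely continuous, and the difference of their
  densities represents \<open>\<nu>\<close> as a set function and as an integral.
\<close>

lemma signed_measure_radon_nikodym:
  assumes \<nu>: "signed_measure M \<nu>" and M: "sets M = sets \<mu>" and fin: "finite_measure \<mu>"
    and ac: "\<And>A. A \<in> sets \<mu> \<Longrightarrow> emeasure \<mu> A = 0 \<Longrightarrow> \<nu> A = 0"
  obtains h where "integrable \<mu> h" "\<And>A. A \<in> sets \<mu> \<Longrightarrow> \<nu> A = (LINT x:A|\<mu>. h x)"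
    "\<And>f K. f \<in> borel_measurable \<mu> \<Longrightarrow> (\<And>x. x \<in> space \<mu> \<Longrightarrow> \<bar>f x\<bar> \<le> K) \<Longrightarrow>
       signed_integral M \<nu> f = (LINT x|\<mu>. h x * f x)"
proof -
  obtain h1 where h1: "integrable \<mu> h1" "\<And>x. 0 \<le> h1 x" "pos_variation M \<nu> = density \<mu> (\<lambda>x. ennreal (h1 x))"
    using pos_variation_density[OF \<nu> M fin ac] by blast
  obtain h2 where h2: "integrable \<mu> h2" "\<And>x. 0 \<le> h2 x"
    "pos_variation M (\<lambda>A. - \<nu> A) = density \<mu> (\<lambda>x. ennreal (h2 x))"
    using pos_variation_density[OF signed_measure_uminus[OF \<nu>] M fin] ac by auto
  note [measurable] = borel_measurable_integrable[OF h1(1)] borel_measurable_integrable[OF h2(1)]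
  have meas: "measure (density \<mu> (\<lambda>x. ennreal (h x))) A = (LINT x:A|\<mu>. h x)"
    if h: "integrable \<mu> h" "\<And>x. 0 \<le> h x" and A: "A \<in> sets \<mu>" for h A
  proof -
    have "emeasure (density \<mu> (\<lambda>x. ennreal (h x))) A = (\<integral>\<^sup>+x. ennreal (indicator A x * h x) \<partial>\<mu>)"
      using h A by (subst emeasure_density) (auto intro!: nn_integral_cong split: split_indicator)
    also have "\<dots> = ennreal (LINT x|\<mu>. indicator A x * h x)"
      using h A integrable_mult_indicator[OF A h(1)] by (intro nn_integral_eq_integral) auto
    finally show ?thesis using h by (simp add: measure_def set_lebesgue_integral_def)
  qed
  have bint: "integrable \<mu> (\<lambda>x. h x * f x)"
    if "integrable \<mu> h" "f \<in> borel_measurable \<mu>" "\<And>x. x \<in> space \<mu> \<Longrightarrow> \<bar>f x\<bar> \<le> K" for h f :: "_ \<Rightarrow> real" and K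
  proof (rule Bochner_Integration.integrable_bound[where f = "\<lambda>x. h x * K"])
    show "AE x in \<mu>. norm (h x * f x) \<le> norm (h x * K)"
      using order_trans[OF that(3) abs_ge_self] by (auto simp: abs_mult intro!: mult_left_mono AE_I2)
  qed (use that in auto)
  show thesis
  proof (rule that[of "\<lambda>x. h1 x - h2 x"])
    show "integrable \<mu> (\<lambda>x. h1 x - h2 x)" using h1 h2 by auto
    show "\<nu> A = (LINT x:A|\<mu>. h1 x - h2 x)" if A: "A \<in> sets \<mu>" for A
    proof -
      have "\<nu> A = (LINT x:A|\<mu>. h1 x) - (LINT x:A|\<mu>. h2 x)"
        using jordan_decomposition[OF \<nu>, of A] A M h1 h2 by (simp add: meas)
      also have "\<dots> = (LINT x:A|\<mu>. h1 x - h2 x)"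
        by (intro set_integral_diff(2)[symmetric])
          (unfold set_integrable_def, (intro integrable_mult_indicator[OF A] h1(1) h2(1))+)
      finally show ?thesis .
    qed
    show "signed_integral M \<nu> f = (LINT x|\<mu>. (h1 x - h2 x) * f x)"
      if f: "f \<in> borel_measurable \<mu>" "\<And>x. x \<in> space \<mu> \<Longrightarrow> \<bar>f x\<bar> \<le> K" for f K
      unfolding signed_integral_def h1(3) h2(3)
      using f h1 h2 bint[OF h1(1) f] bint[OF h2(1) f]
      by (simp add: integral_real_density left_diff_distrib)
  qed
qed

lemma vector_measure_component:
  assumes "vector_measure M m"
  shows "signed_measure M (\<lambda>A. m A $ i)"
  using assms unfolding vector_measure_def signed_measure_def
  by (auto intro!: bounded_linear.sums[OF bounded_linear_vec_nth])

lemma vm_density_component: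
  assumes "integrable \<mu> v" "A \<in> sets \<mu>"
  shows "vm_density \<mu> v A $ i = (LINT p:A|\<mu>. v p $ i)"
  using integral_bounded_linear[OF bounded_linear_vec_nth integrable_mult_indicator[OF assms(2,1)], of i]
  by (simp add: vm_density_def set_lebesgue_integral_def)

lemma integrable_vec_nth: "integrable \<mu> (v :: _ \<Rightarrow> real^2) \<Longrightarrow> integrable \<mu> (\<lambda>p. v p $ i)"
  by (rule integrable_bounded_linear[OF bounded_linear_vec_nth])

text \<open>
  The choice in the definition of \<open>vm_RN\<close> is from a nonempty set.
\<close>

lemma vm_RN_exists:
  assumes m: "vector_measure M m" and M: "sets M = sets \<mu>" and fin: "finite_measure \<mu>"
    and ac: "vm_abs_cont m \<mu>"
  shows "integrable \<mu> (vm_RN \<mu> m)" "\<And>A. A \<in> sets \<mu> \<Longrightarrow> m A = vm_density \<mu> (vm_RN \<mu> m) A"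
proof -
  have "\<exists>h. integrable \<mu> h \<and> (\<forall>A\<in>sets \<mu>. m A $ i = (LINT x:A|\<mu>. h x))" for i
  proof -
    obtain h where "integrable \<mu> h" "\<And>A. A \<in> sets \<mu> \<Longrightarrow> m A $ i = (LINT x:A|\<mu>. h x)"
      using signed_measure_radon_nikodym[OF vector_measure_component[OF m, of i] M fin] ac
      unfolding vm_abs_cont_def by (metis zero_index)
    then show ?thesis by auto
  qed
  then obtain h where h: "\<And>i. integrable \<mu> (h i)" "\<And>A i. A \<in> sets \<mu> \<Longrightarrow> m A $ i = (LINT x:A|\<mu>. h i x)"
    by metis
  define v where "v p = (\<Sum>i\<in>UNIV. h i p *\<^sub>R axis i (1::real))" for p
  have vi: "v p $ i = h i p" for p i
    by (simp add: v_def axis_def if_distrib cong: if_cong)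
  have v: "integrable \<mu> v"
    unfolding v_def by (intro Bochner_Integration.integrable_sum integrable_scaleR_left h)
  have "m A = vm_density \<mu> v A" if "A \<in> sets \<mu>" for A
    unfolding vec_eq_iff vm_density_component[OF v that] h(2)[OF that] vi by simp
  with v have "integrable \<mu> v \<and> (\<forall>A\<in>sets \<mu>. m A = vm_density \<mu> v A)" by blast
  from someI[of "\<lambda>v. integrable \<mu> v \<and> (\<forall>A\<in>sets \<mu>. m A = vm_density \<mu> v A)", OF this]
  have "integrable \<mu> (vm_RN \<mu> m) \<and> (\<forall>A\<in>sets \<mu>. m A = vm_density \<mu> (vm_RN \<mu> m) A)"
    unfolding vm_RN_def .
  then show "integrable \<mu> (vm_RN \<mu> m)" "\<And>A. A \<in> sets \<mu> \<Longrightarrow> m A = vm_density \<mu> (vm_RN \<mu> m) A"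
    by blast+
qed

lemma vm_density_vector_measure:
  assumes v: "integrable \<mu> v" and M: "sets M = sets \<mu>"
  shows "vector_measure M (vm_density \<mu> v)"
  unfolding vector_measure_def
proof (intro conjI allI impI)
  show "vm_density \<mu> v {} = 0" by (simp add: vm_density_def set_lebesgue_integral_def)
  fix A :: "nat \<Rightarrow> 'a set" assume A: "range A \<subseteq> sets M" "disjoint_family A"
  have si: "set_integrable \<mu> B v" if "B \<in> sets \<mu>" for B
    unfolding set_integrable_def by (rule integrable_mult_indicator[OF that v])
  have Am: "A i \<in> sets \<mu>" for i using A M by auto
  have "(\<lambda>n. LINT p:(\<Union>i<n. A i)|\<mu>. v p) \<longlonglongrightarrow> (LINT p:(\<Union>n. \<Union>i<n. A i)|\<mu>. v p)"
  proof (rule set_integral_cont_up)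
    show "incseq (\<lambda>n. \<Union>i<n. A i)" by (rule incseq_SucI) (force simp: less_Suc_eq)
    show "set_integrable \<mu> (\<Union>n. \<Union>i<n. A i) v" using Am by (intro si) auto
  qed (use Am in auto)
  moreover have "(LINT p:(\<Union>i<n. A i)|\<mu>. v p) = (\<Sum>i<n. vm_density \<mu> v (A i))" for n
    unfolding vm_density_def using A Am si
    by (intro set_integral_finite_Union) (auto simp: disjoint_family_on_def)
  moreover have "(\<Union>n. \<Union>i<n. A i) = (\<Union>i. A i)" by auto
  ultimately show "(\<lambda>i. vm_density \<mu> v (A i)) sums vm_density \<mu> v (\<Union>i. A i)"
    by (simp add: sums_def vm_density_def)
qed

lemma vm_density_abs_cont: "vm_abs_cont (vm_density \<mu> v) \<mu>"
  unfolding vm_abs_cont_def vm_density_def set_lebesgue_integral_def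
proof (intro ballI impI)
  fix A assume "A \<in> sets \<mu>" "emeasure \<mu> A = 0"
  then have "A \<in> null_sets \<mu>" by auto
  then have "AE x in \<mu>. indicat_real A x *\<^sub>R v x = 0"
    by (intro eventually_mono[OF AE_not_in]) auto
  then show "(LINT x|\<mu>. indicat_real A x *\<^sub>R v x) = 0" by (rule integral_eq_zero_AE)
qed

text \<open>
  Integration against a vector measure, defined through Jordan decompositions, is integration
  against its density; this is the bridge between the continuity equation and \<open>D
  \<phi>\<close>.
\<close>

lemma vm_integral_density:
  assumes v: "integrable \<mu> v" and m: "\<And>A. A \<in> sets \<mu> \<Longrightarrow> m A = vm_density \<mu> v A"
    and mv: "vector_measure M m" and M: "sets M = sets \<mu>" and fin: "finite_measure \<mu>"
    and \<psi>: "\<And>i. (\<lambda>p. \<psi> p $ i) \<in> borel_measurable \<mu>" "\<And>p i. p \<in> space \<mu> \<Longrightarrow> \<bar>\<psi> p $ i\<bar> \<le> K"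
  shows "vm_integral M m \<psi> = (LINT p|\<mu>. v p \<bullet> \<psi> p)"
    and "integrable \<mu> (\<lambda>p. v p \<bullet> \<psi> p)"
proof -
  have int: "integrable \<mu> (\<lambda>p. v p $ i * \<psi> p $ i)" for i
  proof (rule Bochner_Integration.integrable_bound[where f = "\<lambda>x. v x $ i * K"])
    show "AE x in \<mu>. norm (v x $ i * \<psi> x $ i) \<le> norm (v x $ i * K)"
      using order_trans[OF \<psi>(2) abs_ge_self] by (auto simp: abs_mult intro!: mult_left_mono AE_I2)
    show "(\<lambda>x. v x $ i * \<psi> x $ i) \<in> borel_measurable \<mu>"
      using integrable_vec_nth[OF v, of i] \<psi>(1) by (auto intro: borel_measurable_times)
  qed (use integrable_vec_nth[OF v, of i] in auto)
  have "signed_integral M (\<lambda>A. m A $ i) (\<lambda>p. \<psi> p $ i) = (LINT p|\<mu>. v p $ i * \<psi> p $ i)" for i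
  proof -
    have ac: "m A $ i = 0" if "A \<in> sets \<mu>" "emeasure \<mu> A = 0" for A
      using vm_density_abs_cont[of \<mu> v] m[OF that(1)] that by (simp add: vm_abs_cont_def)
    obtain h where h: "integrable \<mu> h" "\<And>A. A \<in> sets \<mu> \<Longrightarrow> m A $ i = (LINT x:A|\<mu>. h x)"
      "\<And>f K. f \<in> borel_measurable \<mu> \<Longrightarrow> (\<And>x. x \<in> space \<mu> \<Longrightarrow> \<bar>f x\<bar> \<le> K) \<Longrightarrow>
         signed_integral M (\<lambda>A. m A $ i) f = (LINT x|\<mu>. h x * f x)"
      using signed_measure_radon_nikodym[OF vector_measure_component[OF mv, of i] M fin ac] by blast
    have "AE p in \<mu>. h p = v p $ i"
      by (rule density_unique_real[OF h(1) integrable_vec_nth[OF v]])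
        (use h(2) m vm_density_component[OF v] in metis)
    then have "(LINT p|\<mu>. h p * \<psi> p $ i) = (LINT p|\<mu>. v p $ i * \<psi> p $ i)"
      using h(1) \<psi>(1) int[of i] by (intro integral_cong_AE) (auto elim: eventually_mono)
    then show ?thesis using h(3)[OF \<psi>] by simp
  qed
  then show "vm_integral M m \<psi> = (LINT p|\<mu>. v p \<bullet> \<psi> p)"
    using int by (simp add: vm_integral_def inner_vec_def Bochner_Integration.integral_sum)
  show "integrable \<mu> (\<lambda>p. v p \<bullet> \<psi> p)"
    using int by (simp add: inner_vec_def)
qed

section \<open>The Hahn-Banach theorem\<close>

text \<open>
  Functionals are defined on all functions and only their values on a linear space \<open>V\<close>
  of functions matter, because the integrable functions do not form a type.
\<close>

definition function_space :: "('a \<Rightarrow> real) set \<Rightarrow> bool" where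
  "function_space V \<longleftrightarrow> (\<lambda>_. 0) \<in> V \<and> (\<forall>f\<in>V. \<forall>g\<in>V. (\<lambda>x. f x + g x) \<in> V) \<and>
     (\<forall>f\<in>V. \<forall>c. (\<lambda>x. c * f x) \<in> V)"

definition sublinear_on :: "('a \<Rightarrow> real) set \<Rightarrow> (('a \<Rightarrow> real) \<Rightarrow> real) \<Rightarrow> bool" where
  "sublinear_on V p \<longleftrightarrow> (\<forall>f\<in>V. \<forall>g\<in>V. p (\<lambda>x. f x + g x) \<le> p f + p g) \<and>
     (\<forall>f\<in>V. \<forall>c\<ge>0. p (\<lambda>x. c * f x) = c * p f)"

definition linear_functional_on :: "('a \<Rightarrow> real) set \<Rightarrow> (('a \<Rightarrow> real) \<Rightarrow> real) \<Rightarrow> bool" where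
  "linear_functional_on V q \<longleftrightarrow> (\<forall>f\<in>V. \<forall>g\<in>V. q (\<lambda>x. f x + g x) = q f + q g) \<and>
     (\<forall>f\<in>V. \<forall>c. q (\<lambda>x. c * f x) = c * q f)"

lemma function_spaceD:
  assumes "function_space V"
  shows "(\<lambda>_. 0) \<in> V" "\<And>f g. f \<in> V \<Longrightarrow> g \<in> V \<Longrightarrow> (\<lambda>x. f x + g x) \<in> V"
    "\<And>f c. f \<in> V \<Longrightarrow> (\<lambda>x. c * f x) \<in> V" "\<And>f. f \<in> V \<Longrightarrow> (\<lambda>x. - f x) \<in> V"
    "\<And>f g. f \<in> V \<Longrightarrow> g \<in> V \<Longrightarrow> (\<lambda>x. f x - g x) \<in> V"
proof -
  show a: "(\<lambda>_. 0) \<in> V" "\<And>f g. f \<in> V \<Longrightarrow> g \<in> V \<Longrightarrow> (\<lambda>x. f x + g x) \<in> V"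
    "\<And>f c. f \<in> V \<Longrightarrow> (\<lambda>x. c * f x) \<in> V"
    using assms unfolding function_space_def by auto
  show b: "\<And>f. f \<in> V \<Longrightarrow> (\<lambda>x. - f x) \<in> V" using a(3)[of _ "-1"] by simp
  show "\<And>f g. f \<in> V \<Longrightarrow> g \<in> V \<Longrightarrow> (\<lambda>x. f x - g x) \<in> V"
    using a(2)[OF _ b] by simp
qed

lemma sublinear_onD:
  assumes "sublinear_on V p"
  shows "\<And>f g. f \<in> V \<Longrightarrow> g \<in> V \<Longrightarrow> p (\<lambda>x. f x + g x) \<le> p f + p g"
    "\<And>f c. f \<in> V \<Longrightarrow> 0 \<le> c \<Longrightarrow> p (\<lambda>x. c * f x) = c * p f"
  using assms unfolding sublinear_on_def by auto

lemma linear_functional_onD: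
  assumes "linear_functional_on V q"
  shows "\<And>f g. f \<in> V \<Longrightarrow> g \<in> V \<Longrightarrow> q (\<lambda>x. f x + g x) = q f + q g"
    "\<And>f c. f \<in> V \<Longrightarrow> q (\<lambda>x. c * f x) = c * q f"
    "\<And>f. f \<in> V \<Longrightarrow> q (\<lambda>x. - f x) = - q f"
proof -
  show a: "\<And>f g. f \<in> V \<Longrightarrow> g \<in> V \<Longrightarrow> q (\<lambda>x. f x + g x) = q f + q g"
    "\<And>f c. f \<in> V \<Longrightarrow> q (\<lambda>x. c * f x) = c * q f"
    using assms unfolding linear_functional_on_def by auto
  show "\<And>f. f \<in> V \<Longrightarrow> q (\<lambda>x. - f x) = - q f" using a(2)[of _ "-1"] by simp
qed

text \<open>
  The functional \<open>f \<mapsto> inf {p (f - w) + r | (w, r) \<in> C}\<close> is the largest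
  sublinear functional below \<open>p\<close> with \<open>q w \<le> r\<close> on the cone
  \<open>C\<close>. It is used with a linear relation to impose prescribed values, and with a
  half-line to show that a minimal sublinear functional is odd.
\<close>

lemma sublinear_inf_cone:
  fixes V :: "('a \<Rightarrow> real) set" and C :: "(('a \<Rightarrow> real) \<times> real) set"
  assumes V: "function_space V" and p: "sublinear_on V p"
    and C0: "((\<lambda>_. 0), 0) \<in> C"
    and Cadd: "\<And>w r w' r'. (w, r) \<in> C \<Longrightarrow> (w', r') \<in> C \<Longrightarrow> ((\<lambda>x. w x + w' x), r + r') \<in> C"
    and Cscale: "\<And>w r c. (w, r) \<in> C \<Longrightarrow> 0 \<le> c \<Longrightarrow> ((\<lambda>x. c * w x), c * r) \<in> C"
    and CV: "\<And>w r. (w, r) \<in> C \<Longrightarrow> w \<in> V"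
    and Cp: "\<And>w r. (w, r) \<in> C \<Longrightarrow> 0 \<le> p (\<lambda>x. - w x) + r"
  shows "\<exists>q. sublinear_on V q \<and> (\<forall>f\<in>V. q f \<le> p f) \<and> (\<forall>(w, r)\<in>C. q w \<le> r)"
proof -
  note Vs = function_spaceD[OF V] and ps = sublinear_onD[OF p]
  define q where "q f = (INF (w, r)\<in>C. p (\<lambda>x. f x - w x) + r)" for f
  have low: "- p (\<lambda>x. - f x) \<le> p (\<lambda>x. f x - w x) + r" if f: "f \<in> V" and w: "(w, r) \<in> C" for f w r
  proof -
    have "p (\<lambda>x. (f x - w x) + - f x) \<le> p (\<lambda>x. f x - w x) + p (\<lambda>x. - f x)"
      by (rule ps(1)) (use f CV[OF w] Vs in auto)
    then show ?thesis using Cp[OF w] by simp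
  qed
  have bdd: "bdd_below ((\<lambda>(w, r). p (\<lambda>x. f x - w x) + r) ` C)" if "f \<in> V" for f
    using low[OF that] by (intro bdd_belowI[where m = "- p (\<lambda>x. - f x)"]) auto
  have le: "q f \<le> p (\<lambda>x. f x - w x) + r" if "f \<in> V" "(w, r) \<in> C" for f w r
    unfolding q_def using cINF_lower[OF bdd[OF that(1)] that(2)] by simp
  have ge: "b \<le> q f" if "f \<in> V" "\<And>w r. (w, r) \<in> C \<Longrightarrow> b \<le> p (\<lambda>x. f x - w x) + r" for f b
    unfolding q_def using C0 that(2) by (intro cINF_greatest) auto
  have qp: "q f \<le> p f" if "f \<in> V" for f using le[OF that C0] by simp
  have p0: "p (\<lambda>x. 0) = 0" using ps(2)[OF Vs(1), of 0] by simp
  have qw: "q w \<le> r" if "(w, r) \<in> C" for w r using le[OF CV[OF that] that] p0 by simp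
  have add: "q (\<lambda>x. f x + g x) \<le> q f + q g" if f: "f \<in> V" and g: "g \<in> V" for f g
  proof -
    have fg: "(\<lambda>x. f x + g x) \<in> V" using Vs(2)[OF f g] .
    have main: "q (\<lambda>x. f x + g x) \<le> (p (\<lambda>x. f x - w x) + r) + (p (\<lambda>x. g x - w' x) + r')"
      if w: "(w, r) \<in> C" and w': "(w', r') \<in> C" for w r w' r'
    proof -
      have "q (\<lambda>x. f x + g x) \<le> p (\<lambda>x. (f x + g x) - (w x + w' x)) + (r + r')"
        by (rule le[OF fg Cadd[OF w w']])
      also have "p (\<lambda>x. (f x + g x) - (w x + w' x)) = p (\<lambda>x. (f x - w x) + (g x - w' x))"
        by (simp add: algebra_simps)
      also have "\<dots> \<le> p (\<lambda>x. f x - w x) + p (\<lambda>x. g x - w' x)"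
        by (rule ps(1)) (use f g CV[OF w] CV[OF w'] Vs in auto)
      finally show ?thesis by simp
    qed
    have "q (\<lambda>x. f x + g x) - (p (\<lambda>x. f x - w x) + r) \<le> q g" if "(w, r) \<in> C" for w r
      by (rule ge[OF g]) (use main[OF that] in \<open>auto simp: algebra_simps\<close>)
    then have "q (\<lambda>x. f x + g x) - q g \<le> q f"
      by (intro ge[OF f]) (auto simp: algebra_simps)
    then show ?thesis by simp
  qed
  have scale_le: "q (\<lambda>x. c * f x) \<le> c * q f" if f: "f \<in> V" and c: "0 < c" for f c
  proof -
    have "q (\<lambda>x. c * f x) / c \<le> q f"
    proof (rule ge[OF f])
      fix w r assume w: "(w, r) \<in> C"
      have "q (\<lambda>x. c * f x) \<le> p (\<lambda>x. c * f x - c * w x) + c * r"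
        using le[OF Vs(3)[OF f] Cscale[OF w]] c by simp
      also have "p (\<lambda>x. c * f x - c * w x) = p (\<lambda>x. c * (f x - w x))" by (simp add: algebra_simps)
      also have "\<dots> = c * p (\<lambda>x. f x - w x)"
        using ps(2)[OF Vs(5)[OF f CV[OF w]]] c by simp
      finally show "q (\<lambda>x. c * f x) / c \<le> p (\<lambda>x. f x - w x) + r"
        using c by (simp add: field_simps)
    qed
    then show ?thesis using c by (simp add: field_simps)
  qed
  have scale: "q (\<lambda>x. c * f x) = c * q f" if f: "f \<in> V" and c: "0 \<le> c" for f c
  proof (cases "c = 0")
    case True
    have "0 \<le> q (\<lambda>x. 0)" by (rule ge[OF Vs(1)]) (use Cp in auto)
    moreover have "q (\<lambda>x. 0) \<le> 0" using qp[OF Vs(1)] p0 by simp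
    ultimately show ?thesis using True by simp
  next
    case False
    then have c: "0 < c" using c by simp
    have "q (\<lambda>x. (1/c) * (c * f x)) \<le> (1/c) * q (\<lambda>x. c * f x)"
      by (rule scale_le[OF Vs(3)[OF f]]) (use c in auto)
    then have "c * q f \<le> q (\<lambda>x. c * f x)" using c by (simp add: field_simps)
    then show ?thesis using scale_le[OF f c] by simp
  qed
  show ?thesis
    by (rule exI[of _ q]) (use qp qw add scale in \<open>auto simp: sublinear_on_def\<close>)
qed

text \<open>
  A minimal sublinear functional below \<open>p\<close> exists by Zorn's lemma. It is odd: for given
  \<open>u\<close>, lowering it along the half-line spanned by \<open>- u\<close> keeps it
  sublinear, hence cannot change it, and this gives \<open>q (- u) \<le> - q u\<close>. An odd
  sublinear functional is linear.
\<close>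

lemma sublinear_majorizes_linear:
  fixes V :: "('a \<Rightarrow> real) set"
  assumes V: "function_space V" and p: "sublinear_on V p"
  shows "\<exists>q. linear_functional_on V q \<and> (\<forall>f\<in>V. q f \<le> p f)"
proof -
  note Vs = function_spaceD[OF V]
  define A where "A = {q. sublinear_on V q \<and> (\<forall>f\<in>V. q f \<le> p f) \<and> (\<forall>f. f \<notin> V \<longrightarrow> q f = 0)}"
  define r where "r f = (if f \<in> V then p f else 0)" for f
  have restrict: "(\<lambda>f. if f \<in> V then q f else 0) \<in> A"
    if "sublinear_on V q" "\<forall>f\<in>V. q f \<le> p f" for q
    using that Vs unfolding A_def sublinear_on_def by auto
  have neg: "- p (\<lambda>x. - f x) \<le> q f" if q: "q \<in> A" and f: "f \<in> V" for q f
  proof -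
    have qs: "sublinear_on V q" using q A_def by auto
    have "q (\<lambda>x. f x + - f x) \<le> q f + q (\<lambda>x. - f x)"
      using sublinear_onD(1)[OF qs f Vs(4)[OF f]] by simp
    moreover have "q (\<lambda>x. 0) = 0" using sublinear_onD(2)[OF qs Vs(1), of 0] by simp
    moreover have "q (\<lambda>x. - f x) \<le> p (\<lambda>x. - f x)" using q Vs(4)[OF f] unfolding A_def by auto
    ultimately show ?thesis by simp
  qed
  \<comment> \<open>Zorn's lemma yields maximal elements, so the order is reversed.\<close>
  define P where "P q q' \<longleftrightarrow> q' \<le> q" for q q' :: "('a \<Rightarrow> real) \<Rightarrow> real"
  have "\<exists>m\<in>A. \<forall>a\<in>A. P m a \<longrightarrow> a = m"
  proof (rule predicate_Zorn)
    show "partial_order_on A (relation_of P A)"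
      by (rule partial_order_on_relation_ofI) (auto simp: P_def)
    fix C assume C: "C \<in> Chains (relation_of P A)"
    then have CA: "C \<subseteq> A" and tot: "\<And>a b. a \<in> C \<Longrightarrow> b \<in> C \<Longrightarrow> a \<le> b \<or> b \<le> a"
      unfolding Chains_def relation_of_def P_def by auto
    show "\<exists>u\<in>A. \<forall>a\<in>C. P a u"
    proof (cases "C = {}")
      case True
      then show ?thesis using restrict[OF p] by auto
    next
      case False
      define u where "u f = (INF q\<in>C. q f)" for f
      have bdd: "bdd_below ((\<lambda>q. q f) ` C)" for f
      proof (cases "f \<in> V")
        case True then show ?thesis using neg CA by (intro bdd_belowI[where m = "- p (\<lambda>x. - f x)"]) auto
      next
        case False then show ?thesis using CA by (intro bdd_belowI[where m = 0]) (auto simp: A_def)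
      qed
      have le: "u f \<le> q f" if "q \<in> C" for q f
        unfolding u_def using cINF_lower[OF bdd that] .
      have ge: "b \<le> u f" if "\<And>q. q \<in> C \<Longrightarrow> b \<le> q f" for b f
        unfolding u_def using False that by (intro cINF_greatest) auto
      have "u \<in> A" unfolding A_def mem_Collect_eq
      proof (intro conjI ballI allI impI)
        show "u f \<le> p f" if "f \<in> V" for f
        proof -
          obtain q where "q \<in> C" using False by auto
          then show ?thesis using le[of q f] CA that unfolding A_def by fastforce
        qed
        show "u f = 0" if "f \<notin> V" for f
        proof -
          have "(\<lambda>q. q f) ` C = (\<lambda>q. 0) ` C"
            by (rule image_cong) (use CA that in \<open>auto simp: A_def\<close>)
          then have "(\<lambda>q. q f) ` C = {0}" using False by auto
          then show ?thesis unfolding u_def by simp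
        qed
        show "sublinear_on V u" unfolding sublinear_on_def
        proof (intro conjI ballI allI impI)
          fix f g assume f: "f \<in> V" and g: "g \<in> V"
          have main: "u (\<lambda>x. f x + g x) \<le> q f + q' g" if q: "q \<in> C" and q': "q' \<in> C" for q q'
          proof -
            obtain s where s: "s \<in> C" "s \<le> q" "s \<le> q'" using tot[OF q q'] q q' by auto
            have "u (\<lambda>x. f x + g x) \<le> s (\<lambda>x. f x + g x)" using le[OF s(1)] .
            also have "\<dots> \<le> s f + s g"
              using s(1) CA f g by (intro sublinear_onD(1)[of V]) (auto simp: A_def)
            also have "\<dots> \<le> q f + q' g" using s by (intro add_mono) (auto simp: le_fun_def)
            finally show ?thesis .
          qed
          have "u (\<lambda>x. f x + g x) - q f \<le> u g" if "q \<in> C" for q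
            by (rule ge) (use main[OF that] in \<open>auto simp: algebra_simps\<close>)
          then have "u (\<lambda>x. f x + g x) - u g \<le> u f" by (intro ge) (auto simp: algebra_simps)
          then show "u (\<lambda>x. f x + g x) \<le> u f + u g" by simp
        next
          fix f and c :: real assume f: "f \<in> V" and c: "0 \<le> c"
          have eq: "q (\<lambda>x. c * f x) = c * q f" if "q \<in> C" for q
            using that CA f c by (intro sublinear_onD(2)[of V]) (auto simp: A_def)
          show "u (\<lambda>x. c * f x) = c * u f"
          proof (cases "c = 0")
            case True
            have "(\<lambda>q. q (\<lambda>x. c * f x)) ` C = (\<lambda>q. 0) ` C"
              by (rule image_cong) (use eq True in auto)
            then have "(\<lambda>q. q (\<lambda>x. c * f x)) ` C = {0}" using \<open>C \<noteq> {}\<close> by auto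
            then show ?thesis using True unfolding u_def by simp
          next
            case False
            then have c: "0 < c" using c by simp
            have "c * u f \<le> u (\<lambda>x. c * f x)"
              using c by (intro ge) (simp add: eq le)
            moreover have "u (\<lambda>x. c * f x) / c \<le> u f"
              by (rule ge) (use eq le[of _ "\<lambda>x. c * f x"] c in \<open>auto simp: field_simps\<close>)
            ultimately show ?thesis using c by (simp add: field_simps)
          qed
        qed
      qed
      then show ?thesis using le unfolding P_def le_fun_def by auto
    qed
  qed
  then obtain q where q: "q \<in> A" and min: "\<And>a. a \<in> A \<Longrightarrow> a \<le> q \<Longrightarrow> a = q"
    unfolding P_def by auto
  have qs: "sublinear_on V q" and qp: "\<forall>f\<in>V. q f \<le> p f" using q A_def by auto
  note qs' = sublinear_onD[OF qs]
  have q0: "q (\<lambda>x. 0) = 0" using qs'(2)[OF Vs(1), of 0] by simp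
  have odd: "q (\<lambda>x. - u x) = - q u" if u: "u \<in> V" for u
  proof -
    \<comment> \<open>The constraint imposed on \<open>- t u\<close> is \<open>q' (- t u) \<le> - t (q
      u)\<close>.\<close>
    define C where "C = (\<lambda>t. ((\<lambda>x. - (t * u x)), - (t * q u))) ` {0..}"
    have "\<exists>q'. sublinear_on V q' \<and> (\<forall>f\<in>V. q' f \<le> q f) \<and> (\<forall>(w, r)\<in>C. q' w \<le> r)"
    proof (rule sublinear_inf_cone[OF V qs])
      show "((\<lambda>_. 0), 0) \<in> C" unfolding C_def by (rule image_eqI[of _ _ 0]) auto
      fix w r assume "(w, r) \<in> C"
      then obtain t where t: "0 \<le> t" "w = (\<lambda>x. - (t * u x))" "r = - (t * q u)" unfolding C_def by auto
      show "w \<in> V" using t Vs(3)[OF u, of "- t"] by simp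
      show "0 \<le> q (\<lambda>x. - w x) + r" using t qs'(2)[OF u] by simp
      show "((\<lambda>x. c * w x), c * r) \<in> C" if "0 \<le> c" for c
        unfolding C_def by (rule image_eqI[of _ _ "c * t"]) (use t that in auto)
      fix w' r' assume "(w', r') \<in> C"
      then obtain t' where t': "0 \<le> t'" "w' = (\<lambda>x. - (t' * u x))" "r' = - (t' * q u)"
        unfolding C_def by auto
      show "((\<lambda>x. w x + w' x), r + r') \<in> C"
        unfolding C_def by (rule image_eqI[of _ _ "t + t'"]) (use t t' in \<open>auto simp: algebra_simps\<close>)
    qed
    then obtain q' where q': "sublinear_on V q'" "\<forall>f\<in>V. q' f \<le> q f" "\<forall>(w, r)\<in>C. q' w \<le> r" by auto
    define a where "a f = (if f \<in> V then q' f else 0)" for f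
    have "\<forall>f\<in>V. q' f \<le> p f" using q'(2) qp by (meson order_trans)
    then have "a \<in> A" unfolding a_def using q'(1) by (intro restrict)
    moreover have "a \<le> q" using q' q unfolding a_def le_fun_def A_def by auto
    ultimately have aq: "a = q" by (rule min)
    have "((\<lambda>x. - (1 * u x)), - (1 * q u)) \<in> C" unfolding C_def by (rule image_eqI[of _ _ 1]) auto
    then have "q' (\<lambda>x. - u x) \<le> - q u" using q' by fastforce
    then have 1: "q (\<lambda>x. - u x) \<le> - q u" using fun_cong[OF aq, of "\<lambda>x. - u x"] Vs(4)[OF u] by (simp add: a_def)
    have "0 \<le> q u + q (\<lambda>x. - u x)" using qs'(1)[OF u Vs(4)[OF u]] q0 by simp
    with 1 show ?thesis by simp
  qed
  have "linear_functional_on V q" unfolding linear_functional_on_def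
  proof (intro conjI ballI allI)
    fix f g assume f: "f \<in> V" and g: "g \<in> V"
    have "q (\<lambda>x. - f x + - g x) \<le> q (\<lambda>x. - f x) + q (\<lambda>x. - g x)"
      by (rule qs'(1)) (use f g Vs in auto)
    moreover have "q (\<lambda>x. - f x + - g x) = q (\<lambda>x. - (f x + g x))" by (simp add: algebra_simps)
    moreover have "\<dots> = - q (\<lambda>x. f x + g x)" by (rule odd[OF Vs(2)[OF f g]])
    ultimately show "q (\<lambda>x. f x + g x) = q f + q g"
      using qs'(1)[OF f g] odd[OF f] odd[OF g] by simp
  next
    fix f and c :: real assume f: "f \<in> V"
    show "q (\<lambda>x. c * f x) = c * q f"
    proof (cases "0 \<le> c")
      case True then show ?thesis using qs'(2)[OF f] by simp
    next
      case False
      then have "q (\<lambda>x. (- c) * f x) = (- c) * q f" using qs'(2)[OF f, of "- c"] by simp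
      moreover have "q (\<lambda>x. (- c) * f x) = - q (\<lambda>x. c * f x)"
        using odd[OF Vs(3)[OF f, of c]] by simp
      ultimately show ?thesis by simp
    qed
  qed
  then show ?thesis using qp by auto
qed

text \<open>
  The subspace and the functional on it are given by their graph \<open>R\<close>. In this form the
  prescribed values need not be known to be well defined; that follows from \<open>r \<le> p
  w\<close>.
\<close>

theorem hahn_banach_linear_relation:
  fixes V :: "('a \<Rightarrow> real) set" and R :: "(('a \<Rightarrow> real) \<times> real) set"
  assumes V: "function_space V" and p: "sublinear_on V p"
    and R0: "((\<lambda>_. 0), 0) \<in> R"
    and Radd: "\<And>w r w' r'. (w, r) \<in> R \<Longrightarrow> (w', r') \<in> R \<Longrightarrow> ((\<lambda>x. w x + w' x), r + r') \<in> R"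
    and Rscale: "\<And>w r c. (w, r) \<in> R \<Longrightarrow> ((\<lambda>x. c * w x), c * r) \<in> R"
    and RV: "\<And>w r. (w, r) \<in> R \<Longrightarrow> w \<in> V"
    and Rp: "\<And>w r. (w, r) \<in> R \<Longrightarrow> r \<le> p w"
  obtains q where "linear_functional_on V q" "\<And>f. f \<in> V \<Longrightarrow> q f \<le> p f"
    "\<And>w r. (w, r) \<in> R \<Longrightarrow> q w = r"
proof -
  have R_neg: "((\<lambda>x. - w x), - r) \<in> R" if "(w, r) \<in> R" for w r
    using Rscale[OF that, of "-1"] by simp
  have "\<exists>q. sublinear_on V q \<and> (\<forall>f\<in>V. q f \<le> p f) \<and> (\<forall>(w, r)\<in>R. q w \<le> r)"
  proof (rule sublinear_inf_cone[OF V p R0])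
    show "0 \<le> p (\<lambda>x. - w x) + r" if "(w, r) \<in> R" for w r using Rp[OF R_neg[OF that]] by simp
  qed (blast intro: Radd Rscale RV)+
  then obtain p' where p': "sublinear_on V p'" "\<forall>f\<in>V. p' f \<le> p f" "\<forall>(w, r)\<in>R. p' w \<le> r" by auto
  obtain q where q: "linear_functional_on V q" "\<forall>f\<in>V. q f \<le> p' f"
    using sublinear_majorizes_linear[OF V p'(1)] by auto
  have le: "q w \<le> r" if "(w, r) \<in> R" for w r
    using that p'(3) q(2) RV[OF that] by fastforce
  show thesis
  proof
    show "linear_functional_on V q" by fact
    show "q f \<le> p f" if "f \<in> V" for f using q(2) p'(2) that by (meson order_trans)
    show "q w = r" if "(w, r) \<in> R" for w r
      using le[OF that] le[OF R_neg[OF that]] linear_functional_onD(3)[OF q(1) RV[OF that]] by simp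
  qed
qed

section \<open>Linear functionals dominated by a measure\<close>

text \<open>
  On indicators \<open>q\<close> is a set function between \<open>0\<close> and
  \<open>\<mu>\<close>. It is countably additive, because \<open>\<bar>q f\<bar> \<le> \<integral>
  \<bar>f\<bar> d\<mu>\<close> makes \<open>q\<close> continuous under dominated convergence, so it
  has a density, and the same continuity extends the representation from indicators to all
  integrable functions.
\<close>

lemma dominated_functional_density:
  fixes \<mu> :: "'a measure" and q :: "('a \<Rightarrow> real) \<Rightarrow> real"
  assumes fin: "finite_measure \<mu>" and q: "linear_functional_on {f. integrable \<mu> f} q"
    and dom: "\<And>f. integrable \<mu> f \<Longrightarrow> q f \<le> (LINT x|\<mu>. max 0 (f x))"
  obtains g where "g \<in> borel_measurable \<mu>" "\<And>x. 0 \<le> g x" "\<And>x. g x \<le> 1"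
    "\<And>f. integrable \<mu> f \<Longrightarrow> q f = (LINT x|\<mu>. g x * f x)"
proof -
  interpret finite_measure \<mu> by fact
  have qadd: "q (\<lambda>x. f x + g x) = q f + q g" if "integrable \<mu> f" "integrable \<mu> g" for f g
    using linear_functional_onD(1)[OF q] that by simp
  have qscale: "q (\<lambda>x. c * f x) = c * q f" if "integrable \<mu> f" for f c
    using linear_functional_onD(2)[OF q] that by simp
  have qneg: "q (\<lambda>x. - f x) = - q f" if "integrable \<mu> f" for f
    using linear_functional_onD(3)[OF q] that by simp
  have q0: "q (\<lambda>x. 0) = 0" using qscale[of "\<lambda>x. 0" 0] by simp
  have qabs: "\<bar>q f\<bar> \<le> (LINT x|\<mu>. \<bar>f x\<bar>)" if f: "integrable \<mu> f" for f
  proof -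
    have "(LINT x|\<mu>. max 0 (f x)) \<le> (LINT x|\<mu>. \<bar>f x\<bar>)"
      "(LINT x|\<mu>. max 0 (- f x)) \<le> (LINT x|\<mu>. \<bar>f x\<bar>)"
      using f by (intro integral_mono; auto)+
    then show ?thesis using dom[OF f] dom[of "\<lambda>x. - f x"] qneg[OF f] f by auto
  qed
  have qlim: "(\<lambda>n. q (s n)) \<longlonglongrightarrow> q f"
    if s: "\<And>n. integrable \<mu> (s n)" and f: "integrable \<mu> f" and w: "integrable \<mu> w"
      and lim: "\<And>x. x \<in> space \<mu> \<Longrightarrow> (\<lambda>n. s n x) \<longlonglongrightarrow> f x"
      and bd: "\<And>n x. x \<in> space \<mu> \<Longrightarrow> \<bar>s n x\<bar> \<le> w x" for s f w
  proof -
    have "(\<lambda>n. LINT x|\<mu>. \<bar>s n x - f x\<bar>) \<longlonglongrightarrow> (LINT x|\<mu>. 0)"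
    proof (rule integral_dominated_convergence[where w = "\<lambda>x. w x + \<bar>f x\<bar>"])
      show "AE x in \<mu>. (\<lambda>n. \<bar>s n x - f x\<bar>) \<longlonglongrightarrow> 0"
        using lim by (auto intro!: AE_I2 tendsto_rabs_zero LIM_zero)
      show "AE x in \<mu>. norm \<bar>s n x - f x\<bar> \<le> w x + \<bar>f x\<bar>" for n
        using bd[of _ n] by (intro AE_I2) (smt (verit) real_norm_def)
    qed (use s f w in auto)
    then have lim0: "(\<lambda>n. LINT x|\<mu>. \<bar>s n x - f x\<bar>) \<longlonglongrightarrow> 0" by simp
    have "norm (q (s n) - q f) \<le> (LINT x|\<mu>. \<bar>s n x - f x\<bar>)" for n
    proof -
      have "q (\<lambda>x. s n x + - f x) = q (s n) - q f"
        using qadd[OF s[of n], of "\<lambda>x. - f x"] qneg[OF f] f by simp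
      then show ?thesis using qabs[of "\<lambda>x. s n x - f x"] s[of n] f by simp
    qed
    then have "(\<lambda>n. q (s n) - q f) \<longlonglongrightarrow> 0"
      by (intro Lim_null_comparison[OF always_eventually lim0]) blast
    then show ?thesis by (rule LIM_zero_cancel)
  qed
  define \<nu> where "\<nu> A = q (indicat_real A)" for A
  have int_ind: "integrable \<mu> (indicat_real A)" if "A \<in> sets \<mu>" for A
    using that by (simp add: integrable_indicator_iff less_top[symmetric])
  have sm: "signed_measure \<mu> \<nu>" unfolding signed_measure_def
  proof (intro conjI allI impI)
    have "indicat_real {} = (\<lambda>x::'a. 0)" by auto
    then show "\<nu> {} = 0" unfolding \<nu>_def by (simp add: q0)
    fix A :: "nat \<Rightarrow> 'a set" assume A: "range A \<subseteq> sets \<mu>" "disjoint_family A"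
    have Am: "A i \<in> sets \<mu>" for i using A by auto
    define s where "s n x = (\<Sum>i<n. indicat_real (A i) x)" for n x
    have s_eq: "s n x = indicator (\<Union>i<n. A i) x" for n x
      unfolding s_def using A(2) by (subst indicator_UN_disjoint) (auto simp: disjoint_family_on_def)
    have s_int: "integrable \<mu> (s n)" for n unfolding s_def using int_ind Am by auto
    have qs: "q (s n) = (\<Sum>i<n. \<nu> (A i))" for n
    proof (induction n)
      case 0 then show ?case unfolding s_def using q0 by simp
    next
      case (Suc n)
      have "s (Suc n) = (\<lambda>x. s n x + indicat_real (A n) x)" unfolding s_def by auto
      then show ?case using qadd[OF s_int int_ind[OF Am]] Suc by (simp add: \<nu>_def)
    qed
    have "(\<lambda>n. q (s n)) \<longlonglongrightarrow> q (indicat_real (\<Union>i. A i))"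
    proof (rule qlim[where w = "\<lambda>_. 1"])
      show "(\<lambda>n. s n x) \<longlonglongrightarrow> indicator (\<Union>i. A i) x" for x
      proof (cases "\<exists>i. x \<in> A i")
        case True
        then obtain i where i: "x \<in> A i" by auto
        have "eventually (\<lambda>n. indicator (\<Union>i. A i) x = s n x) sequentially"
          using eventually_gt_at_top[of i] by eventually_elim (use i in \<open>auto simp: s_eq indicator_def\<close>)
        then show ?thesis by (rule Lim_transform_eventually[OF tendsto_const])
      next
        case False
        then show ?thesis by (auto simp: s_eq indicator_def)
      qed
      show "\<bar>s n x\<bar> \<le> 1" for n x by (simp add: s_eq)
    qed (use s_int int_ind Am in auto)
    then show "(\<lambda>i. \<nu> (A i)) sums \<nu> (\<Union>i. A i)" unfolding sums_def by (simp add: qs \<nu>_def)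
  qed
  have \<nu>_le: "\<nu> A \<le> measure \<mu> A" if "A \<in> sets \<mu>" for A
  proof -
    have "q (indicat_real A) \<le> (LINT x|\<mu>. max 0 (indicat_real A x))" by (rule dom[OF int_ind[OF that]])
    also have "\<dots> = (LINT x|\<mu>. indicat_real A x)"
      by (intro Bochner_Integration.integral_cong) (auto split: split_indicator)
    finally show ?thesis using that by (simp add: \<nu>_def)
  qed
  have \<nu>_ge: "0 \<le> \<nu> A" if "A \<in> sets \<mu>" for A
  proof -
    have "q (\<lambda>x. - indicat_real A x) \<le> (LINT x|\<mu>. max 0 (- indicat_real A x))"
      using int_ind[OF that] by (intro dom) auto
    also have "\<dots> = (LINT x|\<mu>. 0)" by (intro Bochner_Integration.integral_cong) (auto split: split_indicator)
    finally show ?thesis using qneg[OF int_ind[OF that]] by (simp add: \<nu>_def)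
  qed
  obtain h where h: "integrable \<mu> h" "\<And>A. A \<in> sets \<mu> \<Longrightarrow> \<nu> A = (LINT x:A|\<mu>. h x)"
    using signed_measure_radon_nikodym[OF sm refl fin] \<nu>_le \<nu>_ge
    by (metis (no_types, lifting) antisym enn2real_0 measure_def)
  have ge0: "AE x in \<mu>. 0 \<le> h x"
    by (rule density_nonneg[OF h(1)]) (use h(2) \<nu>_ge in simp)
  have "AE x in \<mu>. 0 \<le> 1 - h x"
  proof (rule density_nonneg)
    fix A assume A: "A \<in> sets \<mu>"
    have "(LINT x:A|\<mu>. 1 - h x) = measure \<mu> A - \<nu> A"
      using A h integrable_mult_indicator[OF A h(1)] int_ind[OF A]
      by (simp add: set_lebesgue_integral_def algebra_simps)
    then show "0 \<le> (LINT x:A|\<mu>. 1 - h x)" using \<nu>_le[OF A] by simp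
  qed (use h(1) in auto)
  then have le1: "AE x in \<mu>. h x \<le> 1" by simp
  \<comment> \<open>The density is modified on a null set so that the bounds hold everywhere.\<close>
  define g where "g x = max 0 (min 1 (h x))" for x
  have g: "g \<in> borel_measurable \<mu>" "\<And>x. 0 \<le> g x" "\<And>x. g x \<le> 1"
    using borel_measurable_integrable[OF h(1)] by (auto simp: g_def[abs_def])
  have gh: "AE x in \<mu>. g x = h x" using ge0 le1 by eventually_elim (simp add: g_def)
  have gint: "integrable \<mu> (\<lambda>x. g x * f x)" if "integrable \<mu> f" for f
    by (rule Bochner_Integration.integrable_bound[OF that])
      (use g that in \<open>auto simp: abs_mult intro!: AE_I2 mult_left_le_one_le\<close>)
  have "q f = (LINT x|\<mu>. g x * f x)" if "integrable \<mu> f" for f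
    using that
  proof (induction rule: integrable_induct)
    case (base A c)
    have "q (\<lambda>x. indicat_real A x *\<^sub>R c) = c * \<nu> A"
      using qscale[OF int_ind[OF base(1)], of c] by (simp add: \<nu>_def mult.commute)
    also have "\<dots> = c * (LINT x|\<mu>. indicat_real A x * h x)" by (simp add: h(2)[OF base(1)] set_lebesgue_integral_def)
    also have "\<dots> = (LINT x|\<mu>. g x * (indicat_real A x *\<^sub>R c))"
      unfolding integral_mult_right_zero[symmetric]
    proof (rule integral_cong_AE)
      show "AE x in \<mu>. c * (indicat_real A x * h x) = g x * (indicat_real A x *\<^sub>R c)"
        using gh by eventually_elim (simp add: ac_simps)
    qed (use g h base in auto)
    finally show ?case .
  next
    case (add f f')
    then show ?case using qadd[of f f'] gint by (simp add: distrib_left)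
  next
    case (lim f s)
    have 1: "(\<lambda>n. q (s n)) \<longlonglongrightarrow> q f"
      by (rule qlim[where w = "\<lambda>x. 2 * \<bar>f x\<bar>"]) (use lim in auto)
    have 2: "(\<lambda>n. LINT x|\<mu>. g x * s n x) \<longlonglongrightarrow> (LINT x|\<mu>. g x * f x)"
    proof (rule integral_dominated_convergence[where w = "\<lambda>x. 2 * \<bar>f x\<bar>"])
      show "AE x in \<mu>. norm (g x * s n x) \<le> 2 * \<bar>f x\<bar>" for n
      proof (rule AE_I2)
        fix x assume "x \<in> space \<mu>"
        have "\<bar>g x * s n x\<bar> \<le> 1 * \<bar>s n x\<bar>"
          unfolding abs_mult using g(2,3)[of x] by (intro mult_right_mono) auto
        also have "\<dots> \<le> 2 * \<bar>f x\<bar>" using lim.hyps(3)[OF \<open>x \<in> space \<mu>\<close>, of n] by simp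
        finally show "norm (g x * s n x) \<le> 2 * \<bar>f x\<bar>" by simp
      qed
    qed (use lim g in \<open>auto intro!: tendsto_intros AE_I2\<close>)
    show ?case using LIMSEQ_unique[OF 1 2[folded lim.IH]] .
  qed
  then show thesis using that g by blast
qed

section \<open>Periodic functions and measures on the torus\<close>

lemma QL_borel [measurable]: "QL L \<in> sets borel"
proof -
  have "QL L = {x \<in> space borel. \<forall>i\<in>UNIV. - (L/2) \<le> x $ i \<and> x $ i < L/2}" by (auto simp: QL_def)
  also have "\<dots> \<in> sets borel" by measurable
  finally show ?thesis .
qed

lemma QLT_borel [measurable]: "QLT L T \<in> sets borel"
  unfolding QLT_def borel_prod[symmetric] by measurable

lemma space_borel_QL [simp]: "space (borel_QL L) = QL L"
  by (simp add: space_restrict_space)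

lemma space_borel_QLT [simp]: "space (borel_QLT L T) = QLT L T"
  by (simp add: space_restrict_space)

lemma sets_borel_QL: "A \<in> sets (borel_QL L) \<longleftrightarrow> A \<subseteq> QL L \<and> A \<in> sets borel"
  by (rule sets_restrict_space_iff) simp

lemma sets_borel_QLT: "A \<in> sets (borel_QLT L T) \<longleftrightarrow> A \<subseteq> QLT L T \<and> A \<in> sets borel"
  by (rule sets_restrict_space_iff) simp

lemma pos_measuresD:
  assumes "\<nu> \<in> pos_measures M"
  shows "sets \<nu> = sets M" "finite_measure \<nu>" "space \<nu> = space M"
    "\<And>f :: _ \<Rightarrow> real. f \<in> borel_measurable M \<Longrightarrow> f \<in> borel_measurable \<nu>"
  using assms sets_eq_imp_space_eq[of \<nu> M] measurable_cong_sets[of \<nu> M borel borel]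
  by (auto simp: pos_measures_def)

text \<open>
  The closed square: the fundamental domain \<open>QL L\<close> lies in it, and compactness
  arguments for periodic functions are carried out there.
\<close>

definition square :: "real \<Rightarrow> (real^2) set" where
  "square L = {x. \<forall>i. - (L/2) \<le> x $ i \<and> x $ i \<le> L/2}"

lemma compact_square: "compact (square L)"
proof -
  have "square L = cbox (\<chi> i. - (L/2)) (\<chi> i. L/2)" by (auto simp: square_def mem_box_cart)
  then show ?thesis by simp
qed

text \<open>
  The projection of the plane onto the fundamental domain.
\<close>

definition wrap :: "real \<Rightarrow> real^2 \<Rightarrow> real^2" where
  "wrap L x = (\<chi> i. L * frac (x $ i / L + 1/2) - L/2)"

lemma wrap_in_QL: "0 < L \<Longrightarrow> wrap L x \<in> QL L"
  using frac_lt_1 by (auto simp: wrap_def QL_def)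

lemma QL_subset_square: "QL L \<subseteq> square L"
  by (auto simp: QL_def square_def intro: less_imp_le)

lemma borel_measurable_vec_lambda:
  fixes f :: "'a \<Rightarrow> 'n::finite \<Rightarrow> real"
  assumes "\<And>i. (\<lambda>u. f u i) \<in> borel_measurable M"
  shows "(\<lambda>u. \<chi> i. f u i) \<in> borel_measurable M"
  by (subst borel_measurable_euclidean_space) (use assms in \<open>auto simp: Basis_vec_def inner_axis\<close>)

lemma wrap_measurable [measurable]: "wrap L \<in> borel_measurable borel"
  unfolding wrap_def frac_def by (intro borel_measurable_vec_lambda) measurable

lemma periodic_int:
  assumes "periodic L f"
  shows "f (x + (of_int k * L) *\<^sub>R axis i 1) = f x"
proof -
  have nat: "f (x + (of_nat n * L) *\<^sub>R axis i 1) = f x" for n x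
  proof (induction n arbitrary: x)
    case (Suc n)
    have "x + (of_nat (Suc n) * L) *\<^sub>R axis i 1 = (x + (of_nat n * L) *\<^sub>R axis i 1) + L *\<^sub>R axis i 1"
      by (simp add: algebra_simps)
    then show ?case using Suc assms unfolding periodic_def by metis
  qed simp
  show ?thesis
  proof (cases "0 \<le> k")
    case True
    then show ?thesis using nat[of x "nat k"] by simp
  next
    case False
    have "f (x + (of_int k * L) *\<^sub>R axis i 1) =
        f (x + (of_int k * L) *\<^sub>R axis i 1 + (of_nat (nat (- k)) * L) *\<^sub>R axis i 1)"
      by (rule nat[symmetric])
    also have "x + (of_int k * L) *\<^sub>R axis i 1 + (of_nat (nat (- k)) * L) *\<^sub>R axis i 1 = x"
      using False by (simp add: algebra_simps)
    finally show ?thesis .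
  qed
qed

lemma periodic_wrap:
  assumes "0 < L" "periodic L f"
  shows "f (wrap L x) = f x"
proof -
  define k where "k i = \<lfloor>x $ i / L + 1/2\<rfloor>" for i
  have "wrap L x $ i = x $ i - of_int (k i) * L" for i
    using assms(1) by (simp add: wrap_def frac_def k_def field_simps)
  then have "x = (wrap L x + (of_int (k 1) * L) *\<^sub>R axis 1 1) + (of_int (k 2) * L) *\<^sub>R axis 2 1"
    by (simp add: vec_eq_iff forall_2 axis_def)
  then show ?thesis using periodic_int[OF assms(2)] by metis
qed

lemma continuous_compact_bound:
  fixes f :: "'a::topological_space \<Rightarrow> real"
  assumes "compact S" "continuous_on S f"
  obtains K where "0 \<le> K" "\<And>x. x \<in> S \<Longrightarrow> \<bar>f x\<bar> \<le> K"
proof -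
  obtain K where K: "\<forall>x\<in>S. \<bar>f x\<bar> \<le> K"
    using compact_imp_bounded[OF compact_continuous_image[OF assms(2,1)]] by (auto simp: bounded_iff)
  then have "\<bar>f x\<bar> \<le> max 0 K" if "x \<in> S" for x using that by (meson le_max_iff_disj)
  then show thesis by (intro that[of "max 0 K"]) auto
qed

lemma periodic_bounded:
  fixes f :: "real^2 \<Rightarrow> real"
  assumes "0 < L" "periodic L f" "continuous_on UNIV f"
  obtains K where "0 \<le> K" "\<And>x. \<bar>f x\<bar> \<le> K"
proof -
  obtain K where K: "0 \<le> K" "\<And>x. x \<in> square L \<Longrightarrow> \<bar>f x\<bar> \<le> K"
    by (fact continuous_compact_bound[OF compact_square continuous_on_subset[OF assms(3) subset_UNIV]])
  have "\<bar>f x\<bar> \<le> K" for x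
    using K(2)[of "wrap L x"] wrap_in_QL[OF assms(1)] QL_subset_square periodic_wrap[OF assms(1,2)] by auto
  then show thesis using that K(1) by blast
qed

definition smooth_periodic :: "real \<Rightarrow> (real^2 \<Rightarrow> real) set" where
  "smooth_periodic L = {f. smooth f \<and> periodic L f}"

lemma function_space_smooth_periodic: "function_space (smooth_periodic L)"
  unfolding function_space_def smooth_periodic_def periodic_def by auto

lemma smooth_periodicI: "smooth f \<Longrightarrow> periodic L f \<Longrightarrow> f \<in> smooth_periodic L"
  by (simp add: smooth_periodic_def)

lemma smooth_periodicD:
  assumes "f \<in> smooth_periodic L"
  shows "smooth f" "periodic L f" "continuous_on A f"
  using assms smooth_continuous by (auto simp: smooth_periodic_def)

lemma smooth_periodic_const: "(\<lambda>_. c) \<in> smooth_periodic L"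
  by (auto simp: smooth_periodic_def periodic_def)

lemma smooth_periodic_mult:
  "f \<in> smooth_periodic L \<Longrightarrow> g \<in> smooth_periodic L \<Longrightarrow> (\<lambda>x. f x * g x) \<in> smooth_periodic L"
  by (auto simp: smooth_periodic_def periodic_def)

lemma smooth_periodic_compose:
  "smooth \<beta> \<Longrightarrow> f \<in> smooth_periodic L \<Longrightarrow> (\<lambda>x. \<beta> (f x)) \<in> smooth_periodic L"
  by (auto simp: smooth_periodic_def periodic_def intro: smooth_compose)

lemma smooth_periodic_borel: "f \<in> smooth_periodic L \<Longrightarrow> f \<in> borel_measurable borel"
  by (intro borel_measurable_continuous_onI smooth_periodicD)

lemma smooth_coord: "smooth (\<lambda>x::real^2. c * x $ i)"
  by (intro smooth_linear bounded_linear_const_mult bounded_linear_vec_nth)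

lemma smooth_periodic_cos_sin:
  assumes "0 < L"
  shows "(\<lambda>x. cos (2 * pi / L * x $ i + c)) \<in> smooth_periodic L"
    "(\<lambda>x. sin (2 * pi / L * x $ i + c)) \<in> smooth_periodic L"
proof -
  have eq: "2 * pi / L * (x + L *\<^sub>R axis j 1) $ i + c = 2 * pi / L * x $ i + c + (if i = j then 2 * pi else 0)"
    for x :: "real^2" and j
    using assms by (auto simp: axis_def add_divide_distrib distrib_left)
  have cos_eq: "cos (2 * pi / L * (x + L *\<^sub>R axis j 1) $ i + c) = cos (2 * pi / L * x $ i + c)"
    and sin_eq: "sin (2 * pi / L * (x + L *\<^sub>R axis j 1) $ i + c) = sin (2 * pi / L * x $ i + c)"
    for x :: "real^2" and j
    unfolding eq by auto
  show "(\<lambda>x. cos (2 * pi / L * x $ i + c)) \<in> smooth_periodic L"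
    by (intro smooth_periodicI smooth_compose[OF smooth_sin_cos(2)] smooth_add smooth_coord smooth_const)
      (unfold periodic_def cos_eq, blast)
  show "(\<lambda>x. sin (2 * pi / L * x $ i + c)) \<in> smooth_periodic L"
    by (intro smooth_periodicI smooth_compose[OF smooth_sin_cos(1)] smooth_add smooth_coord smooth_const)
      (unfold periodic_def sin_eq, blast)
qed

text \<open>
  For \<open>- L/2 \<le> c < L/2\<close> the points of the circle with \<open>c < x\<^sub>i <
  L/2\<close> form an arc centred at \<open>m = (c + L/2) / 2\<close>, and \<open>cos (2 \<pi>
  (x\<^sub>i - m) / L)\<close> exceeds its value at the ends exactly on this arc. Composition with
  \<open>exp_flat\<close> makes the function nonnegative and keeps it smooth.
\<close>

lemma halfspace_periodic_function:
  assumes L: "0 < L"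
  obtains f where "f \<in> smooth_periodic L" "\<And>x. 0 \<le> f x"
    "\<And>x. x \<in> QL L \<Longrightarrow> 0 < f x \<longleftrightarrow> c < x $ i"
proof -
  consider "c < - (L/2)" | "L/2 \<le> c" | "- (L/2) \<le> c" "c < L/2" by linarith
  then show thesis
  proof cases
    case 1
    have "0 < (1::real) \<longleftrightarrow> c < x $ i" if "x \<in> QL L" for x
      using that 1 by (auto simp: QL_def intro: less_le_trans)
    then show thesis by (intro that[of "\<lambda>_. 1"] smooth_periodic_const) auto
  next
    case 2
    have "0 < (0::real) \<longleftrightarrow> c < x $ i" if "x \<in> QL L" for x
    proof -
      have "x $ i < L/2" using that by (auto simp: QL_def)
      then show ?thesis using 2 by linarith
    qed
    then show thesis by (intro that[of "\<lambda>_. 0"] smooth_periodic_const) auto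
  next
    case 3
    define m where "m = (c + L/2) / 2"
    define \<theta>0 where "\<theta>0 = pi - 2 * pi / L * m"
    define g where "g x = cos (2 * pi / L * x $ i + (- (2 * pi / L * m))) - cos \<theta>0" for x :: "real^2"
    have m: "0 \<le> m" "m < L/2" using 3 by (auto simp: m_def)
    have "2 * pi / L * m < pi" using m L by (simp add: field_simps)
    then have \<theta>0: "0 < \<theta>0" "\<theta>0 \<le> pi" using m L by (auto simp: \<theta>0_def)
    have g_iff: "0 < g x \<longleftrightarrow> c < x $ i" if x: "x \<in> QL L" for x
    proof -
      define \<theta> where "\<theta> = 2 * pi / L * (x $ i - m)"
      have g: "g x = cos \<theta> - cos \<theta>0" by (simp add: g_def \<theta>_def right_diff_distrib)
      have xb: "- (L/2) \<le> x $ i" "x $ i < L/2" using x by (auto simp: QL_def)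
      have up: "\<theta> < \<theta>0"
      proof -
        have "2 * pi / L * (x $ i - m) < 2 * pi / L * (L/2 - m)"
          using xb L by (intro mult_strict_left_mono) auto
        also have "\<dots> = \<theta>0" using L by (simp add: \<theta>0_def field_simps)
        finally show ?thesis by (simp add: \<theta>_def)
      qed
      have lo: "\<theta>0 - 2 * pi \<le> \<theta>"
      proof -
        have "\<theta>0 - 2 * pi = 2 * pi / L * (- (L/2) - m)" using L by (simp add: \<theta>0_def field_simps)
        also have "\<dots> \<le> \<theta>" unfolding \<theta>_def using xb L by (intro mult_left_mono) auto
        finally show ?thesis .
      qed
      have mid: "- \<theta>0 < \<theta> \<longleftrightarrow> c < x $ i"
      proof -
        have "- \<theta>0 = 2 * pi / L * (c - m)" using L by (simp add: \<theta>0_def m_def field_simps)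
        then have "- \<theta>0 < \<theta> \<longleftrightarrow> 2 * pi / L * (c - m) < 2 * pi / L * (x $ i - m)" by (simp add: \<theta>_def)
        also have "\<dots> \<longleftrightarrow> c - m < x $ i - m" using L by (intro mult_less_cancel_left_pos) simp
        finally show ?thesis by simp
      qed
      show ?thesis
      proof (cases "- \<theta>0 < \<theta>")
        case True
        have "cos \<theta>0 < cos \<bar>\<theta>\<bar>"
          using True up \<theta>0 by (intro cos_monotone_0_pi) auto
        then show ?thesis using True mid g by simp
      next
        case False
        have "cos \<bar>\<theta>\<bar> \<le> cos \<theta>0"
        proof (cases "\<bar>\<theta>\<bar> \<le> pi")
          case True
          then show ?thesis using False \<theta>0 by (intro cos_monotone_0_pi_le) auto
        next
          case F: False
          have "cos (2 * pi - \<bar>\<theta>\<bar>) \<le> cos \<theta>0"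
            using F False \<theta>0 lo by (intro cos_monotone_0_pi_le) auto
          then show ?thesis by simp
        qed
        then show ?thesis using False mid g by simp
      qed
    qed
    have g: "g \<in> smooth_periodic L"
      unfolding g_def using function_spaceD(5)[OF function_space_smooth_periodic
        smooth_periodic_cos_sin(1)[OF L] smooth_periodic_const] .
    show thesis
      by (rule that[of "\<lambda>x. exp_flat (g x)"])
        (use g g_iff smooth_periodic_compose[OF smooth_exp_flat] in \<open>auto simp: exp_flat_props\<close>)
  qed
qed

lemma exp_flat_LIMSEQ_positivity:
  "(\<lambda>n. exp_flat (real n * f x)) \<longlonglongrightarrow> indicator {x. 0 < f x} x"
  using exp_flat_scaled_LIMSEQ[of "f x"] by (simp add: indicator_def)

lemma integral_exp_flat_LIMSEQ:
  assumes "finite_measure M" and f: "f \<in> borel_measurable M"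
  shows "(\<lambda>n. LINT x|M. exp_flat (real n * f x)) \<longlonglongrightarrow> measure M {x \<in> space M. 0 < f x}"
proof -
  interpret finite_measure M by fact
  have [measurable]: "exp_flat \<in> borel_measurable borel"
    using smooth_exp_flat by (rule smooth_borel)
  have "(\<lambda>n. LINT x|M. exp_flat (real n * f x)) \<longlonglongrightarrow> (LINT x|M. indicat_real {0<..} (f x))"
    by (rule integral_dominated_convergence[where w = "\<lambda>_. 1"])
      (use f exp_flat_scaled_LIMSEQ in \<open>auto simp: exp_flat_props\<close>)
  also have "(LINT x|M. indicat_real {0<..} (f x)) = (LINT x|M. indicat_real {x \<in> space M. 0 < f x} x)"
    by (intro Bochner_Integration.integral_cong) (auto simp: indicator_def)
  also have "\<dots> = measure M {x \<in> space M. 0 < f x}"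
    using f by simp
  finally show ?thesis .
qed

text \<open>
  The product of nonnegative functions is positive exactly where both factors are.
\<close>

lemma Int_stable_positivity_sets:
  fixes \<F> :: "('a \<Rightarrow> real) set"
  assumes mult: "\<And>f g. f \<in> \<F> \<Longrightarrow> g \<in> \<F> \<Longrightarrow> (\<lambda>x. f x * g x) \<in> \<F>"
    and nonneg: "\<And>f x. f \<in> \<F> \<Longrightarrow> 0 \<le> f x"
  shows "Int_stable ((\<lambda>f. {x \<in> \<Omega>. 0 < f x}) ` \<F>)" (is "Int_stable ?E")
proof (rule Int_stableI)
  fix a b assume "a \<in> ?E" "b \<in> ?E"
  then obtain f g where fg: "f \<in> \<F>" "g \<in> \<F>" "a = {x \<in> \<Omega>. 0 < f x}" "b = {x \<in> \<Omega>. 0 < g x}"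
    by auto
  have "a \<inter> b = {x \<in> \<Omega>. 0 < f x * g x}"
    unfolding fg(3,4) using nonneg[OF fg(1)] nonneg[OF fg(2)]
    by (auto simp: zero_less_mult_iff not_less[symmetric])
  then show "a \<inter> b \<in> ?E" using mult[OF fg(1,2)] by (auto intro!: image_eqI[of _ _ "\<lambda>x. f x * g x"])
qed

text \<open>
  Integrals of smooth functions determine a measure: sets of positivity \<open>{f > 0}\<close> are
  stable under intersection, and their indicators are limits of functions from the same family.
\<close>

lemma measure_eqI_positivity_sets:
  fixes \<F> :: "('a \<Rightarrow> real) set"
  assumes fin: "finite_measure M" "finite_measure N" and sets: "sets M = sets N"
    and gen: "sets M = sigma_sets (space M) ((\<lambda>f. {x \<in> space M. 0 < f x}) ` \<F>)"
    and mult: "\<And>f g. f \<in> \<F> \<Longrightarrow> g \<in> \<F> \<Longrightarrow> (\<lambda>x. f x * g x) \<in> \<F>"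
    and nonneg: "\<And>f x. f \<in> \<F> \<Longrightarrow> 0 \<le> f x"
    and meas: "\<And>f. f \<in> \<F> \<Longrightarrow> f \<in> borel_measurable M"
    and approx: "\<And>f. f \<in> \<F> \<Longrightarrow> \<exists>g. \<forall>x. (\<forall>n. g n \<in> \<F> \<and> g n x \<le> 1) \<and>
        (\<lambda>n::nat. g n x) \<longlonglongrightarrow> indicator {x. 0 < f x} x"
    and eq: "\<And>f. f \<in> \<F> \<Longrightarrow> (LINT x|M. f x) = (LINT x|N. f x)"
    and cover: "\<And>n. h n \<in> \<F>" "(\<Union>n::nat. {x \<in> space M. 0 < h n x}) = space M"
  shows "M = N"
proof (rule measure_eqI_generator_eq[OF _ _ _ gen])
  interpret M: finite_measure M by fact
  interpret N: finite_measure N by fact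
  let ?E = "(\<lambda>f. {x \<in> space M. 0 < f x}) ` \<F>"
  have sp: "space N = space M" using sets_eq_imp_space_eq[OF sets] by simp
  show "Int_stable ?E" by (rule Int_stable_positivity_sets) (use mult nonneg in blast)+
  have lim: "(\<lambda>n. LINT x|K. g n x) \<longlonglongrightarrow> measure K {x \<in> space K. 0 < f x}"
    if K: "finite_measure K" "sets K = sets M" and f: "f \<in> \<F>"
      and g: "\<forall>x. (\<forall>n. g n \<in> \<F> \<and> g n x \<le> 1) \<and> (\<lambda>n::nat. g n x) \<longlonglongrightarrow> indicator {x. 0 < f x} x" for K f g
  proof -
    interpret K: finite_measure K by (rule K)
    have Km: "h \<in> borel_measurable K" if "h \<in> \<F>" for h
      using meas[OF that] measurable_cong_sets[OF K(2) refl] by blast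
    have "(\<lambda>n. LINT x|K. g n x) \<longlonglongrightarrow> (LINT x|K. indicat_real {x \<in> space K. 0 < f x} x)"
    proof (rule integral_dominated_convergence[where w = "\<lambda>_. 1"])
      show "AE x in K. (\<lambda>n. g n x) \<longlonglongrightarrow> indicat_real {x \<in> space K. 0 < f x} x"
      proof (rule AE_I2)
        fix x assume "x \<in> space K"
        then have "indicat_real {x \<in> space K. 0 < f x} x = indicator {x. 0 < f x} x" by (simp add: indicator_def)
        then show "(\<lambda>n. g n x) \<longlonglongrightarrow> indicat_real {x \<in> space K. 0 < f x} x" using g by simp
      qed
      show "AE x in K. norm (g n x) \<le> 1" for n using g nonneg by (auto intro!: AE_I2)
      show "indicat_real {x \<in> space K. 0 < f x} \<in> borel_measurable K" using Km[OF f] by measurable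
      show "g n \<in> borel_measurable K" for n using g Km by blast
    qed simp
    then show ?thesis using Km[OF f] by simp
  qed
  show "emeasure M X = emeasure N X" if "X \<in> ?E" for X
  proof -
    obtain f where f: "f \<in> \<F>" "X = {x \<in> space M. 0 < f x}" using \<open>X \<in> ?E\<close> by auto
    obtain g where g: "\<forall>x. (\<forall>n. g n \<in> \<F> \<and> g n x \<le> 1) \<and> (\<lambda>n::nat. g n x) \<longlonglongrightarrow> indicator {x. 0 < f x} x"
      using approx[OF f(1)] by blast
    have "(LINT x|M. g n x) = (LINT x|N. g n x)" for n using g eq by blast
    then have "measure M {x \<in> space M. 0 < f x} = measure N {x \<in> space N. 0 < f x}"
      using lim[OF fin(1) refl f(1) g] lim[OF fin(2) sets[symmetric] f(1) g] LIMSEQ_unique by simp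
    then have "measure M X = measure N X" by (simp add: f(2) sp)
    then show ?thesis by (simp add: M.emeasure_eq_measure N.emeasure_eq_measure)
  qed
  show "range (\<lambda>n. {x \<in> space M. 0 < h n x}) \<subseteq> ?E" using cover(1) by auto
  show "(\<Union>n. {x \<in> space M. 0 < h n x}) = space M" by (rule cover(2))
  show "emeasure M {x \<in> space M. 0 < h n x} \<noteq> \<infinity>" for n by simp
  show "sets N = sigma_sets (space M) ?E" using gen sets by simp
qed auto

text \<open>
  Half-spaces already generate the Borel sets of the fundamental domain.
\<close>

lemma sets_borel_QL_generated:
  assumes L: "0 < L"
  shows "sets (borel_QL L) =
    sigma_sets (QL L) ((\<lambda>f. {x \<in> QL L. 0 < f x}) ` {f \<in> smooth_periodic L. \<forall>x. 0 \<le> f x})"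
    (is "_ = sigma_sets _ ?E")
proof (rule antisym)
  show "sigma_sets (QL L) ?E \<subseteq> sets (borel_QL L)"
  proof (rule sets.sigma_sets_subset[of _ "borel_QL L", simplified])
    show "?E \<subseteq> sets (borel_QL L)"
      unfolding sets_borel_QL[THEN eq_reflection] subset_eq
    proof safe
      fix f x assume f: "f \<in> smooth_periodic L"
      show "{x \<in> QL L. 0 < f x} \<in> sets borel" using smooth_periodic_borel[OF f] by measurable
    qed
  qed
  let ?H = "(\<lambda>(a, i). {x::real^2. a < x \<bullet> i}) ` (UNIV \<times> Basis)"
  have b: "sets (borel :: (real^2) measure) = sigma_sets UNIV ?H"
    by (subst borel_eq_halfspace_greater) simp
  have "sets (borel_QL L) = (\<inter>) (QL L) ` sigma_sets UNIV ?H"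
    by (simp only: sets_restrict_space b)
  also have "\<dots> = sigma_sets (QL L) ((\<inter>) (QL L) ` ?H)"
    by (rule sigma_sets_Int) (use QL_borel[of L] b in auto)
  also have "\<dots> \<subseteq> sigma_sets (QL L) ?E"
  proof (rule sigma_sets_mono')
    show "(\<inter>) (QL L) ` ?H \<subseteq> ?E"
    proof safe
      fix a and b :: "real^2" assume "b \<in> Basis"
      then obtain i where b: "b = axis i 1" by (auto simp: Basis_vec_def)
      obtain f where f: "f \<in> smooth_periodic L" "\<And>x. 0 \<le> f x" "\<And>x. x \<in> QL L \<Longrightarrow> 0 < f x \<longleftrightarrow> a < x $ i"
        using halfspace_periodic_function[OF L] by blast
      show "QL L \<inter> {x. a < x \<bullet> b} \<in> ?E"
        by (rule image_eqI[of _ _ f]) (use f b in \<open>auto simp: inner_axis\<close>)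
    qed
  qed
  finally show "sets (borel_QL L) \<subseteq> sigma_sets (QL L) ?E" .
qed

lemma measure_eqI_smooth_periodic:
  assumes L: "0 < L" and M: "M \<in> pos_measures (borel_QL L)" and N: "N \<in> pos_measures (borel_QL L)"
    and eq: "\<And>f. f \<in> smooth_periodic L \<Longrightarrow> (LINT x|M. f x) = (LINT x|N. f x)"
  shows "M = N"
proof (rule measure_eqI_positivity_sets[where \<F> = "{f \<in> smooth_periodic L. \<forall>x. 0 \<le> f x}" and h = "\<lambda>_ _. 1"])
  note Ms = pos_measuresD[OF M] and Ns = pos_measuresD[OF N]
  show "finite_measure M" "finite_measure N" "sets M = sets N" using Ms(1,2) Ns(1,2) by simp_all
  have sp: "space M = QL L" using Ms(3) by simp
  show "sets M = sigma_sets (space M) ((\<lambda>f. {x \<in> space M. 0 < f x}) ` {f \<in> smooth_periodic L. \<forall>x. 0 \<le> f x})"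
    unfolding sp Ms(1) by (rule sets_borel_QL_generated[OF L])
  show "f \<in> borel_measurable M" if "f \<in> {f \<in> smooth_periodic L. \<forall>x. 0 \<le> f x}" for f
    using that by (intro Ms(4) measurable_restrict_space1 smooth_periodic_borel) auto
  show "\<exists>g. \<forall>x. (\<forall>n. g n \<in> {f \<in> smooth_periodic L. \<forall>x. 0 \<le> f x} \<and> g n x \<le> 1) \<and>
      (\<lambda>n::nat. g n x) \<longlonglongrightarrow> indicator {x. 0 < f x} x" if "f \<in> {f \<in> smooth_periodic L. \<forall>x. 0 \<le> f x}" for f
    using that by (intro exI[of _ "\<lambda>n x. exp_flat (real n * f x)"])
      (auto simp: exp_flat_props intro!: exp_flat_LIMSEQ_positivity smooth_periodic_compose[OF smooth_exp_flat]
        smooth_periodic_mult[OF smooth_periodic_const])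
qed (use eq smooth_periodic_const smooth_periodic_mult in auto)

text \<open>
  A continuous periodic function factors through the embedding \<open>x \<mapsto> (cos (2 \<pi> x /
  L), sin (2 \<pi> x / L))\<close> of the torus into Euclidean space, whose image is compact. There
  the Stone-Weierstrass theorem provides polynomials, and a polynomial in sines and cosines is
  smooth and periodic.
\<close>

lemma smooth_periodic_dense:
  fixes f :: "real^2 \<Rightarrow> real"
  assumes L: "0 < L" and per: "periodic L f" and cont: "continuous_on UNIV f" and e: "0 < e"
  obtains g where "g \<in> smooth_periodic L" "\<And>x. \<bar>f x - g x\<bar> < e"
proof -
  define E :: "real^2 \<Rightarrow> (real^2) \<times> (real^2)" where
    "E x = (\<chi> i. cos (2 * pi / L * x $ i), \<chi> i. sin (2 * pi / L * x $ i))" for x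
  \<comment> \<open>The function on the image of the torus through which \<open>f\<close> factors.\<close>
  define F where "F s = f (SOME x. x \<in> square L \<and> E x = s)" for s
  have contE: "continuous_on A E" for A
    unfolding E_def by (intro continuous_intros)
  have inj: "f x = f y" if "E x = E y" for x y
  proof -
    have "frac (x $ i / L + 1/2) = frac (y $ i / L + 1/2)" for i
    proof -
      have "sin (2 * pi / L * x $ i) = sin (2 * pi / L * y $ i) \<and> cos (2 * pi / L * x $ i) = cos (2 * pi / L * y $ i)"
        using that by (auto simp: E_def vec_eq_iff)
      then obtain n :: int where n: "2 * pi / L * x $ i = 2 * pi / L * y $ i + 2 * pi * of_int n"
        using sin_cos_eq_iff by blast
      have "x $ i / L = y $ i / L + of_int n"
      proof -
        have "2 * pi * (x $ i / L) = 2 * pi * (y $ i / L + of_int n)" using n by (simp add: algebra_simps)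
        then show ?thesis by (subst (asm) mult_cancel_left) (use pi_gt_zero in auto)
      qed
      then have "x $ i / L + 1/2 = (y $ i / L + 1/2) + of_int n" by simp
      then show ?thesis by (metis frac_add_of_int_right)
    qed
    then have "wrap L x = wrap L y" by (simp add: wrap_def)
    then show ?thesis using periodic_wrap[OF L per] by metis
  qed
  have FE: "F (E x) = f x" if "x \<in> square L" for x
  proof -
    have "(SOME y. y \<in> square L \<and> E y = E x) \<in> square L \<and> E (SOME y. y \<in> square L \<and> E y = E x) = E x"
      by (rule someI[of _ x]) (use that in simp)
    then show ?thesis unfolding F_def by (intro inj) simp
  qed
  have cS: "compact (E ` square L)" by (intro compact_continuous_image contE compact_square)
  have contF: "continuous_on (E ` square L) F"
    unfolding continuous_on_closed_vimage[OF compact_imp_closed[OF cS]]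
  proof (intro allI impI)
    fix B :: "real set" assume "closed B"
    have "F -` B \<inter> E ` square L = E ` (square L \<inter> f -` B)" using FE by force
    moreover have "closed (f -` B)" by (rule closed_vimage[OF \<open>closed B\<close> cont])
    then have "compact (E ` (square L \<inter> f -` B))"
      by (intro compact_continuous_image contE compact_Int_closed compact_square)
    ultimately show "closed (F -` B \<inter> E ` square L)" by (simp add: compact_imp_closed)
  qed
  obtain P where P: "real_polynomial_function P" "\<And>s. s \<in> E ` square L \<Longrightarrow> \<bar>F s - P s\<bar> < e"
    using Stone_Weierstrass_real_polynomial_function[OF cS contF e] by blast
  note V = function_spaceD[OF function_space_smooth_periodic[of L]]
  have cs: "(\<lambda>x. cos (2 * pi / L * x $ i)) \<in> smooth_periodic L" "(\<lambda>x. sin (2 * pi / L * x $ i)) \<in> smooth_periodic L" for i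
    using smooth_periodic_cos_sin[OF L, of i 0] by simp_all
  have PE: "(\<lambda>x. P (E x)) \<in> smooth_periodic L"
    using P(1)
  proof (induction)
    case (linear h)
    have "h (E x) = (cos (2 * pi / L * x $ 1) * h (axis 1 1, 0) + cos (2 * pi / L * x $ 2) * h (axis 2 1, 0))
      + (sin (2 * pi / L * x $ 1) * h (0, axis 1 1) + sin (2 * pi / L * x $ 2) * h (0, axis 2 1))" for x
    proof -
      have "E x = (cos (2 * pi / L * x $ 1) *\<^sub>R (axis 1 1, 0) + cos (2 * pi / L * x $ 2) *\<^sub>R (axis 2 1, 0))
        + (sin (2 * pi / L * x $ 1) *\<^sub>R (0, axis 1 1) + sin (2 * pi / L * x $ 2) *\<^sub>R (0, axis 2 1))"
        by (simp add: E_def vec_eq_iff forall_2 axis_def)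
      then show ?thesis
        by (simp only: linear_add[OF bounded_linear.linear[OF linear]]
            linear_scale[OF bounded_linear.linear[OF linear]] real_scaleR_def)
    qed
    moreover have "(\<lambda>x. (cos (2 * pi / L * x $ 1) * h (axis 1 1, 0) + cos (2 * pi / L * x $ 2) * h (axis 2 1, 0))
      + (sin (2 * pi / L * x $ 1) * h (0, axis 1 1) + sin (2 * pi / L * x $ 2) * h (0, axis 2 1))) \<in> smooth_periodic L"
      by (intro V(2) smooth_periodic_mult smooth_periodic_const cs)
    ultimately show ?case by simp
  next
    case (const c) show ?case by (rule smooth_periodic_const)
  next
    case (add f g) then show ?case by (intro V(2))
  next
    case (mult f g) then show ?case by (intro smooth_periodic_mult)
  qed
  show thesis
  proof
    show "(\<lambda>x. P (E x)) \<in> smooth_periodic L" by (rule PE)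
    fix x
    have w: "wrap L x \<in> square L" using wrap_in_QL[OF L] QL_subset_square by auto
    have "\<bar>f (wrap L x) - P (E (wrap L x))\<bar> < e"
      using P(2)[of "E (wrap L x)"] FE[OF w] w by auto
    then show "\<bar>f x - P (E x)\<bar> < e"
      using periodic_wrap[OF L per, of x] periodic_wrap[OF L smooth_periodicD(2)[OF PE], of x] by simp
  qed
qed

section \<open>A Riesz representation theorem on the torus\<close>

definition bounded_functions :: "('a \<Rightarrow> real) set" where
  "bounded_functions = {f. \<exists>K. \<forall>x. \<bar>f x\<bar> \<le> K}"

lemma bounded_functionsI: "(\<And>x. \<bar>f x\<bar> \<le> K) \<Longrightarrow> f \<in> bounded_functions"
  unfolding bounded_functions_def by auto

lemma function_space_bounded_functions: "function_space bounded_functions"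
  unfolding function_space_def
proof (intro conjI ballI allI)
  show "(\<lambda>_. 0) \<in> bounded_functions" by (rule bounded_functionsI[of _ 0]) auto
  fix f :: "'a \<Rightarrow> real" assume "f \<in> bounded_functions"
  then obtain K where K: "\<And>x. \<bar>f x\<bar> \<le> K" unfolding bounded_functions_def by auto
  show "(\<lambda>x. c * f x) \<in> bounded_functions" for c
    by (rule bounded_functionsI[of _ "\<bar>c\<bar> * K"]) (auto simp: abs_mult intro!: mult_left_mono K)
  fix g :: "'a \<Rightarrow> real" assume "g \<in> bounded_functions"
  then obtain K' where K': "\<And>x. \<bar>g x\<bar> \<le> K'" unfolding bounded_functions_def by auto
  show "(\<lambda>x. f x + g x) \<in> bounded_functions"
    by (rule bounded_functionsI[of _ "K + K'"]) (use K K' in \<open>meson abs_triangle_ineq add_mono order_trans\<close>)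
qed

lemma linear_functional_sum:
  assumes V: "function_space V" and q: "linear_functional_on V q"
    and fin: "finite S" and f: "\<And>i. i \<in> S \<Longrightarrow> f i \<in> V"
  shows "(\<lambda>x. \<Sum>i\<in>S. f i x) \<in> V \<and> q (\<lambda>x. \<Sum>i\<in>S. f i x) = (\<Sum>i\<in>S. q (f i))"
  using fin f
proof (induction S)
  case empty
  show ?case using linear_functional_onD(2)[OF q function_spaceD(1)[OF V], of 0] function_spaceD(1)[OF V] by simp
next
  case (insert i S)
  then show ?case using linear_functional_onD(1)[OF q] function_spaceD(2)[OF V] by simp
qed

text \<open>
  The sets \<open>A\<^sub>0, A\<^sub>1, \<dots>\<close> are the events that the successive bits of a
  point are set. Subdividing \<open>[0, q 1)\<close> into intervals whose lengths are the masses of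
  the cells, each interval being split into the two intervals of its children, defines bits on the
  real line with the same joint laws. The finitely additive \<open>q\<close> is thereby replaced by
  the countably additive Lebesgue measure.
\<close>

lemma bit_representation:
  fixes q :: "('a \<Rightarrow> real) \<Rightarrow> real" and A :: "nat \<Rightarrow> 'a set"
  assumes q: "linear_functional_on bounded_functions q"
    and pos: "\<And>f. f \<in> bounded_functions \<Longrightarrow> (\<And>x. 0 \<le> f x) \<Longrightarrow> 0 \<le> q f"
  obtains bit :: "real \<Rightarrow> nat \<Rightarrow> bool" where "\<And>k. {u. bit u k} \<in> sets borel"
    "\<And>n G. q (\<lambda>x. G (map (\<lambda>k. x \<in> A k) [0..<n])) =
       (LINT u:{0..<q (\<lambda>_. 1)}|lborel. G (map (bit u) [0..<n]))"
proof -
  note V = function_space_bounded_functions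
  define code where "code x n = map (\<lambda>k. x \<in> A k) [0..<n]" for x n
  define cell where "cell w = {x. code x (length w) = w}" for w
  define mass where "mass w = q (indicat_real (cell w))" for w
  have ind: "indicat_real B \<in> bounded_functions" for B :: "'a set"
    by (rule bounded_functionsI[of _ 1]) (auto simp: indicator_def)
  have mass0: "0 \<le> mass w" for w unfolding mass_def by (rule pos[OF ind]) auto
  have code_Suc: "code x (Suc n) = code x n @ [x \<in> A n]" for x n by (simp add: code_def)
  have mass_split: "mass w = mass (w @ [False]) + mass (w @ [True])" for w
  proof -
    have "indicat_real (cell w) = (\<lambda>x. indicat_real (cell (w @ [False])) x + indicat_real (cell (w @ [True])) x)"
      by (auto simp: cell_def code_Suc indicator_def fun_eq_iff)
    then show ?thesis unfolding mass_def using linear_functional_onD(1)[OF q ind ind] by simp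
  qed
  define M where "M = q (\<lambda>_. 1)"
  have M: "mass [] = M"
  proof -
    have "indicat_real (cell []) = (\<lambda>_. 1)" by (auto simp: cell_def code_def)
    then show ?thesis by (simp add: mass_def M_def)
  qed
  \<comment> \<open>The left end of the interval of the word \<open>w\<close>: each bit that is set skips the
    sibling with that bit cleared.\<close>
  define lft where "lft w = (\<Sum>k<length w. if w ! k then mass (take k w @ [False]) else 0)" for w
  have lft_Nil: "lft [] = 0" by (simp add: lft_def)
  have lft_snoc: "lft (w @ [b]) = lft w + (if b then mass (w @ [False]) else 0)" for w b
    by (auto simp: lft_def nth_append intro!: sum.cong)
  \<comment> \<open>The word of length \<open>n\<close> whose interval contains \<open>u\<close>.\<close>
  define W where "W u = rec_nat [] (\<lambda>_ w. w @ [lft w + mass (w @ [False]) \<le> u])" for u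
  have W0: "W u 0 = []" and WS: "W u (Suc n) = W u n @ [lft (W u n) + mass (W u n @ [False]) \<le> u]" for u n
    by (simp_all add: W_def)
  have lenW: "length (W u n) = n" for u n by (induction n) (auto simp: W0 WS)
  have Wset: "u \<in> {0..<M} \<and> W u (length w) = w \<longleftrightarrow> u \<in> {lft w..<lft w + mass w}" for w u
  proof (induction w rule: rev_induct)
    case Nil then show ?case by (simp add: W0 M lft_Nil)
  next
    case (snoc b w)
    have "u \<in> {0..<M} \<and> W u (length (w @ [b])) = w @ [b] \<longleftrightarrow>
        u \<in> {lft w..<lft w + mass w} \<and> (lft w + mass (w @ [False]) \<le> u) = b"
      unfolding snoc[symmetric] by (auto simp: WS)
    also have "\<dots> \<longleftrightarrow> u \<in> {lft (w @ [b])..<lft (w @ [b]) + mass (w @ [b])}"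
      using mass_split[of w] mass0[of "w @ [False]"] mass0[of "w @ [True]"]
      by (cases b) (auto simp: lft_snoc)
    finally show ?case .
  qed
  define words where "words n = {w :: bool list. length w = n}" for n
  have fin_words: "finite (words n)" for n
    using finite_lists_length_eq[of "UNIV :: bool set" n] by (simp add: words_def)
  have Wmeas: "{u. W u n = w} \<in> sets borel" for n w
  proof (induction n arbitrary: w)
    case 0 show ?case by (cases "w = []") (auto simp: W0)
  next
    case (Suc n)
    have "{u. W u (Suc n) = w} =
        (\<Union>v\<in>words n. {u. W u n = v} \<inter> {u. v @ [lft v + mass (v @ [False]) \<le> u] = w})"
      using lenW by (auto simp: WS words_def)
    moreover have "{u. v @ [lft v + mass (v @ [False]) \<le> u] = w} \<in> sets borel" for v
    proof -
      have "{u. v @ [lft v + mass (v @ [False]) \<le> u] = w} =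
        (if w = v @ [True] then {lft v + mass (v @ [False])..} else if w = v @ [False] then {..<lft v + mass (v @ [False])} else {})"
        by auto
      then show ?thesis by simp
    qed
    ultimately show ?case using Suc fin_words by auto
  qed
  define bit where "bit u k = last (W u (Suc k))" for u k
  have W_bit: "W u n = map (bit u) [0..<n]" for u n
    by (induction n) (auto simp: W0 WS bit_def)
  show thesis
  proof
    show "{u. bit u k} \<in> sets borel" for k
    proof -
      have "{u. bit u k} = (\<Union>w\<in>{w \<in> words (Suc k). last w}. {u. W u (Suc k) = w})"
        using lenW by (auto simp: bit_def words_def)
      then show ?thesis using Wmeas fin_words by auto
    qed
    fix n and G :: "bool list \<Rightarrow> real"
    have "(\<lambda>x. G (code x n)) = (\<lambda>x. \<Sum>w\<in>words n. G w * indicat_real (cell w) x)"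
    proof
      fix x
      have "(\<Sum>w\<in>words n. G w * indicat_real (cell w) x) = (\<Sum>w\<in>{code x n}. G w * indicat_real (cell w) x)"
        by (rule sum.mono_neutral_right[OF fin_words]) (auto simp: words_def cell_def code_def)
      also have "\<dots> = G (code x n)" by (simp add: cell_def code_def)
      finally show "G (code x n) = (\<Sum>w\<in>words n. G w * indicat_real (cell w) x)" by simp
    qed
    then have "q (\<lambda>x. G (code x n)) = (\<Sum>w\<in>words n. q (\<lambda>x. G w * indicat_real (cell w) x))"
      using linear_functional_sum[OF V q fin_words, of n "\<lambda>w x. G w * indicat_real (cell w) x"]
        function_spaceD(3)[OF V ind] by simp
    also have "\<dots> = (\<Sum>w\<in>words n. G w * mass w)"
      unfolding mass_def by (intro sum.cong refl linear_functional_onD(2)[OF q ind])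
    also have "\<dots> = (\<Sum>w\<in>words n. (LINT u|lborel. G w * indicat_real {lft w..<lft w + mass w} u))"
      using mass0 by simp
    also have "\<dots> = (LINT u|lborel. (\<Sum>w\<in>words n. G w * indicat_real {lft w..<lft w + mass w} u))"
      by (rule Bochner_Integration.integral_sum[symmetric])
        (use mass0 in \<open>auto simp: integrable_indicator_iff\<close>)
    also have "\<dots> = (LINT u:{0..<M}|lborel. G (W u n))"
      unfolding set_lebesgue_integral_def
    proof (intro Bochner_Integration.integral_cong refl)
      fix u :: real
      have "(\<Sum>w\<in>words n. G w * indicat_real {lft w..<lft w + mass w} u) =
          (\<Sum>w\<in>words n. if w = W u n then indicat_real {0..<M} u * G (W u n) else 0)"
      proof (intro sum.cong refl)
        fix w assume "w \<in> words n"
        then have "indicat_real {lft w..<lft w + mass w} u = (if w = W u n then indicat_real {0..<M} u else 0)"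
          using Wset[of u w] by (auto simp: indicator_def words_def)
        then show "G w * indicat_real {lft w..<lft w + mass w} u =
            (if w = W u n then indicat_real {0..<M} u * G (W u n) else 0)" by simp
      qed
      also have "\<dots> = indicat_real {0..<M} u *\<^sub>R G (W u n)"
        using fin_words lenW by (subst sum.delta) (auto simp: words_def)
      finally show "(\<Sum>w\<in>words n. G w * indicat_real {lft w..<lft w + mass w} u) =
          indicat_real {0..<M} u *\<^sub>R G (W u n)" .
    qed
    finally show "q (\<lambda>x. G (map (\<lambda>k. x \<in> A k) [0..<n])) =
       (LINT u:{0..<q (\<lambda>_. 1)}|lborel. G (map (bit u) [0..<n]))"
      by (simp add: code_def W_bit M_def)
  qed
qed

lemma floor_double: "\<lfloor>2 * z\<rfloor> = 2 * \<lfloor>z\<rfloor> + (if odd \<lfloor>2 * z\<rfloor> then 1 else 0)" for z :: real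
proof -
  have "\<lfloor>2 * z\<rfloor> = 2 * \<lfloor>z\<rfloor> \<or> \<lfloor>2 * z\<rfloor> = 2 * \<lfloor>z\<rfloor> + 1" by linarith
  then show ?thesis by auto
qed

text \<open>
  The first \<open>N\<close> binary digits of \<open>y\<close>, read off from the parity of
  \<open>\<lfloor>2\<^sup>j y\<rfloor>\<close>, give the dyadic approximation of \<open>y\<close>
  from below.
\<close>

lemma binary_digits_sum:
  fixes y :: real
  assumes "0 \<le> y" "y < 1"
  shows "(\<Sum>j<N. if odd \<lfloor>2 ^ Suc j * y\<rfloor> then (1/2) ^ Suc j else 0) = \<lfloor>2 ^ N * y\<rfloor> / 2 ^ N"
proof (induction N)
  case 0
  have "\<lfloor>y\<rfloor> = 0" using assms by linarith
  then show ?case by simp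
next
  case (Suc N)
  have "real_of_int \<lfloor>2 ^ Suc N * y\<rfloor> = 2 * of_int \<lfloor>2 ^ N * y\<rfloor> + (if odd \<lfloor>2 ^ Suc N * y\<rfloor> then 1 else 0)"
    using arg_cong[OF floor_double[of "2 ^ N * y"], of real_of_int] by (auto simp: mult.assoc split: if_splits)
  then show ?case using Suc by (simp add: field_simps)
qed

lemma sum_powers_half: "(\<Sum>j<N. (1/2 :: real) ^ Suc j) = 1 - (1/2) ^ N"
  by (induction N) auto

lemma summable_digits: "summable (\<lambda>j. if b j then (1/2 :: real) ^ Suc j else 0)"
  by (rule summable_comparison_test'[where g = "\<lambda>j. (1/2) ^ Suc j" and N = 0])
    (auto intro!: summable_mult2 summable_geometric)

text \<open>
  The functional is extended to all bounded functions, bounded by \<open>\<Lambda> 1\<close> times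
  the supremum, and the extension is positive. The bits of a point are the binary digits of its two
  coordinates, alternating. Truncating the binary expansion changes a smooth periodic function by a
  uniformly small amount, on the torus and on the real line, so \<open>\<Lambda> f\<close> is the
  integral of \<open>f\<close> over the image of Lebesgue measure under the limiting point
  \<open>z\<close>. This point may lie on the boundary of the square, and \<open>wrap\<close> moves
  it back to the fundamental domain without changing periodic functions.
\<close>

theorem riesz_torus:
  assumes L: "0 < L" and \<Lambda>: "linear_functional_on (smooth_periodic L) \<Lambda>"
    and pos: "\<And>f. f \<in> smooth_periodic L \<Longrightarrow> (\<And>x. 0 \<le> f x) \<Longrightarrow> 0 \<le> \<Lambda> f"
  obtains \<rho> where "\<rho> \<in> pos_measures (borel_QL L)"
    "\<And>f. f \<in> smooth_periodic L \<Longrightarrow> (LINT x|\<rho>. f x) = \<Lambda> f"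
proof -
  note SP = function_spaceD[OF function_space_smooth_periodic[of L]]
  define M where "M = \<Lambda> (\<lambda>_. 1)"
  have M0: "0 \<le> M" unfolding M_def by (rule pos[OF smooth_periodic_const]) simp
  have SPb: "f \<in> bounded_functions" if f: "f \<in> smooth_periodic L" for f
  proof -
    obtain K where "\<And>x. \<bar>f x\<bar> \<le> K"
      using periodic_bounded[OF L smooth_periodicD(2)[OF f] smooth_periodicD(3)[OF f]] by blast
    then show ?thesis by (rule bounded_functionsI)
  qed
  have bdd: "bdd_above (range f)" if f: "f \<in> bounded_functions" for f :: "real^2 \<Rightarrow> real"
  proof -
    obtain K where "\<And>x. \<bar>f x\<bar> \<le> K" using f unfolding bounded_functions_def by blast
    then have "\<And>x. f x \<le> K" using abs_le_D1 by blast
    then show ?thesis by (rule bdd_aboveI2)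
  qed
  \<comment> \<open>Positivity of \<open>\<Lambda>\<close> gives \<open>\<Lambda> f \<le> p f\<close>, and
    conversely a linear functional below \<open>p\<close> is positive.\<close>
  define p where "p f = M * (SUP x. f x)" for f :: "real^2 \<Rightarrow> real"
  have p_sub: "sublinear_on bounded_functions p" unfolding sublinear_on_def
  proof (intro conjI ballI allI impI)
    fix f :: "real^2 \<Rightarrow> real" assume f: "f \<in> bounded_functions"
    show "p (\<lambda>x. f x + g x) \<le> p f + p g" if g: "g \<in> bounded_functions" for g
    proof -
      have "(SUP x. f x + g x) \<le> (SUP x. f x) + (SUP x. g x)"
        by (intro cSUP_least add_mono cSUP_upper bdd f g) auto
      from mult_left_mono[OF this M0] show ?thesis by (simp add: p_def distrib_left)
    qed
    show "p (\<lambda>x. c * f x) = c * p f" if "0 \<le> c" for c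
    proof (cases "c = 0")
      case False
      then have c: "0 < c" using that by simp
      have "(SUP x. c * f x) = c * (SUP x. f x)"
      proof (rule antisym)
        show "(SUP x. c * f x) \<le> c * (SUP x. f x)"
          using c by (intro cSUP_least mult_left_mono cSUP_upper bdd f) auto
        have "(SUP x. f x) \<le> (SUP x. c * f x) / c"
        proof (rule cSUP_least)
          fix x
          have "c * f x \<le> (SUP x. c * f x)"
            by (intro cSUP_upper bdd function_spaceD(3)[OF function_space_bounded_functions f]) auto
          then show "f x \<le> (SUP x. c * f x) / c" using c by (simp add: field_simps)
        qed auto
        then show "c * (SUP x. f x) \<le> (SUP x. c * f x)" using c by (simp add: field_simps)
      qed
      then show ?thesis by (simp add: p_def)
    qed (simp add: p_def)
  qed
  define R where "R = (\<lambda>h. (h, \<Lambda> h)) ` smooth_periodic L"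
  obtain q where q: "linear_functional_on bounded_functions q" "\<And>f. f \<in> bounded_functions \<Longrightarrow> q f \<le> p f"
    "\<And>w r. (w, r) \<in> R \<Longrightarrow> q w = r"
  proof (rule hahn_banach_linear_relation[OF function_space_bounded_functions p_sub, of R])
    have "\<Lambda> (\<lambda>_. 0) = 0" using linear_functional_onD(2)[OF \<Lambda> SP(1), of 0] by simp
    then show "((\<lambda>_. 0), 0) \<in> R" unfolding R_def using SP(1) by (auto intro!: image_eqI[of _ _ "\<lambda>_. 0"])
    show "((\<lambda>x. w x + w' x), r + r') \<in> R" if "(w, r) \<in> R" "(w', r') \<in> R" for w r w' r'
      using that linear_functional_onD(1)[OF \<Lambda>] SP(2) unfolding R_def
      by (auto intro!: image_eqI[of _ _ "\<lambda>x. w x + w' x"])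
    show "((\<lambda>x. c * w x), c * r) \<in> R" if "(w, r) \<in> R" for w r c
      using that linear_functional_onD(2)[OF \<Lambda>] SP(3) unfolding R_def
      by (auto intro!: image_eqI[of _ _ "\<lambda>x. c * w x"])
    show "w \<in> bounded_functions" if "(w, r) \<in> R" for w r using that SPb unfolding R_def by auto
    show "r \<le> p w" if "(w, r) \<in> R" for w r
    proof -
      have w: "w \<in> smooth_periodic L" and r: "r = \<Lambda> w" using that unfolding R_def by auto
      have "0 \<le> \<Lambda> (\<lambda>x. (SUP x. w x) + - w x)"
      proof (rule pos[OF SP(2)[OF smooth_periodic_const SP(4)[OF w]]])
        fix x
        have "w x \<le> (SUP x. w x)" by (intro cSUP_upper bdd SPb w) auto
        then show "0 \<le> (SUP x. w x) + - w x" by simp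
      qed
      also have "\<dots> = \<Lambda> (\<lambda>x. (SUP x. w x) * 1) + \<Lambda> (\<lambda>x. - w x)"
        using linear_functional_onD(1)[OF \<Lambda> smooth_periodic_const SP(4)[OF w]] by simp
      also have "\<dots> = p w - \<Lambda> w"
        unfolding linear_functional_onD(2)[OF \<Lambda> smooth_periodic_const] linear_functional_onD(3)[OF \<Lambda> w]
        by (simp add: p_def M_def)
      finally show ?thesis by (simp add: r)
    qed
  qed blast
  note V = function_spaceD[OF function_space_bounded_functions]
  have q_le: "q f \<le> M * K" if "\<And>x. f x \<le> K" "f \<in> bounded_functions" for f K
  proof -
    have "(SUP x. f x) \<le> K" by (rule cSUP_least) (use that in auto)
    then show ?thesis using q(2)[OF that(2)] mult_left_mono[OF _ M0] unfolding p_def by (meson order_trans)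
  qed
  have q_pos: "0 \<le> q f" if "f \<in> bounded_functions" "\<And>x. 0 \<le> f x" for f
    using q_le[of "\<lambda>x. - f x" 0] linear_functional_onD(3)[OF q(1) that(1)] V(4)[OF that(1)] that(2) by simp
  have q_abs: "\<bar>q f\<bar> \<le> M * K" if "\<And>x. \<bar>f x\<bar> \<le> K" for f K
  proof -
    have f: "f \<in> bounded_functions" by (rule bounded_functionsI[OF that])
    show ?thesis
      using q_le[of f K] q_le[of "\<lambda>x. - f x" K] linear_functional_onD(3)[OF q(1) f] V(4)[OF f] f that
      by (auto simp: abs_le_iff)
  qed
  have q_eq: "q f = \<Lambda> f" if "f \<in> smooth_periodic L" for f using q(3) that unfolding R_def by auto
  have q1: "q (\<lambda>_. 1) = M" unfolding M_def by (rule q_eq[OF smooth_periodic_const])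

  define y where "y x i = frac (x $ i / L + 1/2)" for x :: "real^2" and i :: 2
  \<comment> \<open>Even bits belong to the first coordinate, odd bits to the second; \<open>o2\<close> is the
    offset of a coordinate.\<close>
  define A where "A k = {x. odd \<lfloor>2 ^ Suc (k div 2) * y x (if even k then 1 else 2)\<rfloor>}" for k :: nat
  define o2 where "o2 i = (if i = 1 then 0 else 1 :: nat)" for i :: 2
  have A_mem: "x \<in> A (2 * j + o2 i) \<longleftrightarrow> odd \<lfloor>2 ^ Suc j * y x i\<rfloor>" for x j i
    using exhaust_2[of i] by (auto simp: A_def o2_def)
  define P where "P N b = (\<chi> i. L * (\<Sum>j<N. if b (2 * j + o2 i) then (1/2) ^ Suc j else 0) - L/2)" for N and b :: "nat \<Rightarrow> bool"
  have P_cong: "P N ((!) (map b [0..<2*N])) = P N b" for N b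
    unfolding P_def by (auto simp: vec_eq_iff o2_def intro!: sum.cong)
  obtain bit :: "real \<Rightarrow> nat \<Rightarrow> bool" where bit: "\<And>k. {u. bit u k} \<in> sets borel"
    "\<And>n G. q (\<lambda>x. G (map (\<lambda>k. x \<in> A k) [0..<n])) =
       (LINT u:{0..<q (\<lambda>_. 1)}|lborel. G (map (bit u) [0..<n]))"
    using bit_representation[OF q(1) q_pos] by blast
  define S where "S N x = P N (\<lambda>k. x \<in> A k)" for N x
  define z where "z u = (\<chi> i. L * (\<Sum>j. if bit u (2 * j + o2 i) then (1/2) ^ Suc j else 0) - L/2)" for u
  have P_square: "P N b \<in> square L" for N b
  proof -
    have "0 \<le> (\<Sum>j<N. if c j then (1/2 :: real) ^ Suc j else 0)" for c by (rule sum_nonneg) auto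
    moreover have "(\<Sum>j<N. if c j then (1/2 :: real) ^ Suc j else 0) \<le> 1" for c
    proof -
      have "(\<Sum>j<N. if c j then (1/2 :: real) ^ Suc j else 0) \<le> (\<Sum>j<N. (1/2) ^ Suc j)" by (rule sum_mono) auto
      also have "\<dots> \<le> 1" unfolding sum_powers_half by simp
      finally show ?thesis .
    qed
    ultimately show ?thesis using L by (auto simp: P_def square_def mult_left_le)
  qed
  have S_near: "\<bar>S N x $ i - wrap L x $ i\<bar> \<le> L / 2 ^ N" for N x i
  proof -
    have y: "0 \<le> y x i" "y x i < 1" by (auto simp: y_def frac_lt_1)
    have "S N x $ i = L * (\<lfloor>2 ^ N * y x i\<rfloor> / 2 ^ N) - L/2"
      unfolding S_def P_def A_mem using binary_digits_sum[OF y, of N] by simp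
    moreover have "wrap L x $ i = L * y x i - L/2" by (simp add: wrap_def y_def)
    ultimately have "wrap L x $ i - S N x $ i = L * ((2 ^ N * y x i - \<lfloor>2 ^ N * y x i\<rfloor>) / 2 ^ N)"
      by (simp add: diff_divide_distrib right_diff_distrib)
    moreover define r where "r = 2 ^ N * y x i - \<lfloor>2 ^ N * y x i\<rfloor>"
    ultimately have eq: "wrap L x $ i - S N x $ i = L * (r / 2 ^ N)" by simp
    have r: "0 \<le> r" "r \<le> 1" unfolding r_def by linarith+
    have "L * (r / 2 ^ N) \<le> L * (1 / 2 ^ N)" using r L by (intro mult_left_mono divide_right_mono) auto
    moreover have "0 \<le> L * (r / 2 ^ N)" using r L by simp
    ultimately show ?thesis using eq by (auto simp: abs_le_iff)
  qed
  have P_lim: "(\<lambda>N. P N (bit u)) \<longlonglongrightarrow> z u" for u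
  proof (rule vec_tendstoI)
    fix i
    show "(\<lambda>N. P N (bit u) $ i) \<longlonglongrightarrow> z u $ i"
      unfolding P_def z_def vec_lambda_beta
      by (intro tendsto_intros summable_LIMSEQ summable_digits)
  qed
  have bit_meas: "(\<lambda>u. if bit u k then c else (0::real)) \<in> borel_measurable borel" for k c
    using bit(1)[of k] by (intro measurable_If) (auto simp: pred_def)
  have z_meas: "z \<in> borel_measurable borel"
    unfolding z_def using bit_meas
    by (intro borel_measurable_vec_lambda borel_measurable_diff borel_measurable_times
        borel_measurable_suminf borel_measurable_const)
  have P_meas: "(\<lambda>u. P N (bit u)) \<in> borel_measurable borel" for N
    unfolding P_def using bit_meas
    by (intro borel_measurable_vec_lambda borel_measurable_diff borel_measurable_times
        borel_measurable_sum borel_measurable_const)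
  define U where "U = restrict_space lborel {0..<M}"
  have finU: "finite_measure U"
    by (rule finite_measureI) (use M0 in \<open>simp add: U_def emeasure_restrict_space space_restrict_space\<close>)
  have Umeas: "h \<in> measurable U N" if "h \<in> measurable borel N" for h and N :: "'b measure"
    unfolding U_def using that by (intro measurable_restrict_space1) simp
  define \<rho> where "\<rho> = distr U (borel_QL L) (\<lambda>u. wrap L (z u))"
  have wz: "(\<lambda>u. wrap L (z u)) \<in> measurable U (borel_QL L)"
    by (rule measurable_restrict_space2)
      (use wrap_in_QL[OF L] Umeas z_meas in \<open>auto intro: measurable_compose[OF _ wrap_measurable]\<close>)
  show thesis
  proof
    show "\<rho> \<in> pos_measures (borel_QL L)"
      using finite_measure.finite_measure_distr[OF finU wz] by (simp add: pos_measures_def \<rho>_def)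
    fix f assume f: "f \<in> smooth_periodic L"
    note fb = smooth_periodic_borel[OF f]
    have per: "f (wrap L x) = f x" for x by (rule periodic_wrap[OF L smooth_periodicD(2)[OF f]])
    obtain K where K: "\<And>x. \<bar>f x\<bar> \<le> K" using periodic_bounded[OF L smooth_periodicD(2)[OF f] smooth_periodicD(3)[OF f]] by blast
    have fS: "(\<lambda>x. f (S N x)) \<in> bounded_functions" for N by (rule bounded_functionsI[of _ K]) (rule K)
    have "(\<lambda>N. q (\<lambda>x. f (S N x))) \<longlonglongrightarrow> q f"
    proof (rule LIMSEQ_I)
      fix e :: real assume e: "0 < e"
      define e' where "e' = e / (M + 1)"
      have e': "0 < e'" using e M0 by (simp add: e'_def)
      have "uniformly_continuous_on (square L) f"
        by (rule compact_uniformly_continuous[OF smooth_periodicD(3)[OF f] compact_square])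
      then obtain d where d: "0 < d" "\<And>x x'. x \<in> square L \<Longrightarrow> x' \<in> square L \<Longrightarrow> dist x' x < d \<Longrightarrow> dist (f x') (f x) < e'"
        using e' unfolding uniformly_continuous_on_def by blast
      have "(\<lambda>N. 2 * (L / 2 ^ N)) \<longlonglongrightarrow> 0"
        using tendsto_mult_left[OF LIMSEQ_divide_realpow_zero[of 2 L], of 2] by simp
      then obtain N0 where N0: "\<And>N. N0 \<le> N \<Longrightarrow> 2 * (L / 2 ^ N) < d"
        using order_tendstoD(2)[of _ 0 sequentially d] d(1) by (auto simp: eventually_sequentially)
      have "norm (q (\<lambda>x. f (S N x)) - q f) < e" if N: "N0 \<le> N" for N
      proof -
        have "\<bar>f (S N x) - f x\<bar> \<le> e'" for x
        proof -
          have "norm (S N x - wrap L x) \<le> (\<Sum>i\<in>UNIV. \<bar>(S N x - wrap L x) $ i\<bar>)"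
            by (rule norm_le_l1_cart)
          also have "\<dots> \<le> (\<Sum>i\<in>(UNIV::2 set). L / 2 ^ N)"
            by (rule sum_mono) (use S_near in simp)
          also have "\<dots> < d" using N0[OF N] by simp
          finally have "dist (S N x) (wrap L x) < d" by (simp add: dist_norm)
          then have "dist (f (S N x)) (f (wrap L x)) < e'"
            using P_square wrap_in_QL[OF L, THEN QL_subset_square[THEN subsetD]] by (intro d(2)) (auto simp: S_def)
          then show ?thesis by (simp add: per dist_real_def)
        qed
        then have "\<bar>q (\<lambda>x. f (S N x) - f x)\<bar> \<le> M * e'" by (rule q_abs)
        also have "M * e' < e" using e M0 by (simp add: e'_def field_simps)
        finally show ?thesis
          using linear_functional_onD(1)[OF q(1) fS V(4)[OF SPb[OF f]]] linear_functional_onD(3)[OF q(1) SPb[OF f]]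
          by simp
      qed
      then show "\<exists>N0. \<forall>N\<ge>N0. norm (q (\<lambda>x. f (S N x)) - q f) < e" by blast
    qed
    moreover have "q (\<lambda>x. f (S N x)) = (LINT u|U. f (P N (bit u)))" for N
    proof -
      have "q (\<lambda>x. f (S N x)) = (LINT u:{0..<M}|lborel. f (P N (bit u)))"
        using bit(2)[of "\<lambda>w. f (P N ((!) w))" "2 * N"] unfolding P_cong q1 S_def by simp
      then show ?thesis
        unfolding U_def set_lebesgue_integral_def
        by (subst integral_restrict_space) auto
    qed
    moreover have "(\<lambda>N. LINT u|U. f (P N (bit u))) \<longlonglongrightarrow> (LINT u|U. f (z u))"
    proof (rule integral_dominated_convergence[where w = "\<lambda>_. K"])
      show "AE u in U. (\<lambda>N. f (P N (bit u))) \<longlonglongrightarrow> f (z u)"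
        using smooth_periodicD(3)[OF f, of UNIV] P_lim
        by (auto intro!: isCont_tendsto_compose[of _ f] simp: continuous_on_eq_continuous_at)
      show "AE u in U. norm (f (P N (bit u))) \<le> K" for N using K by auto
      show "integrable U (\<lambda>_. K)" using finU by (simp add: finite_measure.integrable_const)
    qed (auto intro!: Umeas measurable_compose[OF _ fb] z_meas P_meas)
    ultimately have "q f = (LINT u|U. f (z u))" using LIMSEQ_unique by fastforce
    also have "\<dots> = (LINT x|\<rho>. f x)"
      unfolding \<rho>_def by (subst integral_distr[OF wz]) (auto simp: per intro: measurable_restrict_space1 fb)
    finally show "(LINT x|\<rho>. f x) = \<Lambda> f" using q_eq[OF f] by simp
  qed
qed

section \<open>Measures on space-time\<close>

text \<open>
  Nonnegative products of a function of space and a cutoff in time: rich enough to determine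
  measures on space-time, and simple enough to be evaluated slice by slice.
\<close>

definition product_cutoffs :: "real \<Rightarrow> real \<Rightarrow> ((real^2) \<times> real \<Rightarrow> real) set" where
  "product_cutoffs L T = {\<lambda>p. f (fst p) * \<zeta> (snd p) | f \<zeta>. f \<in> smooth_periodic L \<and> (\<forall>x. 0 \<le> f x) \<and>
     smooth \<zeta> \<and> (\<forall>t. 0 \<le> \<zeta> t) \<and> (\<exists>r<T. \<forall>t. r \<le> \<bar>t\<bar> \<longrightarrow> \<zeta> t = 0)}"

lemma product_cutoffsI:
  assumes "f \<in> smooth_periodic L" "\<And>x. 0 \<le> f x" "smooth \<zeta>" "\<And>t. 0 \<le> \<zeta> t" "r < T" "\<And>t. r \<le> \<bar>t\<bar> \<Longrightarrow> \<zeta> t = 0"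
  shows "(\<lambda>p. f (fst p) * \<zeta> (snd p)) \<in> product_cutoffs L T"
  unfolding product_cutoffs_def using assms by blast

lemma borel_measurable_product:
  fixes f :: "real^2 \<Rightarrow> real" and \<zeta> :: "real \<Rightarrow> real"
  assumes "f \<in> borel_measurable borel" "\<zeta> \<in> borel_measurable borel"
  shows "(\<lambda>p. f (fst p) * \<zeta> (snd p)) \<in> borel_measurable borel"
  unfolding borel_prod[symmetric]
  by (intro borel_measurable_times measurable_compose[OF measurable_fst assms(1)]
      measurable_compose[OF measurable_snd assms(2)])

lemma exhausting_time_cutoffs:
  assumes T: "0 < T"
  obtains \<zeta> :: "nat \<Rightarrow> real \<Rightarrow> real" and r where "\<And>n. smooth (\<zeta> n)" "\<And>n t. 0 \<le> \<zeta> n t" "\<And>n. r n < T"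
    "\<And>n t. r n \<le> \<bar>t\<bar> \<Longrightarrow> \<zeta> n t = 0" "\<And>t. \<bar>t\<bar> < T \<Longrightarrow> \<exists>n. 0 < \<zeta> n t"
proof -
  define r where "r n = T - T / real (n + 2)" for n
  define \<zeta> where "\<zeta> n t = exp_flat (t + r n) * exp_flat (r n - t)" for n t
  have \<zeta>0: "0 \<le> \<zeta> n t" for n t by (simp add: \<zeta>_def exp_flat_props)
  have \<zeta>_pos: "0 < \<zeta> n t \<longleftrightarrow> \<bar>t\<bar> < r n" for n t
    using exp_flat_props(1)[of "t + r n"] exp_flat_props(1)[of "r n - t"]
    by (auto simp: \<zeta>_def zero_less_mult_iff exp_flat_props(4) not_less[symmetric])
  show thesis
  proof
    show "smooth (\<zeta> n)" for n unfolding \<zeta>_def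
      by (intro smooth_mult smooth_compose[OF smooth_exp_flat] smooth_add smooth_diff smooth_const
          smooth_linear bounded_linear_ident)
    show "0 \<le> \<zeta> n t" for n t by (rule \<zeta>0)
    show "r n < T" for n using T by (simp add: r_def)
    show "\<zeta> n t = 0" if "r n \<le> \<bar>t\<bar>" for n t
      using that \<zeta>_pos[of n t] \<zeta>0[of n t] by (auto simp: less_le)
    show "\<exists>n. 0 < \<zeta> n t" if t: "\<bar>t\<bar> < T" for t
    proof -
      have "(\<lambda>n. T - T * (1 / real (n + 2))) \<longlonglongrightarrow> T - T * 0"
        by (intro tendsto_intros LIMSEQ_ignore_initial_segment lim_const_over_n)
      then have "r \<longlonglongrightarrow> T" by (simp add: r_def[abs_def])
      then show ?thesis
        using order_tendstoD(1)[OF _ t] eventually_sequentially \<zeta>_pos by fastforce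
    qed
  qed
qed

lemma product_cutoffs_borel:
  assumes "h \<in> product_cutoffs L T"
  shows "h \<in> borel_measurable borel"
proof -
  obtain f \<zeta> where "h = (\<lambda>p. f (fst p) * \<zeta> (snd p))" "f \<in> smooth_periodic L" "smooth \<zeta>"
    using assms unfolding product_cutoffs_def by blast
  then show ?thesis
    using borel_measurable_product[OF smooth_periodic_borel smooth_borel] by simp
qed

text \<open>
  A function of time without support condition is reached by exhausting \<open>(-T, T)\<close> with
  cutoffs.
\<close>

lemma positivity_set_generated:
  assumes T: "0 < T" and f: "f \<in> smooth_periodic L" "\<And>x. 0 \<le> f x"
    and \<eta>: "smooth (\<eta> :: real \<Rightarrow> real)" "\<And>t. 0 \<le> \<eta> t"
  shows "{p \<in> QLT L T. 0 < f (fst p) * \<eta> (snd p)} \<in>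
    sigma_sets (QLT L T) ((\<lambda>h. {p \<in> QLT L T. 0 < h p}) ` product_cutoffs L T)" (is "_ \<in> sigma_sets _ ?E")
proof -
  obtain \<zeta> :: "nat \<Rightarrow> real \<Rightarrow> real" and r where \<zeta>s: "\<And>n. smooth (\<zeta> n)" and \<zeta>0: "\<And>n t. 0 \<le> \<zeta> n t"
    and r: "\<And>n. r n < T" and \<zeta>_zero: "\<And>n t. r n \<le> \<bar>t\<bar> \<Longrightarrow> \<zeta> n t = 0"
    and \<zeta>_pos: "\<And>t. \<bar>t\<bar> < T \<Longrightarrow> \<exists>n. 0 < \<zeta> n t"
    using exhausting_time_cutoffs[OF T] by blast
  have "{p \<in> QLT L T. 0 < f (fst p) * \<eta> (snd p)} =
      (\<Union>n. {p \<in> QLT L T. 0 < f (fst p) * (\<eta> (snd p) * \<zeta> n (snd p))})"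
  proof safe
    fix x t assume p: "(x, t) \<in> QLT L T" "0 < f (fst (x, t)) * \<eta> (snd (x, t))"
    then have t: "\<bar>t\<bar> < T" by (auto simp: QLT_def)
    then obtain n where "0 < \<zeta> n t" using \<zeta>_pos by blast
    then have "0 < f x * (\<eta> t * \<zeta> n t)" using p f(2)[of x] \<eta>(2)[of t] by (auto simp: zero_less_mult_iff)
    then show "(x, t) \<in> (\<Union>n. {p \<in> QLT L T. 0 < f (fst p) * (\<eta> (snd p) * \<zeta> n (snd p))})" using p by auto
  next
    fix x t n assume "0 < f (fst (x, t)) * (\<eta> (snd (x, t)) * \<zeta> n (snd (x, t)))"
    then show "0 < f (fst (x, t)) * \<eta> (snd (x, t))"
      using \<zeta>0[of n t] f(2)[of x] \<eta>(2)[of t] by (auto simp: zero_less_mult_iff)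
  qed
  moreover have "{p \<in> QLT L T. 0 < f (fst p) * (\<eta> (snd p) * \<zeta> n (snd p))} \<in> sigma_sets (QLT L T) ?E" for n
  proof (intro sigma_sets.Basic imageI product_cutoffsI[OF f])
    show "smooth (\<lambda>t. \<eta> t * \<zeta> n t)" using \<eta> \<zeta>s by auto
    show "0 \<le> \<eta> t * \<zeta> n t" for t using \<eta> \<zeta>0 by auto
    show "r n < T" by (rule r)
    show "\<eta> t * \<zeta> n t = 0" if "r n \<le> \<bar>t\<bar>" for t
      using that \<zeta>_zero by simp
  qed
  ultimately show ?thesis by (auto intro: sigma_sets.Union)
qed

lemma sets_borel_QLT_generated:
  assumes L: "0 < L" and T: "0 < T"
  shows "sets (borel_QLT L T) =
    sigma_sets (QLT L T) ((\<lambda>h. {p \<in> QLT L T. 0 < h p}) ` product_cutoffs L T)"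
    (is "_ = sigma_sets _ ?E")
proof (rule antisym)
  show "sigma_sets (QLT L T) ?E \<subseteq> sets (borel_QLT L T)"
  proof (rule sets.sigma_sets_subset[of _ "borel_QLT L T", simplified])
    show "?E \<subseteq> sets (borel_QLT L T)"
    proof safe
      fix h assume "h \<in> product_cutoffs L T"
      then have "h \<in> borel_measurable borel" by (rule product_cutoffs_borel)
      then have "{p \<in> QLT L T. 0 < h p} \<in> sets borel" by measurable
      then show "{p \<in> QLT L T. 0 < h p} \<in> sets (borel_QLT L T)" by (auto simp: sets_borel_QLT)
    qed
  qed
  let ?H = "(\<lambda>(a, i). {x::(real^2) \<times> real. a < x \<bullet> i}) ` (UNIV \<times> Basis)"
  have b: "sets (borel :: ((real^2) \<times> real) measure) = sigma_sets UNIV ?H"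
    by (subst borel_eq_halfspace_greater) simp
  have "sets (borel_QLT L T) = (\<inter>) (QLT L T) ` sigma_sets UNIV ?H"
    by (simp only: sets_restrict_space b)
  also have "\<dots> = sigma_sets (QLT L T) ((\<inter>) (QLT L T) ` ?H)"
    by (rule sigma_sets_Int) (use QLT_borel[of L T] b in auto)
  also have "\<dots> \<subseteq> sigma_sets (QLT L T) ?E"
  proof (rule sigma_sets_mono, safe)
    fix a and b1 :: "real^2" and b2 :: real assume "(b1, b2) \<in> Basis"
    then consider i where "b1 = axis i 1" "b2 = 0" | "b1 = 0" "b2 = 1"
      by (auto simp: Basis_prod_def Basis_vec_def)
    then show "QLT L T \<inter> {x. a < x \<bullet> (b1, b2)} \<in> sigma_sets (QLT L T) ?E"
    proof cases
      case 1
      obtain f where f: "f \<in> smooth_periodic L" "\<And>x. 0 \<le> f x" "\<And>x. x \<in> QL L \<Longrightarrow> 0 < f x \<longleftrightarrow> a < x $ i"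
        using halfspace_periodic_function[OF L] by blast
      have "QLT L T \<inter> {x. a < x \<bullet> (b1, b2)} = {p \<in> QLT L T. 0 < f (fst p) * 1}"
        using f(3) 1 by (auto simp: QLT_def inner_axis)
      then show ?thesis using positivity_set_generated[OF T f(1,2), of "\<lambda>_. 1"] by simp
    next
      case 2
      have s: "smooth (\<lambda>t. exp_flat (t - a))"
        by (intro smooth_compose[OF smooth_exp_flat] smooth_diff smooth_const smooth_linear bounded_linear_ident)
      have "QLT L T \<inter> {x. a < x \<bullet> (b1, b2)} = {p \<in> QLT L T. 0 < 1 * exp_flat (snd p - a)}"
        using 2 by (auto simp: exp_flat_props)
      then show ?thesis
        using positivity_set_generated[OF T smooth_periodic_const[of 1] _ s] by (simp add: exp_flat_props)
    qed
  qed
  finally show "sets (borel_QLT L T) \<subseteq> sigma_sets (QLT L T) ?E" .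
qed

lemma measure_eqI_product_cutoffs:
  assumes L: "0 < L" and T: "0 < T"
    and M: "M \<in> pos_measures (borel_QLT L T)" and N: "N \<in> pos_measures (borel_QLT L T)"
    and eq: "\<And>h. h \<in> product_cutoffs L T \<Longrightarrow> (LINT p|M. h p) = (LINT p|N. h p)"
  shows "M = N"
proof -
  note Ms = pos_measuresD[OF M] and Ns = pos_measuresD[OF N]
  have sp: "space M = QLT L T" using Ms(3) by simp
  obtain \<zeta> :: "nat \<Rightarrow> real \<Rightarrow> real" and r where \<zeta>s: "\<And>n. smooth (\<zeta> n)" and \<zeta>0: "\<And>n t. 0 \<le> \<zeta> n t"
    and r: "\<And>n. r n < T" and \<zeta>_zero: "\<And>n t. r n \<le> \<bar>t\<bar> \<Longrightarrow> \<zeta> n t = 0"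
    and \<zeta>_pos: "\<And>t. \<bar>t\<bar> < T \<Longrightarrow> \<exists>n. 0 < \<zeta> n t"
    using exhausting_time_cutoffs[OF T] by blast
  show ?thesis
  proof (rule measure_eqI_positivity_sets[where \<F> = "product_cutoffs L T" and h = "\<lambda>n p. 1 * \<zeta> n (snd p)"])
    show "finite_measure M" "finite_measure N" "sets M = sets N" using Ms(1,2) Ns(1,2) by simp_all
    show "sets M = sigma_sets (space M) ((\<lambda>h. {x \<in> space M. 0 < h x}) ` product_cutoffs L T)"
      unfolding sp Ms(1) by (rule sets_borel_QLT_generated[OF L T])
    fix h assume h: "h \<in> product_cutoffs L T"
    then obtain f \<eta> s where fe: "h = (\<lambda>p. f (fst p) * \<eta> (snd p))" "f \<in> smooth_periodic L" "\<forall>x. 0 \<le> f x"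
       "smooth \<eta>" "\<forall>t. 0 \<le> \<eta> t" "s < T" "\<forall>t. s \<le> \<bar>t\<bar> \<longrightarrow> \<eta> t = 0"
      unfolding product_cutoffs_def by blast
    show "0 \<le> h p" for p using fe by simp
    show "h \<in> borel_measurable M"
      by (intro Ms(4) measurable_restrict_space1 product_cutoffs_borel[OF h])
    show "(LINT p|M. h p) = (LINT p|N. h p)" by (rule eq[OF h])
    show "(\<lambda>p. h p * h' p) \<in> product_cutoffs L T" if h': "h' \<in> product_cutoffs L T" for h'
    proof -
      obtain f' \<eta>' where fe': "h' = (\<lambda>p. f' (fst p) * \<eta>' (snd p))" "f' \<in> smooth_periodic L" "\<forall>x. 0 \<le> f' x"
        "smooth \<eta>'" "\<forall>t. 0 \<le> \<eta>' t"
        using h' unfolding product_cutoffs_def by blast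
      have "(\<lambda>p. (f (fst p) * f' (fst p)) * (\<eta> (snd p) * \<eta>' (snd p))) \<in> product_cutoffs L T"
        by (rule product_cutoffsI[where r = s]) (use fe fe' in \<open>auto intro: smooth_periodic_mult\<close>)
      also have "(\<lambda>p. (f (fst p) * f' (fst p)) * (\<eta> (snd p) * \<eta>' (snd p))) = (\<lambda>p. h p * h' p)"
        by (simp add: fe fe' ac_simps)
      finally show ?thesis .
    qed
    define g where "g n p = exp_flat (real n * f (fst p)) * exp_flat (real n * \<eta> (snd p))" for n :: nat and p
    have "g n \<in> product_cutoffs L T" for n
      unfolding g_def[abs_def]
      by (rule product_cutoffsI[where r = s])
        (use fe in \<open>auto simp: exp_flat_props intro!: smooth_periodic_compose[OF smooth_exp_flat]
          smooth_periodic_mult[OF smooth_periodic_const] smooth_compose[OF smooth_exp_flat]\<close>)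
    moreover have "g n p \<le> 1" for n p
      unfolding g_def by (rule mult_le_one) (auto simp: exp_flat_props)
    moreover have "(\<lambda>n. g n p) \<longlonglongrightarrow> indicator {p. 0 < h p} p" for p
    proof -
      have "(\<lambda>n. g n p) \<longlonglongrightarrow> indicator {0<..} (f (fst p)) * indicator {0<..} (\<eta> (snd p))"
        unfolding g_def by (intro tendsto_mult exp_flat_scaled_LIMSEQ)
      also have "indicator {0<..} (f (fst p)) * indicator {0<..} (\<eta> (snd p)) = (indicator {p. 0 < h p} p :: real)"
        using fe(3,5) by (auto simp: indicator_def fe(1) zero_less_mult_iff not_less[symmetric])
      finally show ?thesis .
    qed
    ultimately show "\<exists>g. \<forall>x. (\<forall>n. g n \<in> product_cutoffs L T \<and> g n x \<le> 1) \<and>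
        (\<lambda>n::nat. g n x) \<longlonglongrightarrow> indicator {x. 0 < h x} x" by blast
  next
    show "(\<lambda>p. 1 * \<zeta> n (snd p)) \<in> product_cutoffs L T" for n
      using product_cutoffsI[OF smooth_periodic_const[of 1] _ \<zeta>s[of n] \<zeta>0[of n] r[of n] \<zeta>_zero[of n]] by simp
    show "(\<Union>n. {p \<in> space M. 0 < 1 * \<zeta> n (snd p)}) = space M"
    proof safe
      fix x t assume p: "(x, t) \<in> space M"
      then have t: "\<bar>t\<bar> < T" by (auto simp: QLT_def sp)
      then obtain n where "0 < \<zeta> n t" using \<zeta>_pos by blast
      then show "(x, t) \<in> (\<Union>n. {p \<in> space M. 0 < 1 * \<zeta> n (snd p)})" using p by auto
    qed
  qed
qed

section \<open>Integration against a disintegration\<close>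

text \<open>
  The part of \<open>disintegration\<close> that does not mention the measure on space-time.
\<close>

definition kernel_on :: "real \<Rightarrow> real \<Rightarrow> (real \<Rightarrow> (real^2) measure) \<Rightarrow> bool" where
  "kernel_on L T \<sigma> \<longleftrightarrow> (\<forall>t\<in>{-T..T}. \<sigma> t \<in> pos_measures (borel_QL L)) \<and>
     (\<forall>B\<in>sets (borel_QL L). (\<lambda>t. emeasure (\<sigma> t) B) \<in> borel_measurable (restrict_space borel {-T..T}))"

lemma disintegration_kernel: "disintegration L T \<mu> \<sigma> \<Longrightarrow> kernel_on L T \<sigma>"
  by (simp add: disintegration_def kernel_on_def)

lemma kernel_onD:
  assumes "kernel_on L T \<sigma>" "t \<in> {-T..T}"
  shows "sets (\<sigma> t) = sets (borel_QL L)" "finite_measure (\<sigma> t)" "space (\<sigma> t) = QL L"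
    "\<sigma> t \<in> pos_measures (borel_QL L)"
  using assms pos_measuresD[of "\<sigma> t" "borel_QL L"] by (auto simp: kernel_on_def)

lemma kernel_borel_measurable:
  assumes "kernel_on L T \<sigma>" "t \<in> {-T..T}" "h \<in> measurable borel N"
  shows "h \<in> measurable (\<sigma> t) N"
  using measurable_cong_sets[OF kernel_onD(1)[OF assms(1,2)] refl] measurable_restrict_space1[OF assms(3)]
  by blast

lemma measurable_slice: "(h :: (real^2) \<times> real \<Rightarrow> 'a::topological_space) \<in> borel_measurable borel \<Longrightarrow> (\<lambda>x. h (x, t)) \<in> borel_measurable borel"
  by (rule measurable_compose[where N = borel]) (auto simp: borel_prod[symmetric])

lemma slice_borel: "A \<in> sets (borel :: ((real^2) \<times> real) measure) \<Longrightarrow> {x. (x, t) \<in> A} \<in> sets borel"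
  using measurable_sets[of "\<lambda>x::real^2. (x, t)" borel borel A]
  by (simp add: vimage_def borel_prod[symmetric])

lemma slice_borel_QLT:
  assumes "A \<in> sets (borel_QLT L T)"
  shows "{x. (x, t) \<in> A} \<in> sets (borel_QL L)"
  using assms slice_borel[of A t] unfolding sets_borel_QLT sets_borel_QL by (auto simp: QLT_def)

text \<open>
  Dividing the slice at time \<open>t\<close> by \<open>1 +\<close> its mass gives a measurable
  kernel of subprobability measures, to which the measurability results for the Giry monad apply.
\<close>

lemma kernel_measurable_nn_integral:
  fixes h :: "(real^2) \<times> real \<Rightarrow> ennreal"
  assumes L: "0 < L" and \<sigma>: "kernel_on L T \<sigma>" and h: "h \<in> borel_measurable borel"
  shows "(\<lambda>t. \<integral>\<^sup>+x. h (x, t) \<partial>\<sigma> t) \<in> borel_measurable (restrict_space borel {-T..T})"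
proof -
  define d where "d t = measure (\<sigma> t) (QL L)" for t
  define K where "K t = scale_measure (ennreal (1 / (1 + d t))) (\<sigma> t)" for t
  let ?R = "restrict_space borel {-T..T}"
  have QLs: "QL L \<in> sets (borel_QL L)" by (simp add: sets_borel_QL)
  have em: "emeasure (\<sigma> t) (QL L) = ennreal (d t)" if "t \<in> {-T..T}" for t
    unfolding d_def by (rule finite_measure.emeasure_eq_measure[OF kernel_onD(2)[OF \<sigma> that]])
  have [measurable]: "(\<lambda>t. emeasure (\<sigma> t) B) \<in> borel_measurable ?R" if "B \<in> sets (borel_QL L)" for B
    using \<sigma> that by (auto simp: kernel_on_def)
  have d_meas [measurable]: "d \<in> borel_measurable ?R"
    unfolding d_def measure_def using QLs by measurable
  have d0: "0 \<le> d t" for t by (simp add: d_def)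
  have K: "K \<in> measurable ?R (subprob_algebra (borel_QL L))"
  proof (rule measurable_subprob_algebra)
    fix t assume "t \<in> space ?R"
    then have t: "t \<in> {-T..T}" by (simp add: space_restrict_space)
    show "sets (K t) = sets (borel_QL L)" using kernel_onD(1)[OF \<sigma> t] by (simp add: K_def)
    show "subprob_space (K t)"
    proof
      have "emeasure (K t) (space (K t)) = ennreal (1 / (1 + d t)) * ennreal (d t)"
        using em[OF t] kernel_onD(3)[OF \<sigma> t] by (simp add: K_def space_scale_measure)
      also have "\<dots> \<le> 1" using d0[of t]
        by (auto simp: ennreal_mult[symmetric] ennreal_le_1 field_simps)
      finally show "emeasure (K t) (space (K t)) \<le> 1" .
      show "space (K t) \<noteq> {}"
        using wrap_in_QL[OF L] kernel_onD(3)[OF \<sigma> t] by (auto simp: K_def space_scale_measure)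
    qed
  next
    fix B assume B: "B \<in> sets (borel_QL L)"
    then show "(\<lambda>t. emeasure (K t) B) \<in> borel_measurable ?R"
      unfolding K_def emeasure_scale_measure by measurable
  qed
  have "(\<lambda>(t, x). h (x, t)) \<in> borel_measurable (?R \<Otimes>\<^sub>M borel_QL L)"
  proof -
    have "(\<lambda>p. (snd p, fst p)) \<in> measurable (?R \<Otimes>\<^sub>M borel_QL L) (borel \<Otimes>\<^sub>M borel)"
      by (intro measurable_Pair measurable_compose[OF measurable_snd] measurable_compose[OF measurable_fst]
          measurable_restrict_space1) auto
    then have "(\<lambda>p. (snd p, fst p)) \<in> measurable (?R \<Otimes>\<^sub>M borel_QL L) borel" by (simp add: borel_prod)
    from measurable_compose[OF this h] show ?thesis by (simp add: case_prod_unfold)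
  qed
  from nn_integral_measurable_subprob_algebra2[OF this K]
  have [measurable]: "(\<lambda>t. \<integral>\<^sup>+x. h (x, t) \<partial>K t) \<in> borel_measurable ?R" .
  have eq: "(\<integral>\<^sup>+x. h (x, t) \<partial>\<sigma> t) = ennreal (1 + d t) * (\<integral>\<^sup>+x. h (x, t) \<partial>K t)" if t: "t \<in> {-T..T}" for t
  proof -
    have "(\<integral>\<^sup>+x. h (x, t) \<partial>K t) = ennreal (1 / (1 + d t)) * (\<integral>\<^sup>+x. h (x, t) \<partial>\<sigma> t)"
      unfolding K_def by (rule nn_integral_scale_measure[OF kernel_borel_measurable[OF \<sigma> t measurable_slice[OF h]]])
    moreover have "ennreal (1 + d t) * ennreal (1 / (1 + d t)) = 1"
      using d0[of t] by (subst ennreal_mult[symmetric]) auto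
    ultimately show ?thesis by (simp only: mult.assoc[symmetric] mult_1_left)
  qed
  have "(\<lambda>t. ennreal (1 + d t) * (\<integral>\<^sup>+x. h (x, t) \<partial>K t)) \<in> borel_measurable ?R" by measurable
  then show ?thesis
    by (rule measurable_cong[THEN iffD2, rotated]) (simp add: eq space_restrict_space)
qed

lemma kernel_nn_integral_measurable:
  fixes h :: "(real^2) \<times> real \<Rightarrow> ennreal"
  assumes L: "0 < L" and \<sigma>: "kernel_on L T \<sigma>" and h: "h \<in> borel_measurable borel"
  shows "(\<lambda>t. (\<integral>\<^sup>+x. h (x, t) \<partial>\<sigma> t) * indicator {-T<..<T} t) \<in> borel_measurable lborel"
proof -
  have "(\<lambda>t. (\<integral>\<^sup>+x. h (x, t) \<partial>\<sigma> t) * indicator {-T..T} t) \<in> borel_measurable borel"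
    using kernel_measurable_nn_integral[OF assms] by (subst (asm) borel_measurable_restrict_space_iff_ennreal) auto
  then have "(\<lambda>t. (\<integral>\<^sup>+x. h (x, t) \<partial>\<sigma> t) * indicator {-T..T} t * indicator {-T<..<T} t) \<in> borel_measurable borel"
    by measurable
  also have "(\<lambda>t. (\<integral>\<^sup>+x. h (x, t) \<partial>\<sigma> t) * indicator {-T..T} t * indicator {-T<..<T} t) =
      (\<lambda>t. (\<integral>\<^sup>+x. h (x, t) \<partial>\<sigma> t) * indicator {-T<..<T} t)"
    by (auto simp: fun_eq_iff split: split_indicator)
  finally show ?thesis by simp
qed

lemma nn_integral_slice_indicator:
  assumes \<sigma>: "kernel_on L T \<sigma>" and t: "t \<in> {-T<..<T}" and A: "A \<in> sets borel"
  shows "(\<integral>\<^sup>+x. indicator A (x, t) \<partial>\<sigma> t) = emeasure (\<sigma> t) {x. (x, t) \<in> A \<inter> QLT L T}"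
proof -
  have t': "t \<in> {-T..T}" using t by auto
  have "{x. (x, t) \<in> A \<inter> QLT L T} \<in> sets (\<sigma> t)"
    unfolding kernel_onD(1)[OF \<sigma> t'] by (rule slice_borel_QLT[of _ L T]) (use A in \<open>auto simp: sets_borel_QLT\<close>)
  then have "emeasure (\<sigma> t) {x. (x, t) \<in> A \<inter> QLT L T} = (\<integral>\<^sup>+x. indicator {x. (x, t) \<in> A \<inter> QLT L T} x \<partial>\<sigma> t)"
    by simp
  also have "\<dots> = (\<integral>\<^sup>+x. indicator A (x, t) \<partial>\<sigma> t)"
    using t kernel_onD(3)[OF \<sigma> t'] by (intro nn_integral_cong) (auto simp: QLT_def split: split_indicator)
  finally show ?thesis by simp
qed

lemma nn_integral_disintegration:
  fixes h :: "(real^2) \<times> real \<Rightarrow> ennreal"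
  assumes L: "0 < L" and \<mu>: "sets \<mu> = sets (borel_QLT L T)" and dis: "disintegration L T \<mu> \<sigma>"
    and h: "h \<in> borel_measurable borel"
  shows "(\<integral>\<^sup>+p. h p \<partial>\<mu>) = (\<integral>\<^sup>+t\<in>{-T<..<T}. (\<integral>\<^sup>+x. h (x, t) \<partial>\<sigma> t) \<partial>lborel)"
proof -
  note \<sigma> = disintegration_kernel[OF dis]
  have \<mu>m: "g \<in> borel_measurable \<mu>" if "g \<in> borel_measurable borel" for g :: "_ \<Rightarrow> ennreal"
    using measurable_cong_sets[OF \<mu> refl] measurable_restrict_space1[OF that] by blast
  have \<sigma>m: "(\<lambda>x. g (x, t)) \<in> borel_measurable (\<sigma> t)" if "g \<in> borel_measurable borel" "t \<in> {-T<..<T}" for g :: "_ \<Rightarrow> ennreal" and t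
    using that by (intro kernel_borel_measurable[OF \<sigma>] measurable_slice) auto
  note Lm = kernel_nn_integral_measurable[OF L \<sigma>]
  show ?thesis
    using h
  proof (induction rule: borel_measurable_induct)
    case (cong f g) then show ?case by simp
  next
    case (set A)
    have "(\<integral>\<^sup>+p. indicator A p \<partial>\<mu>) = (\<integral>\<^sup>+p. indicator (A \<inter> QLT L T) p \<partial>\<mu>)"
      using sets_eq_imp_space_eq[OF \<mu>] by (intro nn_integral_cong) (auto split: split_indicator)
    also have "\<dots> = emeasure \<mu> (A \<inter> QLT L T)"
      using set \<mu> by (intro nn_integral_indicator) (auto simp: sets_borel_QLT)
    also have "\<dots> = (\<integral>\<^sup>+t\<in>{-T<..<T}. emeasure (\<sigma> t) {x. (x, t) \<in> A \<inter> QLT L T} \<partial>lborel)"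
      using dis set by (simp add: disintegration_def sets_borel_QLT)
    also have "\<dots> = (\<integral>\<^sup>+t\<in>{-T<..<T}. (\<integral>\<^sup>+x. indicator A (x, t) \<partial>\<sigma> t) \<partial>lborel)"
      by (intro nn_integral_cong) (use nn_integral_slice_indicator[OF \<sigma> _ set] in \<open>auto split: split_indicator\<close>)
    finally show ?case .
  next
    case (mult u c)
    have "(\<integral>\<^sup>+p. c * u p \<partial>\<mu>) = c * (\<integral>\<^sup>+p. u p \<partial>\<mu>)" by (rule nn_integral_cmult[OF \<mu>m[OF mult.hyps(2)]])
    also have "\<dots> = (\<integral>\<^sup>+t. c * ((\<integral>\<^sup>+x. u (x, t) \<partial>\<sigma> t) * indicator {-T<..<T} t) \<partial>lborel)"
      unfolding mult.IH by (rule nn_integral_cmult[OF Lm[OF mult.hyps(2)], symmetric])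
    also have "\<dots> = (\<integral>\<^sup>+t\<in>{-T<..<T}. (\<integral>\<^sup>+x. c * u (x, t) \<partial>\<sigma> t) \<partial>lborel)"
      by (intro nn_integral_cong) (use nn_integral_cmult[OF \<sigma>m[OF mult.hyps(2)]] in \<open>auto split: split_indicator\<close>)
    finally show ?case .
  next
    case (add u v)
    have "(\<integral>\<^sup>+p. v p + u p \<partial>\<mu>) = (\<integral>\<^sup>+p. v p \<partial>\<mu>) + (\<integral>\<^sup>+p. u p \<partial>\<mu>)"
      by (intro nn_integral_add \<mu>m add.hyps)
    also have "\<dots> = (\<integral>\<^sup>+t. (\<integral>\<^sup>+x. v (x, t) \<partial>\<sigma> t) * indicator {-T<..<T} t + (\<integral>\<^sup>+x. u (x, t) \<partial>\<sigma> t) * indicator {-T<..<T} t \<partial>lborel)"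
      unfolding add.IH by (intro nn_integral_add[symmetric] Lm add.hyps)
    also have "\<dots> = (\<integral>\<^sup>+t\<in>{-T<..<T}. (\<integral>\<^sup>+x. v (x, t) + u (x, t) \<partial>\<sigma> t) \<partial>lborel)"
      by (intro nn_integral_cong) (use nn_integral_add[OF \<sigma>m \<sigma>m] add.hyps in \<open>auto split: split_indicator\<close>)
    finally show ?case .
  next
    case (seq U)
    have inc: "incseq (\<lambda>i. U i p)" for p
      using seq.hyps(3) unfolding incseq_def le_fun_def by blast
    have "(\<integral>\<^sup>+p. (SUP i. U i) p \<partial>\<mu>) = (SUP i. \<integral>\<^sup>+p. U i p \<partial>\<mu>)"
      unfolding SUP_apply by (rule nn_integral_monotone_convergence_SUP[OF seq.hyps(3) \<mu>m[OF seq.hyps(1)]])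
    also have "\<dots> = (SUP i. \<integral>\<^sup>+t\<in>{-T<..<T}. (\<integral>\<^sup>+x. U i (x, t) \<partial>\<sigma> t) \<partial>lborel)" by (simp add: seq.IH)
    also have "\<dots> = (\<integral>\<^sup>+t. (SUP i. (\<integral>\<^sup>+x. U i (x, t) \<partial>\<sigma> t) * indicator {-T<..<T} t) \<partial>lborel)"
    proof (rule nn_integral_monotone_convergence_SUP[symmetric])
      show "incseq (\<lambda>i t. (\<integral>\<^sup>+x. U i (x, t) \<partial>\<sigma> t) * indicator {-T<..<T} t)"
        using inc by (auto simp: incseq_def le_fun_def intro!: mult_right_mono nn_integral_mono)
    qed (rule Lm[OF seq.hyps(1)])
    also have "\<dots> = (\<integral>\<^sup>+t\<in>{-T<..<T}. (\<integral>\<^sup>+x. (SUP i. U i) (x, t) \<partial>\<sigma> t) \<partial>lborel)"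
    proof (intro nn_integral_cong)
      fix t
      show "(SUP i. (\<integral>\<^sup>+x. U i (x, t) \<partial>\<sigma> t) * indicator {-T<..<T} t) =
          (\<integral>\<^sup>+x. (SUP i. U i) (x, t) \<partial>\<sigma> t) * indicator {-T<..<T} t"
      proof (cases "t \<in> {-T<..<T}")
        case True
        have "(\<integral>\<^sup>+x. (SUP i. U i (x, t)) \<partial>\<sigma> t) = (SUP i. \<integral>\<^sup>+x. U i (x, t) \<partial>\<sigma> t)"
        proof (rule nn_integral_monotone_convergence_SUP)
          show "incseq (\<lambda>i x. U i (x, t))" using inc by (simp add: incseq_def le_fun_def)
        qed (rule \<sigma>m[OF seq.hyps(1) True])
        then show ?thesis using True by (simp add: SUP_apply image_comp)
      qed simp
    qed
    finally show ?case .
  qed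
qed

lemma integral_disintegration_nonneg:
  fixes h :: "(real^2) \<times> real \<Rightarrow> real"
  assumes L: "0 < L" and \<mu>: "\<mu> \<in> pos_measures (borel_QLT L T)" and dis: "disintegration L T \<mu> \<sigma>"
    and h: "h \<in> borel_measurable borel" "\<And>p. 0 \<le> h p" "\<And>p. h p \<le> K"
  shows "set_integrable lborel {-T<..<T} (\<lambda>t. LINT x|\<sigma> t. h (x, t))"
    and "(LINT p|\<mu>. h p) = (LINT t:{-T<..<T}|lborel. (LINT x|\<sigma> t. h (x, t)))"
proof -
  note \<sigma> = disintegration_kernel[OF dis] and \<mu>s = pos_measuresD[OF \<mu>]
  interpret \<mu>: finite_measure \<mu> by (rule \<mu>s(2))
  have hm: "h \<in> borel_measurable \<mu>" by (intro \<mu>s(4) measurable_restrict_space1 h)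
  define G where "G t = (LINT x|\<sigma> t. h (x, t))" for t
  have G0: "0 \<le> G t" for t unfolding G_def using h(2) by (intro integral_nonneg_AE) auto
  have Gnn: "(\<integral>\<^sup>+x. ennreal (h (x, t)) \<partial>\<sigma> t) = ennreal (G t)" if t: "t \<in> {-T<..<T}" for t
  proof -
    have t': "t \<in> {-T..T}" using t by auto
    interpret finite_measure "\<sigma> t" by (rule kernel_onD(2)[OF \<sigma> t'])
    have "integrable (\<sigma> t) (\<lambda>x. h (x, t))"
      using h by (intro integrable_const_bound[where B = K] kernel_borel_measurable[OF \<sigma> t'] measurable_slice) auto
    then show ?thesis unfolding G_def by (rule nn_integral_eq_integral) (use h in auto)
  qed
  have eq: "ennreal (indicator {-T<..<T} t * G t) = (\<integral>\<^sup>+x. ennreal (h (x, t)) \<partial>\<sigma> t) * indicator {-T<..<T} t" for t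
    using Gnn[of t] by (auto split: split_indicator)
  have hb: "(\<lambda>p. ennreal (h p)) \<in> borel_measurable borel" using h(1) by measurable
  have m: "(\<lambda>t. indicator {-T<..<T} t * G t) \<in> borel_measurable lborel"
  proof -
    have "(\<lambda>t. enn2real ((\<integral>\<^sup>+x. ennreal (h (x, t)) \<partial>\<sigma> t) * indicator {-T<..<T} t)) \<in> borel_measurable lborel"
      using kernel_nn_integral_measurable[OF L \<sigma> hb] by measurable
    then show ?thesis unfolding eq[symmetric] using G0 by (simp add: enn2real_ennreal)
  qed
  have int: "(\<integral>\<^sup>+p. ennreal (h p) \<partial>\<mu>) = (\<integral>\<^sup>+t. ennreal (indicator {-T<..<T} t * G t) \<partial>lborel)"
    using nn_integral_disintegration[OF L \<mu>s(1) dis hb] by (simp add: eq)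
  have hint: "integrable \<mu> h" using h hm by (intro \<mu>.integrable_const_bound[where B = K]) auto
  have fin: "(\<integral>\<^sup>+t. ennreal (indicator {-T<..<T} t * G t) \<partial>lborel) < \<infinity>"
    unfolding int[symmetric] using nn_integral_eq_integral[OF hint] h(2) by auto
  show "set_integrable lborel {-T<..<T} G"
    unfolding set_integrable_def real_scaleR_def by (rule integrableI_nonneg[OF m _ fin]) (use G0 in auto)
  have "(LINT p|\<mu>. h p) = enn2real (\<integral>\<^sup>+p. ennreal (h p) \<partial>\<mu>)"
    by (rule integral_eq_nn_integral) (use hm h in auto)
  also have "\<dots> = (LINT t|lborel. indicator {-T<..<T} t * G t)"
    unfolding int by (rule integral_eq_nn_integral[symmetric]) (use m G0 in auto)
  finally show "(LINT p|\<mu>. h p) = (LINT t:{-T<..<T}|lborel. G t)"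
    by (simp add: set_lebesgue_integral_def)
qed

lemma integral_disintegration:
  fixes h :: "(real^2) \<times> real \<Rightarrow> real"
  assumes L: "0 < L" and \<mu>: "\<mu> \<in> pos_measures (borel_QLT L T)" and dis: "disintegration L T \<mu> \<sigma>"
    and h: "h \<in> borel_measurable borel" "\<And>p. \<bar>h p\<bar> \<le> K"
  shows "set_integrable lborel {-T<..<T} (\<lambda>t. LINT x|\<sigma> t. h (x, t))" (is ?A)
    and "(LINT p|\<mu>. h p) = (LINT t:{-T<..<T}|lborel. (LINT x|\<sigma> t. h (x, t)))" (is ?B)
proof -
  note \<sigma> = disintegration_kernel[OF dis] and \<mu>s = pos_measuresD[OF \<mu>]
  interpret \<mu>: finite_measure \<mu> by (rule \<mu>s(2))
  define f where "f p = h p + K" for p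
  have K0: "0 \<le> K" using h(2) by (meson abs_ge_zero order_trans)
  have f: "f \<in> borel_measurable borel" "\<And>p. 0 \<le> f p" "\<And>p. f p \<le> 2 * K"
    using h(1) abs_le_D1[OF h(2)] abs_le_D2[OF h(2)] by (auto simp: f_def[abs_def] minus_le_iff add.commute)
      (smt (verit))
  have k: "(\<lambda>_. K) \<in> borel_measurable borel" "\<And>p. 0 \<le> K" "\<And>p. K \<le> K" using K0 by auto
  note F = integral_disintegration_nonneg[OF L \<mu> dis f] and C = integral_disintegration_nonneg[OF L \<mu> dis k]
  have sl: "(LINT x|\<sigma> t. h (x, t)) = (LINT x|\<sigma> t. f (x, t)) - (LINT x|\<sigma> t. K)" if t: "t \<in> {-T<..<T}" for t
  proof -
    have t': "t \<in> {-T..T}" using t by auto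
    interpret finite_measure "\<sigma> t" by (rule kernel_onD(2)[OF \<sigma> t'])
    have "integrable (\<sigma> t) (\<lambda>x. h (x, t))"
      using h by (intro integrable_const_bound[where B = K] kernel_borel_measurable[OF \<sigma> t'] measurable_slice) auto
    then show ?thesis by (simp add: f_def)
  qed
  have d: "set_integrable lborel {-T<..<T} (\<lambda>t. (LINT x|\<sigma> t. f (x, t)) - (LINT x|\<sigma> t. K))"
    by (rule set_integral_diff(1)[OF F(1) C(1)])
  then show ?A
    by (rule set_integrable_cong[THEN iffD2, rotated -1]) (use sl in auto)
  have hm: "h \<in> borel_measurable \<mu>" by (intro \<mu>s(4) measurable_restrict_space1 h)
  have "integrable \<mu> h" using h hm by (intro \<mu>.integrable_const_bound[where B = K]) auto
  then have "(LINT p|\<mu>. h p) = (LINT p|\<mu>. f p) - (LINT p|\<mu>. K)" by (simp add: f_def)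
  also have "\<dots> = (LINT t:{-T<..<T}|lborel. (LINT x|\<sigma> t. f (x, t)) - (LINT x|\<sigma> t. K))"
    unfolding F(2) C(2) by (rule set_integral_diff(2)[OF F(1) C(1), symmetric])
  also have "\<dots> = (LINT t:{-T<..<T}|lborel. (LINT x|\<sigma> t. h (x, t)))"
    by (rule set_lebesgue_integral_cong) (use sl in auto)
  finally show ?B .
qed

text \<open>
  Conversely, a kernel with bounded masses is the disintegration of some measure on space-time.
\<close>

lemma measure_of_kernel:
  assumes L: "0 < L" and \<sigma>: "kernel_on L T \<sigma>"
    and bd: "\<And>t. t \<in> {-T..T} \<Longrightarrow> emeasure (\<sigma> t) (QL L) \<le> ennreal C"
  obtains N where "N \<in> pos_measures (borel_QLT L T)" "disintegration L T N \<sigma>"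
proof -
  define F where "F A = (\<integral>\<^sup>+t\<in>{-T<..<T}. emeasure (\<sigma> t) {x. (x, t) \<in> A} \<partial>lborel)" for A
  define N where "N = measure_of (QLT L T) (sets (borel_QLT L T)) F"
  have sa: "sigma_algebra (QLT L T) (sets (borel_QLT L T))"
    using sets.sigma_algebra_axioms[of "borel_QLT L T"] by simp
  have sN: "sets N = sets (borel_QLT L T)" unfolding N_def
    using sigma_algebra.sigma_sets_eq[OF sa] sets.space_closed[of "borel_QLT L T"] by (simp add: sets_measure_of)
  have meas: "(\<lambda>t. emeasure (\<sigma> t) {x. (x, t) \<in> A} * indicator {-T<..<T} t) \<in> borel_measurable lborel"
    if A: "A \<in> sets (borel_QLT L T)" for A
  proof -
    have Ab: "A \<in> sets borel" and AQ: "A \<inter> QLT L T = A" using A by (auto simp: sets_borel_QLT)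
    have "(\<lambda>t. (\<integral>\<^sup>+x. indicator A (x, t) \<partial>\<sigma> t) * indicator {-T<..<T} t) \<in> borel_measurable lborel"
      by (rule kernel_nn_integral_measurable[OF L \<sigma>]) (use Ab in measurable)
    also have "(\<lambda>t. (\<integral>\<^sup>+x. indicator A (x, t) \<partial>\<sigma> t) * indicator {-T<..<T} t) =
       (\<lambda>t. emeasure (\<sigma> t) {x. (x, t) \<in> A} * indicator {-T<..<T} t)"
      using nn_integral_slice_indicator[OF \<sigma> _ Ab] by (auto simp: fun_eq_iff AQ split: split_indicator)
    finally show ?thesis .
  qed
  have emN: "emeasure N A = F A" if A: "A \<in> sets (borel_QLT L T)" for A
    unfolding N_def
  proof (rule emeasure_measure_of_sigma[OF sa _ _ A])
    show "positive (sets (borel_QLT L T)) F" by (simp add: positive_def F_def)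
    show "countably_additive (sets (borel_QLT L T)) F"
    proof (rule countably_additiveI)
      fix A :: "nat \<Rightarrow> _ set"
      assume A: "range A \<subseteq> sets (borel_QLT L T)" "disjoint_family A"
      have "(\<Sum>i. F (A i)) = (\<integral>\<^sup>+t. (\<Sum>i. emeasure (\<sigma> t) {x. (x, t) \<in> A i} * indicator {-T<..<T} t) \<partial>lborel)"
        unfolding F_def using A meas by (intro nn_integral_suminf[symmetric]) auto
      also have "\<dots> = F (\<Union> (range A))" unfolding F_def
      proof (intro nn_integral_cong)
        fix t
        show "(\<Sum>i. emeasure (\<sigma> t) {x. (x, t) \<in> A i} * indicator {-T<..<T} t) =
          emeasure (\<sigma> t) {x. (x, t) \<in> \<Union> (range A)} * indicator {-T<..<T} t"
        proof (cases "t \<in> {-T<..<T}")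
          case True
          then have t: "t \<in> {-T..T}" by auto
          have "(\<Sum>i. emeasure (\<sigma> t) {x. (x, t) \<in> A i}) = emeasure (\<sigma> t) (\<Union>i. {x. (x, t) \<in> A i})"
          proof (rule suminf_emeasure)
            show "range (\<lambda>i. {x. (x, t) \<in> A i}) \<subseteq> sets (\<sigma> t)"
              unfolding kernel_onD(1)[OF \<sigma> t] using A slice_borel_QLT by blast
            show "disjoint_family (\<lambda>i. {x. (x, t) \<in> A i})" using A(2) unfolding disjoint_family_on_def by blast
          qed
          moreover have "(\<Union>i. {x. (x, t) \<in> A i}) = {x. (x, t) \<in> \<Union> (range A)}" by auto
          ultimately show ?thesis using True by simp
        qed simp
      qed
      finally show "(\<Sum>i. F (A i)) = F (\<Union> (range A))" .
    qed
  qed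
  have "emeasure N (QLT L T) \<le> (\<integral>\<^sup>+t. ennreal C * indicator {-T<..<T} t \<partial>lborel)"
  proof -
    have "QLT L T \<in> sets (borel_QLT L T)" by (simp add: sets_borel_QLT)
    then have "emeasure N (QLT L T) = F (QLT L T)" by (rule emN)
    also have "\<dots> \<le> (\<integral>\<^sup>+t. ennreal C * indicator {-T<..<T} t \<partial>lborel)"
      unfolding F_def
    proof (rule nn_integral_mono)
      fix t
      have "{x. (x, t) \<in> QLT L T} = (if t \<in> {-T<..<T} then QL L else {})" by (auto simp: QLT_def)
      then show "emeasure (\<sigma> t) {x. (x, t) \<in> QLT L T} * indicator {-T<..<T} t \<le> ennreal C * indicator {-T<..<T} t"
        using bd[of t] by (auto split: split_indicator)
    qed
    finally show ?thesis .
  qed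
  also have "\<dots> < \<infinity>" 
  proof -
    have "emeasure lborel {-T<..<T} < \<infinity>" by (cases "- T \<le> T") auto
    then show ?thesis by (subst nn_integral_cmult_indicator) (auto simp: ennreal_mult_less_top)
  qed
  finally have "finite_measure N"
    using sets_eq_imp_space_eq[OF sN] by (intro finite_measureI) auto
  then have "N \<in> pos_measures (borel_QLT L T)" using sN by (simp add: pos_measures_def)
  moreover have "disintegration L T N \<sigma>"
    using \<sigma> emN by (auto simp: disintegration_def kernel_on_def F_def)
  ultimately show thesis by (rule that)
qed

section \<open>The derivative along the transport\<close>

text \<open>
  The derivative along \<open>(v, 1)\<close>, which equals \<open>\<partial>\<^sub>3 \<phi> + v
  \<bullet> \<nabla>' \<phi>\<close>. As a single directional derivative it inherits the product and
  chain rules.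
\<close>

definition transport_deriv ::
    "((real^2) \<times> real \<Rightarrow> real^2) \<Rightarrow> ((real^2) \<times> real \<Rightarrow> real) \<Rightarrow> (real^2) \<times> real \<Rightarrow> real" where
  "transport_deriv v \<phi> p = frechet_derivative \<phi> (at p) (v p, 1)"

lemma transport_deriv_eqI: "(\<phi> has_derivative D) (at p) \<Longrightarrow> transport_deriv v \<phi> p = D (v p, 1)"
  unfolding transport_deriv_def using frechet_derivative_at by fastforce

lemma transport_deriv_conv:
  assumes "smooth \<phi>"
  shows "transport_deriv v \<phi> p = deriv3 \<phi> p + v p \<bullet> grad' \<phi> p"
proof -
  let ?D = "frechet_derivative \<phi> (at p)"
  have lin: "linear ?D" using has_derivative_linear[OF smooth_has_derivative[OF assms]] .
  have "(v p, 1 :: real) = (0, 1) + (v p $ 1 *\<^sub>R (axis 1 1, 0) + v p $ 2 *\<^sub>R (axis 2 1, 0))"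
    by (simp add: vec_eq_iff forall_2 axis_def)
  then have "?D (v p, 1) = ?D (0, 1) + (v p $ 1 *\<^sub>R ?D (axis 1 1, 0) + v p $ 2 *\<^sub>R ?D (axis 2 1, 0))"
    by (simp only: linear_add[OF lin] linear_scale[OF lin])
  then show ?thesis by (simp add: transport_deriv_def deriv3_def grad'_def inner_vec_def sum_2)
qed

lemma transport_deriv_add:
  "smooth \<phi> \<Longrightarrow> smooth \<psi> \<Longrightarrow> transport_deriv v (\<lambda>p. \<phi> p + \<psi> p) p = transport_deriv v \<phi> p + transport_deriv v \<psi> p"
  by (subst transport_deriv_eqI[OF has_derivative_add[OF smooth_has_derivative smooth_has_derivative]])
    (auto simp: transport_deriv_def)

lemma transport_deriv_mult:
  "smooth \<phi> \<Longrightarrow> smooth \<psi> \<Longrightarrow> transport_deriv v (\<lambda>p. \<phi> p * \<psi> p) p =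
     \<phi> p * transport_deriv v \<psi> p + transport_deriv v \<phi> p * \<psi> p"
  by (subst transport_deriv_eqI[OF has_derivative_mult[OF smooth_has_derivative smooth_has_derivative]])
    (auto simp: transport_deriv_def)

lemma transport_deriv_diff:
  "smooth \<phi> \<Longrightarrow> smooth \<psi> \<Longrightarrow> transport_deriv v (\<lambda>p. \<phi> p - \<psi> p) p = transport_deriv v \<phi> p - transport_deriv v \<psi> p"
  by (subst transport_deriv_eqI[OF has_derivative_diff[OF smooth_has_derivative smooth_has_derivative]])
    (auto simp: transport_deriv_def)

lemma transport_deriv_const: "transport_deriv v (\<lambda>_. c) p = 0"
  by (simp add: transport_deriv_def)

lemma transport_deriv_cmult: "smooth \<phi> \<Longrightarrow> transport_deriv v (\<lambda>p. c * \<phi> p) p = c * transport_deriv v \<phi> p"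
  using transport_deriv_mult[OF smooth_const, of \<phi> v c p] by (simp add: transport_deriv_const)

lemma transport_deriv_compose:
  assumes "(\<beta> has_real_derivative b) (at (\<phi> p))" "smooth \<phi>"
  shows "transport_deriv v (\<lambda>p. \<beta> (\<phi> p)) p = b * transport_deriv v \<phi> p"
  using transport_deriv_eqI[OF has_derivative_compose[OF smooth_has_derivative[OF assms(2)]
      assms(1)[unfolded has_field_derivative_def]], of v]
  by (simp add: transport_deriv_def)

lemma smooth_fst: "smooth f \<Longrightarrow> smooth (\<lambda>p :: (real^2) \<times> real. f (fst p))"
  by (rule smooth_compose_linear[OF bounded_linear_fst])

lemma smooth_snd: "smooth f \<Longrightarrow> smooth (\<lambda>p :: (real^2) \<times> real. f (snd p))"
  by (rule smooth_compose_linear[OF bounded_linear_snd])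

lemma transport_deriv_time_mult:
  assumes "(H has_real_derivative h) (at (snd p))" "smooth H" "smooth \<phi>"
  shows "transport_deriv v (\<lambda>p. H (snd p) * \<phi> p) p = H (snd p) * transport_deriv v \<phi> p + h * \<phi> p"
proof -
  have "((\<lambda>p. H (snd p)) has_derivative (\<lambda>y. h * snd y)) (at p)"
    using has_derivative_compose[OF has_derivative_snd[OF has_derivative_ident]
        assms(1)[unfolded has_field_derivative_def]] by simp
  from transport_deriv_eqI[OF this, of v]
  show ?thesis using transport_deriv_mult[OF smooth_snd[OF assms(2)] assms(3), of v p] by simp
qed

lemma smooth_bounded_QLT:
  fixes \<phi> :: "(real^2) \<times> real \<Rightarrow> real"
  assumes "smooth \<phi>"
  obtains K where "0 \<le> K" "\<And>p. p \<in> QLT L T \<Longrightarrow> \<bar>\<phi> p\<bar> \<le> K"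
proof -
  obtain K where K: "0 \<le> K" "\<And>p. p \<in> square L \<times> {-T..T} \<Longrightarrow> \<bar>\<phi> p\<bar> \<le> K"
    by (fact continuous_compact_bound[OF compact_Times[OF compact_square compact_Icc] smooth_continuous[OF assms]])
  moreover have "QLT L T \<subseteq> square L \<times> {-T..T}" using QL_subset_square[of L] by (auto simp: QLT_def)
  ultimately show thesis using that by blast
qed

lemma smooth_deriv3: "smooth \<phi> \<Longrightarrow> smooth (deriv3 \<phi>)"
  unfolding deriv3_def[abs_def] by (rule smooth_frechet_derivative)

lemma smooth_grad'_component: "smooth \<phi> \<Longrightarrow> smooth (\<lambda>p. grad' \<phi> p $ i)"
  unfolding grad'_def vec_lambda_beta by (rule smooth_frechet_derivative)

lemma test_functionsD:
  assumes "\<phi> \<in> test_functions L T"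
  shows "smooth \<phi>" "\<And>t. periodic L (\<lambda>x. \<phi> (x, t))"
  using assms by (auto simp: test_functions_def smooth_def)

lemma time_cutoff_test_function:
  assumes "smooth \<phi>" "\<And>t. periodic L (\<lambda>x. \<phi> (x, t))" "smooth \<eta>" "r < T" "\<And>t. r \<le> \<bar>t\<bar> \<Longrightarrow> \<eta> t = 0"
  shows "(\<lambda>p. \<eta> (snd p) * \<phi> p) \<in> test_functions L T"
proof -
  have "smooth (\<lambda>p. \<eta> (snd p) * \<phi> p)" by (intro smooth_mult smooth_snd assms)
  then show ?thesis using assms unfolding test_functions_def smooth_def periodic_def by auto
qed

text \<open>
  Smooth approximations \<open>H n\<close> of the jump at \<open>s\<close>, with derivatives that
  concentrate at \<open>s\<close>. The transition takes place after \<open>s\<close> if \<open>s <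
  T\<close>, and before \<open>s\<close> if \<open>s = T\<close>; in both cases it stays inside
  \<open>(-T, T)\<close> and \<open>H n\<close> converges to the same indicator on \<open>(-T,
  T)\<close>.
\<close>

lemma time_steps:
  assumes T: "0 < T" and s: "s \<in> {-T..T}"
  obtains H \<zeta> :: "nat \<Rightarrow> real \<Rightarrow> real" and r :: "nat \<Rightarrow> real" where
    "\<And>n. smooth (H n)" "\<And>n. smooth (\<zeta> n)" "\<And>n t. (H n has_real_derivative \<zeta> n t) (at t)"
    "\<And>n t. 0 \<le> \<zeta> n t" "\<And>n t. 0 \<le> H n t" "\<And>n t. H n t \<le> 1" "\<And>n. r n < T"
    "\<And>n t. t \<le> - r n \<Longrightarrow> H n t = 0" "\<And>n t. r n \<le> t \<Longrightarrow> H n t = 1"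
    "\<And>n t. r n \<le> \<bar>t\<bar> \<Longrightarrow> \<zeta> n t = 0" "\<And>n t. \<zeta> n t \<noteq> 0 \<Longrightarrow> \<bar>t - s\<bar> \<le> 2 * T / real (n + 2)"
    "\<And>t. t < T \<Longrightarrow> (\<lambda>n. H n t) \<longlonglongrightarrow> indicator {s<..} t"
proof -
  \<comment> \<open>The transition takes place in \<open>[a n, b n]\<close>.\<close>
  define a where "a n = (if s < T then s + (T - s) / real (n + 3) else T - T / real (n + 2))" for n
  define b where "b n = (if s < T then s + (T - s) / real (n + 2) else T - T / real (n + 3))" for n
  have ab: "- T < a n" "a n < b n" "b n < T" for n
  proof -
    have frac: "c / real (n + 3) < c / real (n + 2) \<and> c / real (n + 2) < c \<and> - c < c / real (n + 3)" if "0 < c" for c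
    proof (intro conjI)
      show "c / real (n + 3) < c / real (n + 2)" "c / real (n + 2) < c"
        using that by (auto intro!: divide_strict_left_mono add_pos_nonneg simp: field_simps)
      have "0 < c / real (n + 3)" using that by simp
      then show "- c < c / real (n + 3)" using that by linarith
    qed
    have "- T < a n \<and> a n < b n \<and> b n < T"
    proof (cases "s < T")
      case True
      then have "0 < T - s" by simp
      moreover define z where "z = (T - s) / real (n + 3)"
      ultimately have "0 < z" by simp
      with frac[OF \<open>0 < T - s\<close>] show ?thesis
        using s unfolding a_def b_def if_P[OF True] z_def[symmetric] by auto
    next
      case False
      from frac[OF T] show ?thesis using T unfolding a_def b_def if_not_P[OF False] by auto
    qed
    then show "- T < a n" "a n < b n" "b n < T" by auto
  qed
  have near: "\<bar>a n - s\<bar> \<le> 2 * T / real (n + 2) \<and> \<bar>b n - s\<bar> \<le> 2 * T / real (n + 2)" for n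
  proof -
    have le: "c / real (n + 3) \<le> 2 * T / real (n + 2)" "c / real (n + 2) \<le> 2 * T / real (n + 2)"
      if "0 \<le> c" "c \<le> 2 * T" for c
      using that T by (auto intro!: frac_le divide_right_mono)
    show ?thesis
    proof (cases "s < T")
      case True
      then show ?thesis using le[of "T - s"] s by (simp add: a_def b_def)
    next
      case False
      then show ?thesis using le[of T] s T by (simp add: a_def b_def)
    qed
  qed
  have supp: "\<bar>t - s\<bar> \<le> 2 * T / real (n + 2)" if t: "a n \<le> t" "t \<le> b n" for n t
    using near[of n] t by (simp only: abs_le_iff) linarith
  define step where "step a b H \<zeta> \<longleftrightarrow> smooth H \<and> smooth \<zeta> \<and> (\<forall>t. (H has_real_derivative \<zeta> t) (at t)) \<and> (\<forall>t. 0 \<le> \<zeta> t) \<and>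
      (\<forall>t. t \<le> a \<or> b \<le> t \<longrightarrow> \<zeta> t = 0) \<and> (\<forall>t\<le>a. H t = 0) \<and> (\<forall>t\<ge>b. H t = 1) \<and> (\<forall>t. 0 \<le> H t \<and> H t \<le> 1)"
    for a b :: real and H \<zeta>
  have "\<exists>H \<zeta>. step (a n) (b n) H \<zeta>" for n
  proof -
    obtain H \<zeta> where "smooth H" "smooth \<zeta>" "\<And>t. (H has_real_derivative \<zeta> t) (at t)"
      "\<And>t. 0 \<le> \<zeta> t" "\<And>t. t \<le> a n \<or> b n \<le> t \<Longrightarrow> \<zeta> t = 0"
      "\<And>t. t \<le> a n \<Longrightarrow> H t = 0" "\<And>t. b n \<le> t \<Longrightarrow> H t = 1" "\<And>t. 0 \<le> H t" "\<And>t. H t \<le> 1"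
      by (fact smooth_step[OF ab(2)[of n]])
    then have "step (a n) (b n) H \<zeta>" unfolding step_def by (intro conjI allI impI; assumption?) auto
    then show ?thesis by blast
  qed
  then have "\<forall>n. \<exists>H \<zeta>. step (a n) (b n) H \<zeta>" by blast
  from choice[OF this] obtain H where "\<forall>n. \<exists>\<zeta>. step (a n) (b n) (H n) \<zeta>" by blast
  from choice[OF this] obtain \<zeta> where step: "\<forall>n. step (a n) (b n) (H n) (\<zeta> n)" by blast
  then have H: "\<And>n. smooth (H n)" "\<And>n. smooth (\<zeta> n)" "\<And>n t. (H n has_real_derivative \<zeta> n t) (at t)"
      "\<And>n t. 0 \<le> \<zeta> n t" "\<And>n t. t \<le> a n \<or> b n \<le> t \<Longrightarrow> \<zeta> n t = 0" "\<And>n t. t \<le> a n \<Longrightarrow> H n t = 0"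
      "\<And>n t. b n \<le> t \<Longrightarrow> H n t = 1" "\<And>n t. 0 \<le> H n t" "\<And>n t. H n t \<le> 1"
    unfolding step_def by blast+
  show thesis
  proof (rule that[of H \<zeta> "\<lambda>n. max \<bar>a n\<bar> \<bar>b n\<bar>"])
    show "max \<bar>a n\<bar> \<bar>b n\<bar> < T" for n using ab[of n] by auto
    show "H n t = 0" if "t \<le> - max \<bar>a n\<bar> \<bar>b n\<bar>" for n t using that by (intro H(6)) auto
    show "H n t = 1" if "max \<bar>a n\<bar> \<bar>b n\<bar> \<le> t" for n t using that by (intro H(7)) auto
    show "\<zeta> n t = 0" if "max \<bar>a n\<bar> \<bar>b n\<bar> \<le> \<bar>t\<bar>" for n t using that by (intro H(5)) auto
    show "\<bar>t - s\<bar> \<le> 2 * T / real (n + 2)" if "\<zeta> n t \<noteq> 0" for n t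
    proof (rule supp)
      have "\<not> (t \<le> a n \<or> b n \<le> t)" using H(5)[of t n] that by blast
      then show "a n \<le> t" "t \<le> b n" by auto
    qed
    fix t assume t: "t < T"
    have lim: "(\<lambda>n. c / real (n + 2)) \<longlonglongrightarrow> 0" for c
      using LIMSEQ_ignore_initial_segment[OF lim_const_over_n, of c 2] by simp
    have ev: "eventually (\<lambda>n. indicator {s<..} t = H n t) sequentially"
    proof (cases "s < t")
      case True
      then have "s < T" using t by simp
      have "b \<longlonglongrightarrow> s + 0" unfolding b_def if_P[OF \<open>s < T\<close>] by (rule tendsto_add[OF tendsto_const lim])
      then have "eventually (\<lambda>n. b n < t) sequentially" using True by (intro order_tendstoD(2)) auto
      then show ?thesis by eventually_elim (use True H(7) in auto)
    next
      case F: False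
      show ?thesis
      proof (cases "s < T")
        case True
        have "t \<le> a n" for n using F True by (auto simp: a_def intro: add_increasing2)
        then show ?thesis using F H(6) by auto
      next
        case False
        have "a \<longlonglongrightarrow> T - 0" unfolding a_def if_not_P[OF False] by (rule tendsto_diff[OF tendsto_const lim])
        then have "eventually (\<lambda>n. t < a n) sequentially" using t by (intro order_tendstoD(1)) auto
        then show ?thesis by eventually_elim (use F H(6) in auto)
      qed
    qed
    show "(\<lambda>n. H n t) \<longlonglongrightarrow> indicator {s<..} t"
      by (rule Lim_transform_eventually[OF tendsto_const ev])
  qed (use H in auto)
qed

text \<open>
  The distributional continuity equation with velocity \<open>v\<close>. The last assumption holds
  for every measure with a disintegration; it makes integrals over the future of \<open>s\<close>
  continuous in \<open>s\<close>.
\<close>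

locale transport =
  fixes L T :: real and \<mu> :: "((real^2) \<times> real) measure" and v :: "(real^2) \<times> real \<Rightarrow> real^2"
  assumes L: "0 < L" and T: "0 < T" and \<mu>: "\<mu> \<in> pos_measures (borel_QLT L T)"
    and v: "integrable \<mu> v"
    and weak_eq: "\<And>\<phi>. \<phi> \<in> test_functions L T \<Longrightarrow> (LINT p|\<mu>. transport_deriv v \<phi> p) = 0"
    and null_slice: "\<And>s. AE p in \<mu>. snd p \<noteq> s"
begin

lemma transport_measure: "sets \<mu> = sets (borel_QLT L T)" "finite_measure \<mu>" "space \<mu> = QLT L T"
  using pos_measuresD[OF \<mu>] by simp_all

sublocale finite_measure \<mu> by (rule transport_measure(2))

lemma borel_measurable_\<mu>: "f \<in> borel_measurable borel \<Longrightarrow> f \<in> borel_measurable \<mu>" for f :: "_ \<Rightarrow> real"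
  by (intro pos_measuresD(4)[OF \<mu>] measurable_restrict_space1)

lemma snd_measurable: "f \<in> borel_measurable borel \<Longrightarrow> (\<lambda>p. f (snd p)) \<in> borel_measurable \<mu>" for f :: "real \<Rightarrow> real"
  by (intro borel_measurable_\<mu>) (simp add: borel_prod[symmetric] measurable_compose[OF measurable_snd])

lemma integrable_smooth: "smooth \<phi> \<Longrightarrow> integrable \<mu> \<phi>"
proof -
  assume s: "smooth \<phi>"
  obtain K where K: "\<And>p. p \<in> QLT L T \<Longrightarrow> \<bar>\<phi> p\<bar> \<le> K" using smooth_bounded_QLT[OF s] by blast
  show ?thesis
    by (rule integrable_const_bound[where B = K])
      (use K transport_measure(3) in \<open>auto intro: borel_measurable_\<mu> smooth_borel[OF s]\<close>)
qed

lemma integrable_bounded_mult: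
  fixes f g :: "(real^2) \<times> real \<Rightarrow> real"
  assumes f: "integrable \<mu> f" and g: "g \<in> borel_measurable \<mu>" "\<And>p. p \<in> QLT L T \<Longrightarrow> \<bar>g p\<bar> \<le> K"
  shows "integrable \<mu> (\<lambda>p. g p * f p)"
proof (rule Bochner_Integration.integrable_bound[where f = "\<lambda>p. K * f p"])
  show "integrable \<mu> (\<lambda>p. K * f p)" using f by simp
  show "AE p in \<mu>. norm (g p * f p) \<le> norm (K * f p)"
    using order_trans[OF g(2) abs_ge_self] by (auto simp: transport_measure(3) abs_mult intro!: AE_I2 mult_right_mono)
qed (use f g in auto)

lemma integrable_transport_deriv:
  assumes s: "smooth \<phi>"
  shows "integrable \<mu> (transport_deriv v \<phi>)"
proof -
  have "integrable \<mu> (\<lambda>p. grad' \<phi> p $ i * v p $ i)" for i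
  proof -
    obtain K where K: "\<And>p. p \<in> QLT L T \<Longrightarrow> \<bar>grad' \<phi> p $ i\<bar> \<le> K"
      using smooth_bounded_QLT[OF smooth_grad'_component[OF s]] by blast
    show ?thesis
      by (rule integrable_bounded_mult[OF integrable_bounded_linear[OF bounded_linear_vec_nth v] _ K])
        (intro borel_measurable_\<mu> smooth_borel smooth_grad'_component s)
  qed
  then have "integrable \<mu> (\<lambda>p. deriv3 \<phi> p + (\<Sum>i\<in>UNIV. grad' \<phi> p $ i * v p $ i))"
    by (intro Bochner_Integration.integrable_add Bochner_Integration.integrable_sum
        integrable_smooth[OF smooth_deriv3[OF s]])
  also have "(\<lambda>p. deriv3 \<phi> p + (\<Sum>i\<in>UNIV. grad' \<phi> p $ i * v p $ i)) = transport_deriv v \<phi>"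
    using transport_deriv_conv[OF s] by (auto simp: fun_eq_iff inner_vec_def mult.commute)
  finally show ?thesis .
qed

end

section \<open>Traces at a fixed time\<close>

lemma integral_step_primitive:
  fixes \<zeta> \<kappa> :: "real \<Rightarrow> real"
  assumes \<kappa>: "\<And>t. (\<kappa> has_real_derivative \<zeta> t) (at t)" and \<zeta>: "continuous_on UNIV \<zeta>"
    and r: "\<And>t. r \<le> \<bar>t\<bar> \<Longrightarrow> \<zeta> t = 0" "r < T" and \<tau>: "- T \<le> \<tau>"
  shows "(LINT t|lborel. \<zeta> t * indicator {..<\<tau>} t) = \<kappa> \<tau> - \<kappa> (- T)"
proof -
  have "(LINT t|lborel. indicator {-T..\<tau>} t *\<^sub>R \<zeta> t) = \<kappa> \<tau> - \<kappa> (- T)"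
    by (rule integral_FTC_atLeastAtMost[OF \<tau>])
      (use \<kappa> \<zeta> in \<open>auto simp: has_real_derivative_iff_has_vector_derivative[symmetric]
         intro: has_field_derivative_at_within continuous_on_subset\<close>)
  moreover have "(LINT t|lborel. \<zeta> t * indicator {..<\<tau>} t) = (LINT t|lborel. indicator {-T..\<tau>} t *\<^sub>R \<zeta> t)"
  proof (rule integral_cong_AE)
    have [measurable]: "\<zeta> \<in> borel_measurable borel" using \<zeta> by (rule borel_measurable_continuous_onI)
    show "(\<lambda>t. \<zeta> t * indicator {..<\<tau>} t) \<in> borel_measurable lborel" by measurable
    show "(\<lambda>t. indicat_real {-T..\<tau>} t *\<^sub>R \<zeta> t) \<in> borel_measurable lborel" by measurable
    have "AE t in lborel. t \<noteq> \<tau>" by (rule AE_lborel_singleton)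
    then show "AE t in lborel. \<zeta> t * indicator {..<\<tau>} t = indicat_real {-T..\<tau>} t *\<^sub>R \<zeta> t"
    proof eventually_elim
      case (elim t)
      have "\<zeta> t = 0" if "t < - T" using r(2) that by (intro r(1)) auto
      then show ?case using elim by (auto simp: indicator_def)
    qed
  qed
  ultimately show ?thesis by simp
qed

context transport
begin

lemma smooth_space: "f \<in> smooth_periodic L \<Longrightarrow> smooth (\<lambda>p :: (real^2) \<times> real. f (fst p))"
  by (intro smooth_fst smooth_periodicD(1))

text \<open>
  Let \<open>Z\<close> be a smooth step from \<open>0\<close> to \<open>1\<close>. Formally
  \<open>\<integral> D (Z f) d\<mu>\<close> is the integral of \<open>f\<close> over the slice at
  \<open>T\<close> and \<open>\<integral>\<^bsub>t > s\<^esub> D f d\<mu>\<close> is the increment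
  of this quantity between \<open>s\<close> and \<open>T\<close>, so their difference \<open>F s
  f\<close> is the integral over the slice at \<open>s\<close>. Testing the continuity equation with
  \<open>(c Z - H) f\<close> compares \<open>Z\<close> with an arbitrary profile \<open>H\<close>
  that increases from \<open>0\<close> to \<open>c\<close>: a step near \<open>s\<close> shows that
  \<open>F s\<close> is positive, and the primitive of a cutoff \<open>\<zeta>\<close> shows, after
  an exchange of integrals, that \<open>F t\<close> disintegrates \<open>\<mu>\<close>.
\<close>

lemma trace_functional:
  obtains F :: "real \<Rightarrow> (real^2 \<Rightarrow> real) \<Rightarrow> real" where
    "\<And>s. linear_functional_on (smooth_periodic L) (F s)"
    "\<And>s f. s \<in> {-T..T} \<Longrightarrow> f \<in> smooth_periodic L \<Longrightarrow> (\<And>x. 0 \<le> f x) \<Longrightarrow> 0 \<le> F s f"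
    "\<And>s. F s (\<lambda>_. 1) = F 0 (\<lambda>_. 1)"
    "\<And>f. f \<in> smooth_periodic L \<Longrightarrow> continuous_on UNIV (\<lambda>s. F s f)"
    "\<And>f \<zeta> r. f \<in> smooth_periodic L \<Longrightarrow> smooth \<zeta> \<Longrightarrow> r < T \<Longrightarrow> (\<And>t. r \<le> \<bar>t\<bar> \<Longrightarrow> \<zeta> t = 0) \<Longrightarrow>
       (LINT t|lborel. \<zeta> t * F t f) = (LINT p|\<mu>. f (fst p) * \<zeta> (snd p))"
proof -
  obtain Z Z' where Z: "smooth Z" "smooth Z'" "\<And>t. (Z has_real_derivative Z' t) (at t)"
    "\<And>t. t \<le> - (T/2) \<Longrightarrow> Z t = 0" "\<And>t. T/2 \<le> t \<Longrightarrow> Z t = 1"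
    
  proof (rule smooth_step[of "- (T/2)" "T/2"])
    show "- (T/2) < T/2" using T by simp
  qed blast
  define D where "D f = transport_deriv v (\<lambda>p. f (fst p))" for f :: "real^2 \<Rightarrow> real"
  define E where "E f = (LINT p|\<mu>. transport_deriv v (\<lambda>p. Z (snd p) * f (fst p)) p)" for f :: "real^2 \<Rightarrow> real"
  define F where "F s f = E f - (LINT p|\<mu>. indicator {s<..} (snd p) * D f p)" for s f
  have D_int: "integrable \<mu> (D f)" if "f \<in> smooth_periodic L" for f
    unfolding D_def by (intro integrable_transport_deriv smooth_space that)
  have Dg_int: "integrable \<mu> (\<lambda>p. g (snd p) * D f p)"
    if "f \<in> smooth_periodic L" "g \<in> borel_measurable borel" "\<And>t. \<bar>g t\<bar> \<le> K" for f g K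
    by (rule integrable_bounded_mult[OF D_int[OF that(1)] snd_measurable[OF that(2)] that(3)])
  have ind_int: "integrable \<mu> (\<lambda>p. indicator {s<..} (snd p) * D f p)" if "f \<in> smooth_periodic L" for s f
    by (rule Dg_int[OF that, of _ 1]) (auto simp: indicator_def)
  have Zf: "smooth (\<lambda>p. Z (snd p) * f (fst p))" if "f \<in> smooth_periodic L" for f
    by (intro smooth_mult smooth_snd smooth_space Z that)
  have F_add: "F s (\<lambda>x. f x + g x) = F s f + F s g" if f: "f \<in> smooth_periodic L" and g: "g \<in> smooth_periodic L" for s f g
  proof -
    have "D (\<lambda>x. f x + g x) p = D f p + D g p" for p
      unfolding D_def by (rule transport_deriv_add) (intro smooth_space f g)+
    moreover have "E (\<lambda>x. f x + g x) = E f + E g"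
      unfolding E_def distrib_left transport_deriv_add[OF Zf[OF f] Zf[OF g]]
      by (intro Bochner_Integration.integral_add integrable_transport_deriv Zf f g)
    ultimately show ?thesis using ind_int[OF f] ind_int[OF g] by (simp add: F_def distrib_left)
  qed
  have F_scale: "F s (\<lambda>x. c * f x) = c * F s f" if f: "f \<in> smooth_periodic L" for s f c
  proof -
    have "D (\<lambda>x. c * f x) p = c * D f p" for p
      unfolding D_def by (rule transport_deriv_cmult) (intro smooth_space f)
    moreover have "E (\<lambda>x. c * f x) = c * E f"
      unfolding E_def mult.left_commute[of _ c] transport_deriv_cmult[OF Zf[OF f]] by simp
    ultimately show ?thesis by (simp add: F_def right_diff_distrib mult.left_commute[of _ c])
  qed
  have lin: "linear_functional_on (smooth_periodic L) (F s)" for s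
    unfolding linear_functional_on_def using F_add F_scale by auto
  \<comment> \<open>The step profile \<open>Z\<close> may be replaced by any profile \<open>H\<close> with the
    values \<open>0\<close> and \<open>c\<close> near the two ends, since \<open>(c Z - H)
    f\<close> is a test function.\<close>
  have E_step: "c * E f = (LINT p|\<mu>. \<zeta> (snd p) * f (fst p)) + (LINT p|\<mu>. H (snd p) * D f p)"
    if f: "f \<in> smooth_periodic L" and H: "smooth H" "smooth \<zeta>" "\<And>t. (H has_real_derivative \<zeta> t) (at t)"
      and r: "r < T" "\<And>t. t \<le> - r \<Longrightarrow> H t = 0" "\<And>t. r \<le> t \<Longrightarrow> H t = c" for f H \<zeta> r c
  proof -
    have fs: "smooth (\<lambda>p :: (real^2) \<times> real. f (fst p))" by (rule smooth_space[OF f])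
    have Hf: "smooth (\<lambda>p. H (snd p) * f (fst p))" by (intro smooth_mult smooth_snd fs H)
    have per: "periodic L (\<lambda>x. f (fst (x, t)))" for t :: real using smooth_periodicD(2)[OF f] by simp
    obtain K where K: "\<And>p. p \<in> QLT L T \<Longrightarrow> \<bar>H (snd p)\<bar> \<le> K"
      using smooth_bounded_QLT[OF smooth_snd[OF H(1)]] by blast
    have HD: "integrable \<mu> (\<lambda>p. H (snd p) * D f p)"
      by (rule integrable_bounded_mult[OF D_int[OF f] snd_measurable[OF smooth_borel[OF H(1)]] K])
    have "(\<lambda>p. (c * Z (snd p) - H (snd p)) * f (fst p)) \<in> test_functions L T"
    proof (rule time_cutoff_test_function[OF fs per])
      show "smooth (\<lambda>t. c * Z t - H t)" by (intro smooth_diff smooth_mult smooth_const Z H)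
      show "max r (T/2) < T" using r T by auto
      show "c * Z t - H t = 0" if "max r (T/2) \<le> \<bar>t\<bar>" for t
      proof (cases "0 \<le> t")
        case True then show ?thesis using that r(3)[of t] Z(5)[of t] by simp
      next
        case False then show ?thesis using that r(2)[of t] Z(4)[of t] by simp
      qed
    qed
    then have "0 = (LINT p|\<mu>. transport_deriv v (\<lambda>p. (c * Z (snd p) - H (snd p)) * f (fst p)) p)"
      using weak_eq by simp
    also have "(\<lambda>p. (c * Z (snd p) - H (snd p)) * f (fst p)) = (\<lambda>p. c * (Z (snd p) * f (fst p)) - H (snd p) * f (fst p))"
      by (simp add: algebra_simps)
    also have "(LINT p|\<mu>. transport_deriv v (\<lambda>p. c * (Z (snd p) * f (fst p)) - H (snd p) * f (fst p)) p) =
        (LINT p|\<mu>. c * transport_deriv v (\<lambda>p. Z (snd p) * f (fst p)) p - (H (snd p) * D f p + \<zeta> (snd p) * f (fst p)))"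
      by (simp only: transport_deriv_diff[OF smooth_mult[OF smooth_const Zf[OF f]] Hf]
          transport_deriv_cmult[OF Zf[OF f]] transport_deriv_time_mult[OF H(3) H(1) fs] D_def)
    also have "\<dots> = c * E f - ((LINT p|\<mu>. H (snd p) * D f p) + (LINT p|\<mu>. \<zeta> (snd p) * f (fst p)))"
    proof -
      have "integrable \<mu> (transport_deriv v (\<lambda>p. Z (snd p) * f (fst p)))" by (intro integrable_transport_deriv Zf f)
      moreover have "integrable \<mu> (\<lambda>p. \<zeta> (snd p) * f (fst p))" by (intro integrable_smooth smooth_mult smooth_snd fs H)
      ultimately show ?thesis using HD by (simp add: E_def)
    qed
    finally show ?thesis by simp
  qed
  have pos: "0 \<le> F s f" if s: "s \<in> {-T..T}" and f: "f \<in> smooth_periodic L" and f0: "\<And>x. 0 \<le> f x" for s f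
  proof -
    obtain H \<zeta> :: "nat \<Rightarrow> real \<Rightarrow> real" and r :: "nat \<Rightarrow> real" where H:
      "\<And>n. smooth (H n)" "\<And>n. smooth (\<zeta> n)" "\<And>n t. (H n has_real_derivative \<zeta> n t) (at t)"
      "\<And>n t. 0 \<le> \<zeta> n t" "\<And>n t. 0 \<le> H n t" "\<And>n t. H n t \<le> 1" "\<And>n. r n < T"
      "\<And>n t. t \<le> - r n \<Longrightarrow> H n t = 0" "\<And>n t. r n \<le> t \<Longrightarrow> H n t = 1"
      "\<And>t. t < T \<Longrightarrow> (\<lambda>n. H n t) \<longlonglongrightarrow> indicator {s<..} t"
      by (rule time_steps[OF T s]) blast
    have H1: "\<bar>H n t\<bar> \<le> 1" for n t using H(5,6) by simp
    have le: "(LINT p|\<mu>. H n (snd p) * D f p) \<le> E f" for n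
    proof -
      have "0 \<le> (LINT p|\<mu>. \<zeta> n (snd p) * f (fst p))" using H(4) f0 by (intro integral_nonneg_AE) auto
      then show ?thesis using E_step[OF f H(1,2,3) H(7,8,9), of n] by simp
    qed
    have "(\<lambda>n. LINT p|\<mu>. H n (snd p) * D f p) \<longlonglongrightarrow> (LINT p|\<mu>. indicator {s<..} (snd p) * D f p)"
    proof (rule integral_dominated_convergence[where w = "\<lambda>p. \<bar>D f p\<bar>"])
      show "AE p in \<mu>. (\<lambda>n. H n (snd p) * D f p) \<longlonglongrightarrow> indicator {s<..} (snd p) * D f p"
        using H(10) transport_measure(3) by (auto simp: QLT_def intro!: AE_I2 tendsto_intros)
      show "AE p in \<mu>. norm (H n (snd p) * D f p) \<le> \<bar>D f p\<bar>" for n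
        using H1 by (auto simp: abs_mult intro!: AE_I2 mult_left_le_one_le)
      show "integrable \<mu> (\<lambda>p. \<bar>D f p\<bar>)" using D_int[OF f] by simp
      show "(\<lambda>p. H n (snd p) * D f p) \<in> borel_measurable \<mu>" for n
        by (rule borel_measurable_integrable[OF Dg_int[OF f smooth_borel[OF H(1)] H1]])
      show "(\<lambda>p. indicator {s<..} (snd p) * D f p) \<in> borel_measurable \<mu>"
        by (rule borel_measurable_integrable[OF ind_int[OF f]])
    qed
    then have "(LINT p|\<mu>. indicator {s<..} (snd p) * D f p) \<le> E f"
      by (rule LIMSEQ_le_const2) (use le in auto)
    then show ?thesis by (simp add: F_def)
  qed
  have const: "F s (\<lambda>_. 1) = F 0 (\<lambda>_. 1)" for s
    by (simp add: F_def D_def transport_deriv_const)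
  have cont: "continuous_on UNIV (\<lambda>s. F s f)" if f: "f \<in> smooth_periodic L" for f
  proof (rule continuous_at_imp_continuous_on, intro ballI continuous_at_sequentiallyI)
    fix s :: real and u :: "nat \<Rightarrow> real" assume u: "u \<longlonglongrightarrow> s"
    have "(\<lambda>n. LINT p|\<mu>. indicator {u n<..} (snd p) * D f p) \<longlonglongrightarrow> (LINT p|\<mu>. indicator {s<..} (snd p) * D f p)"
    proof (rule integral_dominated_convergence[where w = "\<lambda>p. \<bar>D f p\<bar>"])
      show "AE p in \<mu>. (\<lambda>n. indicator {u n<..} (snd p) * D f p) \<longlonglongrightarrow> indicator {s<..} (snd p) * D f p"
        using null_slice[of s]
      proof eventually_elim
        case (elim p)
        have "eventually (\<lambda>n. indicator {s<..} (snd p) * D f p = indicator {u n<..} (snd p) * D f p) sequentially"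
        proof (cases "s < snd p")
          case True
          from order_tendstoD(2)[OF u this] show ?thesis by eventually_elim (use True in auto)
        next
          case False
          then have "snd p < s" using elim by simp
          from order_tendstoD(1)[OF u this] show ?thesis by eventually_elim (use False in auto)
        qed
        then show ?case by (rule Lim_transform_eventually[OF tendsto_const])
      qed
      show "AE p in \<mu>. norm (indicator {u n<..} (snd p) * D f p) \<le> \<bar>D f p\<bar>" for n
        by (auto simp: indicator_def)
      show "integrable \<mu> (\<lambda>p. \<bar>D f p\<bar>)" using D_int[OF f] by simp
    qed (rule borel_measurable_integrable[OF ind_int[OF f]])+
    then show "(\<lambda>n. F (u n) f) \<longlonglongrightarrow> F s f" unfolding F_def by (intro tendsto_intros)
  qed
  have prod: "(LINT t|lborel. \<zeta> t * F t f) = (LINT p|\<mu>. f (fst p) * \<zeta> (snd p))"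
    if f: "f \<in> smooth_periodic L" and \<zeta>: "smooth \<zeta>" and r: "r < T" "\<And>t. r \<le> \<bar>t\<bar> \<Longrightarrow> \<zeta> t = 0" for f \<zeta> r
  proof -
    have \<zeta>c: "continuous_on UNIV \<zeta>" by (rule smooth_continuous[OF \<zeta>])
    have \<zeta>b: "\<zeta> \<in> borel_measurable borel" by (rule smooth_borel[OF \<zeta>])
    obtain \<kappa>0 where \<kappa>0: "\<And>t. (\<kappa>0 has_real_derivative \<zeta> t) (at t)" using exists_primitive[OF \<zeta>c] by auto
    \<comment> \<open>The primitive of \<open>\<zeta>\<close> that vanishes near \<open>- T\<close>; it is
      constant near \<open>T\<close>.\<close>
    define \<kappa> where "\<kappa> t = \<kappa>0 t - \<kappa>0 (- T)" for t
    have \<kappa>: "(\<kappa> has_real_derivative \<zeta> t) (at t)" for t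
      unfolding \<kappa>_def using DERIV_diff[OF \<kappa>0 DERIV_const] by simp
    have \<kappa>s: "smooth \<kappa>" by (rule smooth_primitive[OF \<kappa> \<zeta>])
    have FTC: "(LINT t|lborel. \<zeta> t * indicator {..<\<tau>} t) = \<kappa> \<tau>" if "- T \<le> \<tau>" for \<tau>
      using integral_step_primitive[OF \<kappa> \<zeta>c r(2,1) that] by (simp add: \<kappa>_def)
    define c where "c = \<kappa> T"
    have const: "\<kappa> a = \<kappa> b" if "a \<le> b" "b \<le> - r \<or> r \<le> a" for a b
    proof (cases "a = b")
      case False
      then have "\<exists>z. a < z \<and> z < b \<and> \<kappa> b - \<kappa> a = (b - a) * \<zeta> z"
        using that(1) \<kappa> by (intro MVT2) auto
      then show ?thesis using that(2) r(2) by (auto simp: abs_if)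
    qed simp
    have \<kappa>_lo: "\<kappa> t = 0" if t: "t \<le> - r" for t
    proof -
      have "\<kappa> t = \<kappa> (- T)"
      proof (cases "t \<le> - T")
        case True then show ?thesis by (rule const) (use r(1) in simp)
      next
        case False then show ?thesis by (intro const[symmetric]) (use t in auto)
      qed
      then show ?thesis by (simp add: \<kappa>_def)
    qed
    have \<kappa>_hi: "\<kappa> t = c" if t: "r \<le> t" for t
    proof (cases "t \<le> T")
      case True then show ?thesis unfolding c_def by (rule const) (use t in simp)
    next
      case False then show ?thesis unfolding c_def by (intro const[symmetric]) (use r(1) in auto)
    qed
    have key: "c * E f - (LINT p|\<mu>. \<kappa> (snd p) * D f p) = (LINT p|\<mu>. \<zeta> (snd p) * f (fst p))"
      using E_step[OF f \<kappa>s \<zeta> \<kappa> r(1) \<kappa>_lo \<kappa>_hi] by simp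
    have \<zeta>_supp: "\<bar>t\<bar> < T" if "\<zeta> t \<noteq> 0" for t
      using r(2)[of t] r(1) that by linarith
    have \<zeta>_int: "integrable lborel \<zeta>"
    proof -
      have "set_integrable lborel {-T..T} \<zeta>"
        by (rule borel_integrable_atLeastAtMost') (rule continuous_on_subset[OF \<zeta>c], simp)
      moreover have "(\<lambda>t. indicator {-T..T} t *\<^sub>R \<zeta> t) = \<zeta>"
        using \<zeta>_supp by (force simp: fun_eq_iff indicator_def)
      ultimately show ?thesis by (simp add: set_integrable_def)
    qed
    have \<zeta>_total: "(LINT t|lborel. \<zeta> t) = c"
    proof -
      have "(LINT t|lborel. \<zeta> t) = (LINT t|lborel. \<zeta> t * indicator {..<T} t)"
        using \<zeta>_supp by (intro Bochner_Integration.integral_cong) (force simp: indicator_def)+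
      then show ?thesis using FTC[of T] T by (simp add: c_def)
    qed
    note \<mu>_measurable_integral = borel_measurable_lebesgue_integral
    interpret pair_sigma_finite lborel \<mu>
      by (intro pair_sigma_finite.intro lborel.sigma_finite_measure_axioms sigma_finite_measure_axioms)
    \<comment> \<open>Integrating \<open>\<zeta> t 1\<^bsub>t < \<tau>\<^esub>\<close> in \<open>t\<close>
      gives \<open>\<kappa> \<tau>\<close>.\<close>
    have fubini: "integrable (lborel \<Otimes>\<^sub>M \<mu>) (case_prod (\<lambda>t p. \<zeta> t * (indicator {t<..} (snd p) * D f p)))"
    proof (rule Fubini_integrable)
      have [measurable]: "D f \<in> borel_measurable \<mu>" "(snd :: _ \<Rightarrow> real) \<in> borel_measurable \<mu>" "\<zeta> \<in> borel_measurable lborel"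
        using D_int[OF f] snd_measurable[of "\<lambda>t. t"] \<zeta>b by auto
      have "(\<lambda>q. \<zeta> (fst q) * ((if fst q < snd (snd q) then 1 else 0) * D f (snd q))) \<in> borel_measurable (lborel \<Otimes>\<^sub>M \<mu>)"
        by measurable
      also have "(\<lambda>q. \<zeta> (fst q) * ((if fst q < snd (snd q) then 1 else 0) * D f (snd q))) =
          case_prod (\<lambda>t p. \<zeta> t * (indicator {t<..} (snd p) * D f p))"
        by (auto simp: fun_eq_iff)
      finally show m: "case_prod (\<lambda>t p. \<zeta> t * (indicator {t<..} (snd p) * D f p)) \<in> borel_measurable (lborel \<Otimes>\<^sub>M \<mu>)" .
      show "AE t in lborel. integrable \<mu> (\<lambda>p. case (t, p) of (t, p) \<Rightarrow> \<zeta> t * (indicator {t<..} (snd p) * D f p))"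
        using ind_int[OF f] by (auto intro!: integrable_mult_right)
      show "integrable lborel (\<lambda>t. LINT p|\<mu>. norm (case (t, p) of (t, p) \<Rightarrow> \<zeta> t * (indicator {t<..} (snd p) * D f p)))"
      proof (rule Bochner_Integration.integrable_bound[where f = "\<lambda>t. \<zeta> t * (LINT p|\<mu>. \<bar>D f p\<bar>)"])
        show "integrable lborel (\<lambda>t. \<zeta> t * (LINT p|\<mu>. \<bar>D f p\<bar>))" using \<zeta>_int by simp
        show "(\<lambda>t. LINT p|\<mu>. norm (case (t, p) of (t, p) \<Rightarrow> \<zeta> t * (indicator {t<..} (snd p) * D f p))) \<in> borel_measurable lborel"
        proof -
          have "case_prod (\<lambda>t p. norm (\<zeta> t * (indicator {t<..} (snd p) * D f p))) \<in> borel_measurable (lborel \<Otimes>\<^sub>M \<mu>)"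
            using measurable_compose[OF m borel_measurable_norm] by (simp add: case_prod_unfold)
          from \<mu>_measurable_integral[OF this] show ?thesis by simp
        qed
        show "AE t in lborel. norm (LINT p|\<mu>. norm (case (t, p) of (t, p) \<Rightarrow> \<zeta> t * (indicator {t<..} (snd p) * D f p)))
            \<le> norm (\<zeta> t * (LINT p|\<mu>. \<bar>D f p\<bar>))"
        proof (rule AE_I2)
          fix t
          have "(LINT p|\<mu>. \<bar>\<zeta> t * (indicator {t<..} (snd p) * D f p)\<bar>) \<le> (LINT p|\<mu>. \<bar>\<zeta> t\<bar> * \<bar>D f p\<bar>)"
            using ind_int[OF f, of t] D_int[OF f]
            by (intro integral_mono integrable_abs integrable_mult_right) (auto simp: abs_mult indicator_def)
          then show "norm (LINT p|\<mu>. norm (case (t, p) of (t, p) \<Rightarrow> \<zeta> t * (indicator {t<..} (snd p) * D f p)))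
            \<le> norm (\<zeta> t * (LINT p|\<mu>. \<bar>D f p\<bar>))"
            by (simp add: abs_mult)
        qed
      qed
    qed
    have "(LINT t|lborel. (LINT p|\<mu>. \<zeta> t * (indicator {t<..} (snd p) * D f p))) =
        (LINT p|\<mu>. (LINT t|lborel. \<zeta> t * (indicator {t<..} (snd p) * D f p)))"
      by (rule Fubini_integral[OF fubini, symmetric])
    also have "\<dots> = (LINT p|\<mu>. \<kappa> (snd p) * D f p)"
    proof (intro Bochner_Integration.integral_cong refl)
      fix p assume "p \<in> space \<mu>"
      then have "- T \<le> snd p" by (auto simp: transport_measure(3) QLT_def)
      have "(LINT t|lborel. \<zeta> t * (indicator {t<..} (snd p) * D f p)) = (LINT t|lborel. (\<zeta> t * indicator {..<snd p} t) * D f p)"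
        by (intro Bochner_Integration.integral_cong) (auto simp: indicator_def)
      then show "(LINT t|lborel. \<zeta> t * (indicator {t<..} (snd p) * D f p)) = \<kappa> (snd p) * D f p"
        using FTC[OF \<open>- T \<le> snd p\<close>] by simp
    qed
    finally have swap: "(LINT t|lborel. \<zeta> t * (LINT p|\<mu>. indicator {t<..} (snd p) * D f p)) = (LINT p|\<mu>. \<kappa> (snd p) * D f p)"
      by simp
    have int2: "integrable lborel (\<lambda>t. \<zeta> t * (LINT p|\<mu>. indicator {t<..} (snd p) * D f p))"
      using integrable_fst[OF fubini] by simp
    have "(LINT t|lborel. \<zeta> t * F t f) = (LINT t|lborel. \<zeta> t * E f - \<zeta> t * (LINT p|\<mu>. indicator {t<..} (snd p) * D f p))"
      by (simp add: F_def right_diff_distrib)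
    also have "\<dots> = c * E f - (LINT p|\<mu>. \<kappa> (snd p) * D f p)"
      using \<zeta>_int int2 by (simp add: swap \<zeta>_total)
    also have "\<dots> = (LINT p|\<mu>. f (fst p) * \<zeta> (snd p))" using key by (simp add: mult.commute)
    finally show ?thesis .
  qed
  show thesis using that[of F] lin pos const cont prod by blast
qed

end

section \<open>Weakly continuous slices\<close>

lemma weakly_continuous_smooth_integral:
  "weakly_continuous L T \<rho> \<Longrightarrow> f \<in> smooth_periodic L \<Longrightarrow> continuous_on {-T..T} (\<lambda>t. LINT x|\<rho> t. f x)"
  unfolding weakly_continuous_def using smooth_periodicD by blast

text \<open>
  The measure of a set of positivity is a limit of integrals that are continuous in
  \<open>t\<close>; a monotone class argument extends measurability to all Borel sets.
\<close>

lemma kernel_from_smooth_integrals: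
  assumes L: "0 < L"
    and \<rho>: "\<And>t. t \<in> {-T..T} \<Longrightarrow> \<rho> t \<in> pos_measures (borel_QL L)"
    and cont: "\<And>f. f \<in> smooth_periodic L \<Longrightarrow> continuous_on {-T..T} (\<lambda>t. LINT x|\<rho> t. f x)"
  shows "kernel_on L T \<rho>"
  unfolding kernel_on_def
proof (intro conjI ballI)
  let ?R = "restrict_space borel {-T..T}"
  let ?\<F> = "{f \<in> smooth_periodic L. \<forall>x. 0 \<le> f x}"
  let ?E = "(\<lambda>f. {x \<in> QL L. 0 < f x}) ` ?\<F>"
  note \<rho>s = pos_measuresD[OF \<rho>]
  have spR: "t \<in> {-T..T}" if "t \<in> space ?R" for t using that by (simp add: space_restrict_space)
  have emeas_basic: "(\<lambda>t. emeasure (\<rho> t) {x \<in> QL L. 0 < f x}) \<in> borel_measurable ?R"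
    if f: "f \<in> smooth_periodic L" for f
  proof -
    have lim: "(\<lambda>t. measure (\<rho> t) {x \<in> QL L. 0 < f x}) \<in> borel_measurable ?R"
    proof (rule borel_measurable_LIMSEQ_real)
      fix n :: nat
      have "(\<lambda>x. exp_flat (real n * f x)) \<in> smooth_periodic L"
        by (intro smooth_periodic_compose[OF smooth_exp_flat] smooth_periodic_mult smooth_periodic_const f)
      then show "(\<lambda>t. LINT x|\<rho> t. exp_flat (real n * f x)) \<in> borel_measurable ?R"
        by (intro borel_measurable_continuous_on_restrict cont)
    next
      fix t assume "t \<in> space ?R"
      note t = spR[OF this]
      have "f \<in> borel_measurable (\<rho> t)"
        by (intro \<rho>s(4)[OF t] measurable_restrict_space1 smooth_periodic_borel[OF f])
      from integral_exp_flat_LIMSEQ[OF \<rho>s(2)[OF t] this]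
      show "(\<lambda>n. LINT x|\<rho> t. exp_flat (real n * f x)) \<longlonglongrightarrow> measure (\<rho> t) {x \<in> QL L. 0 < f x}"
        using \<rho>s(3)[OF t] by simp
    qed
    have "(\<lambda>t. ennreal (measure (\<rho> t) {x \<in> QL L. 0 < f x})) \<in> borel_measurable ?R" using lim by measurable
    then show ?thesis
      by (rule measurable_cong[THEN iffD1, rotated])
        (simp add: finite_measure.emeasure_eq_measure[OF \<rho>s(2)[OF spR]])
  qed
  have st: "Int_stable ?E"
    by (rule Int_stable_positivity_sets) (auto intro: smooth_periodic_mult)
  have sub: "?E \<subseteq> Pow (QL L)" by auto
  have top: "QL L \<in> sets (borel_QL L)" by (simp add: sets_borel_QL)
  have whole: "(\<lambda>t. emeasure (\<rho> t) (QL L)) \<in> borel_measurable ?R"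
    using emeas_basic[OF smooth_periodic_const[of 1]] by simp
  fix B assume "B \<in> sets (borel_QL L)"
  then have "B \<in> sigma_sets (QL L) ?E" using sets_borel_QL_generated[OF L] by simp
  then show "(\<lambda>t. emeasure (\<rho> t) B) \<in> borel_measurable ?R"
  proof (induction rule: sigma_sets_induct_disjoint[OF st sub, consumes 1, case_names basic empty compl union])
    case (basic A) then show ?case using emeas_basic by auto
  next
    case empty show ?case by simp
  next
    case (compl A)
    then have A: "A \<in> sets (borel_QL L)" using sets_borel_QL_generated[OF L] by simp
    have "(\<lambda>t. emeasure (\<rho> t) (QL L) - emeasure (\<rho> t) A) \<in> borel_measurable ?R"
      using whole compl by measurable
    moreover have "emeasure (\<rho> t) (QL L) - emeasure (\<rho> t) A = emeasure (\<rho> t) (QL L - A)" if "t \<in> space ?R" for t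
    proof -
      note t = spR[OF that]
      interpret finite_measure "\<rho> t" by (rule \<rho>s(2)[OF t])
      show ?thesis
        using A top \<rho>s(1)[OF t] by (intro emeasure_Diff[symmetric]) (auto simp: sets_borel_QL)
    qed
    ultimately show ?case by (rule measurable_cong[THEN iffD1, rotated]) auto
  next
    case (union A)
    then have A: "A i \<in> sets (borel_QL L)" for i using sets_borel_QL_generated[OF L] by auto
    have "(\<lambda>t. \<Sum>i. emeasure (\<rho> t) (A i)) \<in> borel_measurable ?R"
      using union by (intro borel_measurable_suminf_order) auto
    moreover have "(\<Sum>i. emeasure (\<rho> t) (A i)) = emeasure (\<rho> t) (\<Union>i. A i)" if "t \<in> space ?R" for t
      using A \<rho>s(1)[OF spR[OF that]] union by (intro suminf_emeasure) auto
    ultimately show ?case by (rule measurable_cong[THEN iffD1, rotated]) auto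
  qed
qed (use \<rho> in auto)

text \<open>
  Continuous periodic functions are uniform limits of smooth ones, and the masses of the slices are
  bounded.
\<close>

lemma weakly_continuous_from_smooth:
  assumes L: "0 < L"
    and \<rho>: "\<And>t. t \<in> {-T..T} \<Longrightarrow> \<rho> t \<in> pos_measures (borel_QL L)"
    and cont: "\<And>f. f \<in> smooth_periodic L \<Longrightarrow> continuous_on {-T..T} (\<lambda>t. LINT x|\<rho> t. f x)"
    and mass: "\<And>t. t \<in> {-T..T} \<Longrightarrow> measure (\<rho> t) (QL L) \<le> M"
  shows "weakly_continuous L T \<rho>"
  unfolding weakly_continuous_def
proof (intro allI impI)
  fix g :: "real^2 \<Rightarrow> real" assume g: "continuous_on UNIV g" "periodic L g"
  note \<rho>s = pos_measuresD[OF \<rho>]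
  have "\<exists>h. h \<in> smooth_periodic L \<and> (\<forall>x. \<bar>g x - h x\<bar> < 1 / real (Suc n))" for n
    by (rule smooth_periodic_dense[OF L g(2,1), of "1 / real (Suc n)"]) auto
  then obtain h where h: "\<And>n. h n \<in> smooth_periodic L" "\<And>n x. \<bar>g x - h n x\<bar> < 1 / real (Suc n)" by metis
  have int: "integrable (\<rho> t) f" if t: "t \<in> {-T..T}" and f: "continuous_on UNIV f" "periodic L f" for t and f :: "real^2 \<Rightarrow> real"
  proof -
    interpret finite_measure "\<rho> t" by (rule \<rho>s(2)[OF t])
    obtain K where K: "\<And>x. \<bar>f x\<bar> \<le> K" using periodic_bounded[OF L f(2,1)] by blast
    show ?thesis
      by (rule integrable_const_bound[where B = K])
        (use K in \<open>auto intro!: \<rho>s(4)[OF t] measurable_restrict_space1 borel_measurable_continuous_onI f\<close>)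
  qed
  show "continuous_on {-T..T} (\<lambda>t. LINT x|\<rho> t. g x)"
  proof (rule uniform_limit_theorem[where F = sequentially and f = "\<lambda>n t. LINT x|\<rho> t. h n x"])
    show "uniform_limit {-T..T} (\<lambda>n t. LINT x|\<rho> t. h n x) (\<lambda>t. LINT x|\<rho> t. g x) sequentially"
    proof (rule uniform_limitI)
      fix e :: real assume e: "0 < e"
      have "(\<lambda>n. \<bar>M\<bar> * (1 / real (Suc n))) \<longlonglongrightarrow> \<bar>M\<bar> * 0"
        by (intro tendsto_intros LIMSEQ_Suc lim_const_over_n)
      then have "eventually (\<lambda>n. \<bar>M\<bar> * (1 / real (Suc n)) < e) sequentially"
        using e by (intro order_tendstoD(2)) auto
      then show "\<forall>\<^sub>F n in sequentially. \<forall>t\<in>{-T..T}. dist (LINT x|\<rho> t. h n x) (LINT x|\<rho> t. g x) < e"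
      proof eventually_elim
        case (elim n)
        show ?case
        proof
          fix t assume t: "t \<in> {-T..T}"
          interpret finite_measure "\<rho> t" by (rule \<rho>s(2)[OF t])
          have ig: "integrable (\<rho> t) g" and ih: "integrable (\<rho> t) (h n)"
            using int[OF t g] int[OF t smooth_periodicD(3)[OF h(1)] smooth_periodicD(2)[OF h(1)]] by auto
          have "\<bar>(LINT x|\<rho> t. h n x) - (LINT x|\<rho> t. g x)\<bar> = \<bar>LINT x|\<rho> t. h n x - g x\<bar>" using ig ih by simp
          also have "\<dots> \<le> (LINT x|\<rho> t. \<bar>h n x - g x\<bar>)" by (rule integral_abs_bound)
          also have "\<dots> \<le> (LINT x|\<rho> t. 1 / real (Suc n))"
            using ig ih h(2) by (intro integral_mono) (auto simp: abs_minus_commute intro: less_imp_le)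
          also have "\<dots> = measure (\<rho> t) (QL L) * (1 / real (Suc n))" using \<rho>s(3)[OF t] by simp
          also have "\<dots> \<le> \<bar>M\<bar> * (1 / real (Suc n))" using mass[OF t] by (intro mult_right_mono) auto
          also have "\<dots> < e" by (rule elim)
          finally show "dist (LINT x|\<rho> t. h n x) (LINT x|\<rho> t. g x) < e" by (simp add: dist_real_def)
        qed
      qed
    qed
    show "\<forall>\<^sub>F n in sequentially. continuous_on {-T..T} (\<lambda>t. LINT x|\<rho> t. h n x)"
      using cont[OF h(1)] by simp
  qed simp
qed

context transport
begin

text \<open>
  The slices come from the Riesz theorem applied to \<open>F s\<close>. They disintegrate some
  measure on space-time, and this measure is \<open>\<mu>\<close> because both have the same
  integrals against products of functions of space and cutoffs in time.
\<close>

theorem weakly_continuous_disintegration_exists: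
  "\<exists>\<rho>. disintegration L T \<mu> \<rho> \<and> weakly_continuous L T \<rho>"
proof -
  obtain F :: "real \<Rightarrow> (real^2 \<Rightarrow> real) \<Rightarrow> real" where F:
    "\<And>s. linear_functional_on (smooth_periodic L) (F s)"
    "\<And>s f. s \<in> {-T..T} \<Longrightarrow> f \<in> smooth_periodic L \<Longrightarrow> (\<And>x. 0 \<le> f x) \<Longrightarrow> 0 \<le> F s f"
    "\<And>s. F s (\<lambda>_. 1) = F 0 (\<lambda>_. 1)"
    "\<And>f. f \<in> smooth_periodic L \<Longrightarrow> continuous_on UNIV (\<lambda>s. F s f)"
    "\<And>f \<zeta> r. f \<in> smooth_periodic L \<Longrightarrow> smooth \<zeta> \<Longrightarrow> r < T \<Longrightarrow> (\<And>t. r \<le> \<bar>t\<bar> \<Longrightarrow> \<zeta> t = 0) \<Longrightarrow>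
       (LINT t|lborel. \<zeta> t * F t f) = (LINT p|\<mu>. f (fst p) * \<zeta> (snd p))"
    by (fact trace_functional)
  have "\<exists>\<rho>. \<rho> \<in> pos_measures (borel_QL L) \<and> (\<forall>f\<in>smooth_periodic L. (LINT x|\<rho>. f x) = F s f)"
    if "s \<in> {-T..T}" for s
    by (rule riesz_torus[OF L F(1) F(2)[OF that]]) blast+
  then have "\<forall>s\<in>{-T..T}. \<exists>\<rho>. \<rho> \<in> pos_measures (borel_QL L) \<and> (\<forall>f\<in>smooth_periodic L. (LINT x|\<rho>. f x) = F s f)"
    by blast
  from bchoice[OF this] obtain \<rho> where \<rho>:
    "\<And>s. s \<in> {-T..T} \<Longrightarrow> \<rho> s \<in> pos_measures (borel_QL L)"
    "\<And>s f. s \<in> {-T..T} \<Longrightarrow> f \<in> smooth_periodic L \<Longrightarrow> (LINT x|\<rho> s. f x) = F s f" by blast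
  note \<rho>s = pos_measuresD[OF \<rho>(1)]
  have cont: "continuous_on {-T..T} (\<lambda>t. LINT x|\<rho> t. f x)" if f: "f \<in> smooth_periodic L" for f
    by (rule continuous_on_eq[OF continuous_on_subset[OF F(4)[OF f]]]) (use \<rho>(2) f in auto)
  have mass: "measure (\<rho> t) (QL L) = F 0 (\<lambda>_. 1)" if t: "t \<in> {-T..T}" for t
    using \<rho>(2)[OF t smooth_periodic_const[of 1]] \<rho>s(3)[OF t] F(3)[of t] by simp
  have wc: "weakly_continuous L T \<rho>"
    by (rule weakly_continuous_from_smooth[OF L \<rho>(1) cont]) (use mass in auto)
  have ker: "kernel_on L T \<rho>" by (rule kernel_from_smooth_integrals[OF L \<rho>(1) cont])
  have emass: "emeasure (\<rho> t) (QL L) \<le> ennreal (F 0 (\<lambda>_. 1))" if t: "t \<in> {-T..T}" for t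
    using finite_measure.emeasure_eq_measure[OF \<rho>s(2)[OF t]] mass[OF t] by simp
  obtain N where N: "N \<in> pos_measures (borel_QLT L T)" "disintegration L T N \<rho>"
    using measure_of_kernel[OF L ker emass] by blast
  have "N = \<mu>"
  proof (rule measure_eqI_product_cutoffs[OF L T N(1) \<mu>])
    fix h assume h: "h \<in> product_cutoffs L T"
    then obtain f \<zeta> r where fz: "h = (\<lambda>p. f (fst p) * \<zeta> (snd p))" "f \<in> smooth_periodic L"
       "smooth \<zeta>" "r < T" "\<forall>t. r \<le> \<bar>t\<bar> \<longrightarrow> \<zeta> t = 0"
      unfolding product_cutoffs_def by blast
    obtain K where K: "\<And>x. \<bar>f x\<bar> \<le> K" using periodic_bounded[OF L smooth_periodicD(2)[OF fz(2)] smooth_periodicD(3)[OF fz(2)]] by blast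
    obtain K1 where K1: "0 \<le> K1" "\<And>t. t \<in> {-T..T} \<Longrightarrow> \<bar>\<zeta> t\<bar> \<le> K1"
      by (rule continuous_compact_bound[OF compact_Icc smooth_continuous[OF fz(3)]]) blast
    have K': "\<bar>\<zeta> t\<bar> \<le> K1" for t
    proof (cases "t \<in> {-T..T}")
      case True then show ?thesis by (rule K1(2))
    next
      case False
      then have "r \<le> \<bar>t\<bar>" using fz(4) by (auto simp: abs_if)
      then show ?thesis using fz(5) K1(1) by simp
    qed
    have "\<bar>h p\<bar> \<le> K * K1" for p
      unfolding fz(1) abs_mult using K[of "fst p"] K'[of "snd p"] by (intro mult_mono) auto
    from integral_disintegration(2)[OF L N(1,2) product_cutoffs_borel[OF h] this]
    have "(LINT p|N. h p) = (LINT t:{-T<..<T}|lborel. (LINT x|\<rho> t. f x * \<zeta> t))" by (simp add: fz(1))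
    also have "\<dots> = (LINT t|lborel. \<zeta> t * F t f)"
      unfolding set_lebesgue_integral_def
    proof (intro Bochner_Integration.integral_cong refl)
      fix t
      show "indicator {-T<..<T} t *\<^sub>R (LINT x|\<rho> t. f x * \<zeta> t) = \<zeta> t * F t f"
      proof (cases "t \<in> {-T<..<T}")
        case True then show ?thesis using \<rho>(2)[OF _ fz(2), of t] by simp
      next
        case False
        then have "r \<le> \<bar>t\<bar>" using fz(4) by (auto simp: abs_if)
        then show ?thesis using False fz(5) by simp
      qed
    qed
    also have "\<dots> = (LINT p|\<mu>. h p)"
      unfolding fz(1) by (rule F(5)[OF fz(2,3,4)]) (use fz(5) in auto)
    finally show "(LINT p|N. h p) = (LINT p|\<mu>. h p)" .
  qed
  then show ?thesis using N(2) wc by blast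
qed

text \<open>
  The choice in the definition of \<open>slices\<close> is made among weakly continuous
  disintegrations, as there is one.
\<close>

lemma slices_weakly_continuous:
  "disintegration L T \<mu> (slices L T \<mu>)" "weakly_continuous L T (slices L T \<mu>)"
proof -
  let ?P = "\<lambda>\<sigma>. disintegration L T \<mu> \<sigma> \<and>
     ((\<exists>\<rho>. disintegration L T \<mu> \<rho> \<and> weakly_continuous L T \<rho>) \<longrightarrow> weakly_continuous L T \<sigma>)"
  obtain \<rho> where "disintegration L T \<mu> \<rho> \<and> weakly_continuous L T \<rho>"
    using weakly_continuous_disintegration_exists by blast
  then have "?P \<rho>" by blast
  from someI[of ?P, OF this] have "?P (slices L T \<mu>)" unfolding slices_def .
  then show "disintegration L T \<mu> (slices L T \<mu>)" "weakly_continuous L T (slices L T \<mu>)"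
    using weakly_continuous_disintegration_exists by blast+
qed

end

lemma smooth_slice:
  fixes \<phi> :: "(real^2) \<times> real \<Rightarrow> real"
  assumes "smooth \<phi>"
  shows "smooth (\<lambda>x. \<phi> (x, t))"
proof -
  have "Ck_fun k (\<lambda>x. \<psi> (x, t))" if "Ck_fun k \<psi>" for k and \<psi> :: "(real^2) \<times> real \<Rightarrow> real"
    using that
  proof (induction k arbitrary: \<psi>)
    case 0
    then have "continuous_on UNIV \<psi>" by simp
    then have "continuous_on UNIV (\<lambda>x. \<psi> (x, t))"
      by (rule continuous_on_compose2) (auto intro: continuous_intros)
    then show ?case by simp
  next
    case (Suc k)
    show ?case
    proof (rule Ck_fun_SucI)
      show "((\<lambda>x. \<psi> (x, t)) has_derivative (\<lambda>h. frechet_derivative \<psi> (at (x, t)) (h, 0))) (at x)" for x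
        by (rule has_derivative_compose[OF has_derivative_Pair[OF has_derivative_ident has_derivative_const]
              Ck_fun_Suc_has_derivative[OF Suc.prems]])
      show "Ck_fun k (\<lambda>x. frechet_derivative \<psi> (at (x, t)) (h, 0))" for h
        by (rule Suc.IH) (use Suc.prems in auto)
    qed
  qed
  then show ?thesis using assms by (simp add: smooth_def)
qed

text \<open>
  The integrand changes with time as well, but uniformly so on the compact square.
\<close>

lemma slice_integral_continuous:
  assumes L: "0 < L" and wc: "weakly_continuous L T \<rho>" and ker: "kernel_on L T \<rho>"
    and \<phi>: "smooth \<phi>" "\<And>t. periodic L (\<lambda>x. \<phi> (x, t))"
  shows "continuous_on {-T..T} (\<lambda>t. LINT x|\<rho> t. \<phi> (x, t))"
  unfolding continuous_on_sequentially comp_def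
proof (intro allI ballI impI, elim conjE)
  fix u :: "nat \<Rightarrow> real" and s assume s: "s \<in> {-T..T}" and u: "\<forall>n. u n \<in> {-T..T}" "u \<longlonglongrightarrow> s"
  note ks = kernel_onD[OF ker]
  have sl: "(\<lambda>x. \<phi> (x, t)) \<in> smooth_periodic L" for t
    by (intro smooth_periodicI smooth_slice \<phi>)
  have c1: "continuous_on {-T..T} (\<lambda>t. LINT x|\<rho> t. (1::real))"
    by (rule weakly_continuous_smooth_integral[OF wc smooth_periodic_const])
  have mass: "(LINT x|\<rho> t. (1::real)) = measure (\<rho> t) (QL L)" if "t \<in> {-T..T}" for t
    using ks(3)[OF that] by simp
  obtain C where C0: "0 \<le> C" and C1: "\<And>t. t \<in> {-T..T} \<Longrightarrow> \<bar>LINT x|\<rho> t. (1::real)\<bar> \<le> C"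
    by (rule continuous_compact_bound[OF compact_Icc c1]) blast
  have C: "measure (\<rho> t) (QL L) \<le> C" if "t \<in> {-T..T}" for t
    using C1[OF that] unfolding mass[OF that] by simp
  have int: "integrable (\<rho> t) (\<lambda>x. \<phi> (x, t'))" if t: "t \<in> {-T..T}" for t t'
  proof -
    interpret finite_measure "\<rho> t" by (rule ks(2)[OF t])
    obtain K where K: "\<And>x. \<bar>\<phi> (x, t')\<bar> \<le> K" using periodic_bounded[OF L smooth_periodicD(2)[OF sl] smooth_periodicD(3)[OF sl]] by blast
    show ?thesis
      by (rule integrable_const_bound[where B = K])
        (use K in \<open>auto intro!: kernel_borel_measurable[OF ker t] smooth_periodic_borel sl\<close>)
  qed
  have "(\<lambda>n. (LINT x|\<rho> (u n). \<phi> (x, u n)) - (LINT x|\<rho> (u n). \<phi> (x, s))) \<longlonglongrightarrow> 0"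
  proof (rule LIMSEQ_I)
    fix e :: real assume e: "0 < e"
    define e' where "e' = e / (C + 1)"
    have e': "0 < e'" using e C0 by (simp add: e'_def)
    have "uniformly_continuous_on (square L \<times> {-T..T}) \<phi>"
      by (intro compact_uniformly_continuous smooth_continuous \<phi> compact_Times compact_square compact_Icc)
    then obtain d where d: "0 < d" "\<And>p p'. p \<in> square L \<times> {-T..T} \<Longrightarrow> p' \<in> square L \<times> {-T..T} \<Longrightarrow> dist p' p < d \<Longrightarrow> dist (\<phi> p') (\<phi> p) < e'"
      using e' unfolding uniformly_continuous_on_def by blast
    obtain N where N: "\<And>n. N \<le> n \<Longrightarrow> dist (u n) s < d"
      using u(2) d(1) unfolding lim_sequentially by blast
    have "norm ((LINT x|\<rho> (u n). \<phi> (x, u n)) - (LINT x|\<rho> (u n). \<phi> (x, s)) - 0) < e" if n: "N \<le> n" for n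
    proof -
      have un: "u n \<in> {-T..T}" using u(1) by blast
      interpret finite_measure "\<rho> (u n)" by (rule ks(2)[OF un])
      have "\<bar>(LINT x|\<rho> (u n). \<phi> (x, u n)) - (LINT x|\<rho> (u n). \<phi> (x, s))\<bar> = \<bar>LINT x|\<rho> (u n). \<phi> (x, u n) - \<phi> (x, s)\<bar>"
        using int[OF un] by simp
      also have "\<dots> \<le> (LINT x|\<rho> (u n). \<bar>\<phi> (x, u n) - \<phi> (x, s)\<bar>)" by (rule integral_abs_bound)
      also have "\<dots> \<le> (LINT x|\<rho> (u n). e')"
      proof (rule integral_mono)
        fix x assume "x \<in> space (\<rho> (u n))"
        then have x: "x \<in> square L" using ks(3)[OF un] QL_subset_square by auto
        have "dist (\<phi> (x, u n)) (\<phi> (x, s)) < e'"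
          using x un s N[OF n] by (intro d(2)) (auto simp: dist_Pair_Pair)
        then show "\<bar>\<phi> (x, u n) - \<phi> (x, s)\<bar> \<le> e'" by (simp add: dist_real_def)
      qed (use int[OF un] in auto)
      also have "\<dots> = measure (\<rho> (u n)) (QL L) * e'" using ks(3)[OF un] by simp
      also have "\<dots> \<le> C * e'" using C[OF un] e' by (intro mult_right_mono) auto
      also have "\<dots> < e" using e C0 by (simp add: e'_def field_simps)
      finally show ?thesis by simp
    qed
    then show "\<exists>N. \<forall>n\<ge>N. norm ((LINT x|\<rho> (u n). \<phi> (x, u n)) - (LINT x|\<rho> (u n). \<phi> (x, s)) - 0) < e" by blast
  qed
  moreover have "(\<lambda>n. LINT x|\<rho> (u n). \<phi> (x, s)) \<longlonglongrightarrow> (LINT x|\<rho> s. \<phi> (x, s))"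
    using weakly_continuous_smooth_integral[OF wc sl[of s]] s u unfolding continuous_on_sequentially comp_def by blast
  ultimately show "(\<lambda>n. LINT x|\<rho> (u n). \<phi> (x, u n)) \<longlonglongrightarrow> (LINT x|\<rho> s. \<phi> (x, s))"
    using tendsto_add by fastforce
qed

section \<open>The trace formula and bounds for point masses\<close>

text \<open>
  The function \<open>\<beta> y = y exp (- e / y)\<close> for \<open>y > 0\<close>, extended by
  \<open>0\<close>. The bounds \<open>0 \<le> \<beta>' \<le> 1\<close> and \<open>y - e \<le>
  \<beta> y\<close> are both instances of \<open>1 + z \<le> exp z\<close>.
\<close>

lemma soft_positive_part:
  assumes e: "0 < e"
  obtains \<beta> b :: "real \<Rightarrow> real" where "smooth \<beta>" "\<And>y. (\<beta> has_real_derivative b y) (at y)"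
    "\<And>y. 0 \<le> b y" "\<And>y. b y \<le> 1" "\<beta> 0 = 0" "\<And>y. 0 \<le> \<beta> y" "\<And>y. y - e \<le> \<beta> y"
proof -
  define \<beta> where "\<beta> y = y * exp_flat (y / e)" for y
  define b where "b y = (if 0 < y then exp (- e / y) * (1 + e / y) else 0)" for y
  have s1: "smooth (\<lambda>y. exp_flat (y / e))"
    using smooth_compose_linear[OF bounded_linear_divide smooth_exp_flat] .
  have s: "smooth \<beta>" unfolding \<beta>_def by (intro smooth_mult s1 smooth_linear bounded_linear_ident)
  have \<beta>_eq: "\<beta> y = (if 0 < y then y * exp (- e / y) else 0)" for y
    using e by (auto simp: \<beta>_def exp_flat_def zero_less_divide_iff)
  have der: "(\<beta> has_real_derivative b y) (at y)" for y
  proof -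
    consider "0 < y" | "y = 0" | "y < 0" by linarith
    then show ?thesis
    proof cases
      case 1
      have "((\<lambda>y. y * exp (- e / y)) has_real_derivative exp (- e / y) * (1 + e / y)) (at y)"
        using 1 by (auto intro!: derivative_eq_intros simp: power2_eq_square field_simps)
      then have "(\<beta> has_real_derivative exp (- e / y) * (1 + e / y)) (at y)"
        by (rule has_field_derivative_transform_within_open[where S = "{0<..}"]) (use 1 in \<open>auto simp: \<beta>_eq\<close>)
      then show ?thesis using 1 by (simp add: b_def)
    next
      case 3
      have "((\<lambda>_. 0) has_real_derivative 0) (at y)" by simp
      then have "(\<beta> has_real_derivative 0) (at y)"
        by (rule has_field_derivative_transform_within_open[where S = "{..<0}"]) (use 3 in \<open>auto simp: \<beta>_eq\<close>)
      then show ?thesis using 3 by (simp add: b_def)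
    next
      case 2
      have "isCont (\<lambda>y. exp_flat (y / e)) 0"
        using smooth_continuous[OF s1, of UNIV] by (simp add: continuous_on_eq_continuous_at)
      then have "((\<lambda>h. exp_flat (h / e)) \<longlongrightarrow> 0) (at 0)" by (simp add: isCont_def exp_flat_def)
      then have "((\<lambda>h. (\<beta> (0 + h) - \<beta> 0) / h) \<longlongrightarrow> 0) (at 0)"
        by (rule Lim_transform_eventually) (auto simp: eventually_at_filter \<beta>_def)
      then show ?thesis using 2 by (simp add: DERIV_def b_def)
    qed
  qed
  show thesis
  proof
    show "b y \<le> 1" for y
    proof (cases "0 < y")
      case True
      have "exp (- e / y) * (1 + e / y) \<le> exp (- e / y) * exp (e / y)"
        using exp_ge_add_one_self[of "e / y"] by (intro mult_left_mono) auto
      also have "\<dots> = 1" by (simp add: exp_add[symmetric])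
      finally show ?thesis using True by (simp add: b_def)
    qed (simp add: b_def)
    show "y - e \<le> \<beta> y" for y
    proof (cases "0 < y")
      case True
      have "y * (1 + - e / y) \<le> y * exp (- e / y)"
        using exp_ge_add_one_self[of "- e / y"] True by (intro mult_left_mono) auto
      also have "y * exp (- e / y) = \<beta> y" using True by (simp add: \<beta>_eq)
      finally have "y * (1 + - e / y) \<le> \<beta> y" .
      moreover have "y * (1 + - e / y) = y - e" using True by (simp add: field_simps)
      ultimately show ?thesis by simp
    qed (use e in \<open>simp add: \<beta>_eq\<close>)
    show "0 \<le> b y" "0 \<le> \<beta> y" for y using e by (auto simp: b_def \<beta>_eq)
    show "\<beta> 0 = 0" by (simp add: \<beta>_eq)
  qed (rule s der)+
qed

lemma test_functionsI:
  assumes "smooth \<phi>" "\<And>t. periodic L (\<lambda>x. \<phi> (x, t))" "r < T" "\<And>x t. r \<le> \<bar>t\<bar> \<Longrightarrow> \<phi> (x, t) = 0"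
  shows "\<phi> \<in> test_functions L T"
  using assms unfolding test_functions_def smooth_def by blast

lemma test_functions_support:
  assumes "\<phi> \<in> test_functions L T"
  obtains r where "r < T" "\<And>x t. r \<le> \<bar>t\<bar> \<Longrightarrow> \<phi> (x, t) = 0"
  using assms unfolding test_functions_def by blast

lemma test_functions_add:
  assumes "\<phi> \<in> test_functions L T" "\<psi> \<in> test_functions L T"
  shows "(\<lambda>p. \<phi> p + \<psi> p) \<in> test_functions L T"
proof -
  obtain r1 where r1: "r1 < T" "\<And>x t. r1 \<le> \<bar>t\<bar> \<Longrightarrow> \<phi> (x, t) = 0" by (fact test_functions_support[OF assms(1)])
  obtain r2 where r2: "r2 < T" "\<And>x t. r2 \<le> \<bar>t\<bar> \<Longrightarrow> \<psi> (x, t) = 0" by (fact test_functions_support[OF assms(2)])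
  show ?thesis
  proof (rule test_functionsI[where r = "max r1 r2"])
    show "periodic L (\<lambda>x. \<phi> (x, t) + \<psi> (x, t))" for t
      using test_functionsD(2)[OF assms(1), of t] test_functionsD(2)[OF assms(2), of t] by (simp add: periodic_def)
  qed (use r1 r2 test_functionsD(1)[OF assms(1)] test_functionsD(1)[OF assms(2)] in auto)
qed

lemma test_functions_mult:
  assumes \<phi>: "\<phi> \<in> test_functions L T" and \<psi>: "smooth \<psi>" "\<And>t. periodic L (\<lambda>x. \<psi> (x, t))"
  shows "(\<lambda>p. \<psi> p * \<phi> p) \<in> test_functions L T"
proof -
  obtain r where r: "r < T" "\<And>x t. r \<le> \<bar>t\<bar> \<Longrightarrow> \<phi> (x, t) = 0" by (fact test_functions_support[OF \<phi>])
  show ?thesis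
  proof (rule test_functionsI[where r = r])
    show "smooth (\<lambda>p. \<psi> p * \<phi> p)" by (intro smooth_mult \<psi> test_functionsD[OF \<phi>])
    show "periodic L (\<lambda>x. \<psi> (x, t) * \<phi> (x, t))" for t
      using test_functionsD(2)[OF \<phi>, of t] \<psi>(2)[of t] by (simp add: periodic_def)
  qed (use r in auto)
qed

lemma test_functions_cmult: "\<phi> \<in> test_functions L T \<Longrightarrow> (\<lambda>p. c * \<phi> p) \<in> test_functions L T"
  by (rule test_functions_mult) (auto simp: periodic_def)

lemma test_functions_zero: "0 < T \<Longrightarrow> (\<lambda>_. 0) \<in> test_functions L T"
  by (rule test_functionsI[where r = 0]) (auto simp: periodic_def)

lemma test_functions_compose:
  assumes \<phi>: "\<phi> \<in> test_functions L T" and \<beta>: "smooth \<beta>" "\<beta> 0 = 0"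
  shows "(\<lambda>p. \<beta> (\<phi> p)) \<in> test_functions L T"
proof -
  obtain r where r: "r < T" "\<And>x t. r \<le> \<bar>t\<bar> \<Longrightarrow> \<phi> (x, t) = 0" by (fact test_functions_support[OF \<phi>])
  show ?thesis
  proof (rule test_functionsI[where r = r])
    show "smooth (\<lambda>p. \<beta> (\<phi> p))" by (rule smooth_compose[OF \<beta>(1) test_functionsD(1)[OF \<phi>]])
    show "periodic L (\<lambda>x. \<beta> (\<phi> (x, t)))" for t
      using test_functionsD(2)[OF \<phi>, of t] by (simp add: periodic_def)
    show "\<beta> (\<phi> (x, t)) = 0" if "r \<le> \<bar>t\<bar>" for x t using r(2)[OF that] \<beta>(2) by simp
  qed (rule r)
qed

lemma test_functions_bounded:
  assumes L: "0 < L" and \<phi>: "\<phi> \<in> test_functions L T"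
  obtains K where "0 \<le> K" "\<And>p. \<bar>\<phi> p\<bar> \<le> K"
proof -
  obtain r where r: "r < T" "\<forall>x t. r \<le> \<bar>t\<bar> \<longrightarrow> \<phi> (x, t) = 0"
    using \<phi> unfolding test_functions_def by blast
  obtain K where K: "0 \<le> K" "\<And>p. p \<in> QLT L T \<Longrightarrow> \<bar>\<phi> p\<bar> \<le> K"
    using smooth_bounded_QLT[OF test_functionsD(1)[OF \<phi>]] by blast
  have "\<bar>\<phi> (x, t)\<bar> \<le> K" for x t
  proof (cases "\<bar>t\<bar> < T")
    case True
    then show ?thesis
      using K(2)[of "(wrap L x, t)"] wrap_in_QL[OF L] periodic_wrap[OF L test_functionsD(2)[OF \<phi>], of x t]
      by (auto simp: QLT_def abs_less_iff)
  next
    case False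
    then show ?thesis using r K(1) by simp
  qed
  then show thesis using K(1) that[of K] by (metis surj_pair)
qed

lemma point_mass_le_integral:
  fixes f :: "'a \<Rightarrow> real"
  assumes "finite_measure M" "{X} \<in> sets M" "integrable M f" "\<And>x. 0 \<le> f x"
  shows "measure M {X} * f X \<le> (LINT x|M. f x)"
proof -
  interpret finite_measure M by fact
  have "measure M {X} * f X = (LINT x|M. indicator {X} x * f X)" using assms(2) by simp
  also have "\<dots> \<le> (LINT x|M. f x)"
  proof (rule integral_mono)
    show "integrable M (\<lambda>x. indicator {X} x * f X)"
      using assms(2) by (intro integrable_mult_left integrable_real_indicator) (auto simp: less_top[symmetric])
    show "indicator {X} x * f X \<le> f x" for x using assms(4) by (simp add: indicator_def)
  qed (rule assms)
  finally show ?thesis .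
qed

context transport
begin

text \<open>
  The continuity equation is tested with \<open>H \<phi>\<close> for smooth steps \<open>H\<close>
  that increase from \<open>0\<close> to \<open>1\<close> near \<open>s\<close>. The term \<open>H D
  \<phi>\<close> tends to the restriction of \<open>D \<phi>\<close> to the future of
  \<open>s\<close>, and the term \<open>H' \<phi>\<close> to the integral over the slice, by
  continuity of the slices.
\<close>

lemma trace_formula:
  assumes dis: "disintegration L T \<mu> \<rho>" and wc: "weakly_continuous L T \<rho>"
    and \<phi>: "\<phi> \<in> test_functions L T" and s: "s \<in> {-T<..<T}"
  shows "(LINT x|\<rho> s. \<phi> (x, s)) = - (LINT p|\<mu>. indicator {s<..} (snd p) * transport_deriv v \<phi> p)"
proof -
  note ker = disintegration_kernel[OF dis] and \<phi>s = test_functionsD[OF \<phi>]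
  define g where "g t = (LINT x|\<rho> t. \<phi> (x, t))" for t
  have s': "s \<in> {-T..T}" using s by auto
  have gc: "continuous_on {-T..T} g" unfolding g_def
    by (rule slice_integral_continuous[OF L wc ker \<phi>s])
  obtain H \<zeta> :: "nat \<Rightarrow> real \<Rightarrow> real" and r :: "nat \<Rightarrow> real" where H:
    "\<And>n. smooth (H n)" "\<And>n. smooth (\<zeta> n)" "\<And>n t. (H n has_real_derivative \<zeta> n t) (at t)"
    "\<And>n t. 0 \<le> \<zeta> n t" "\<And>n t. 0 \<le> H n t" "\<And>n t. H n t \<le> 1" "\<And>n. r n < T"
    "\<And>n t. t \<le> - r n \<Longrightarrow> H n t = 0" "\<And>n t. r n \<le> t \<Longrightarrow> H n t = 1"
    "\<And>n t. r n \<le> \<bar>t\<bar> \<Longrightarrow> \<zeta> n t = 0" "\<And>n t. \<zeta> n t \<noteq> 0 \<Longrightarrow> \<bar>t - s\<bar> \<le> 2 * T / real (n + 2)"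
    "\<And>t. t < T \<Longrightarrow> (\<lambda>n. H n t) \<longlonglongrightarrow> indicator {s<..} t"
    by (fact time_steps[OF T s'])
  have \<zeta>\<phi>: "(\<lambda>p. \<zeta> n (snd p) * \<phi> p) \<in> test_functions L T" for n
    by (rule test_functions_mult[OF \<phi> smooth_snd[OF H(2)]]) (simp add: periodic_def)
  have H\<phi>: "(\<lambda>p. H n (snd p) * \<phi> p) \<in> test_functions L T" for n
    by (rule test_functions_mult[OF \<phi> smooth_snd[OF H(1)]]) (simp add: periodic_def)
  have HD_int: "integrable \<mu> (\<lambda>p. H n (snd p) * transport_deriv v \<phi> p)" for n
    using H(5,6) by (intro integrable_bounded_mult[where K = 1] integrable_transport_deriv \<phi>s
        snd_measurable smooth_borel H) auto
  have eq: "(LINT p|\<mu>. H n (snd p) * transport_deriv v \<phi> p) = - (LINT p|\<mu>. \<zeta> n (snd p) * \<phi> p)" for n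
  proof -
    have "0 = (LINT p|\<mu>. H n (snd p) * transport_deriv v \<phi> p + \<zeta> n (snd p) * \<phi> p)"
      using weak_eq[OF H\<phi>[of n]] by (simp only: transport_deriv_time_mult[OF H(3) H(1) \<phi>s(1)])
    also have "\<dots> = (LINT p|\<mu>. H n (snd p) * transport_deriv v \<phi> p) + (LINT p|\<mu>. \<zeta> n (snd p) * \<phi> p)"
      by (intro Bochner_Integration.integral_add HD_int integrable_smooth test_functionsD(1)[OF \<zeta>\<phi>])
    finally show ?thesis by simp
  qed
  have lim1: "(\<lambda>n. LINT p|\<mu>. H n (snd p) * transport_deriv v \<phi> p) \<longlonglongrightarrow>
      (LINT p|\<mu>. indicator {s<..} (snd p) * transport_deriv v \<phi> p)"
  proof (rule integral_dominated_convergence[where w = "\<lambda>p. \<bar>transport_deriv v \<phi> p\<bar>"])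
    show "AE p in \<mu>. (\<lambda>n. H n (snd p) * transport_deriv v \<phi> p) \<longlonglongrightarrow> indicator {s<..} (snd p) * transport_deriv v \<phi> p"
      using H(12) transport_measure(3) by (auto simp: QLT_def intro!: AE_I2 tendsto_intros)
    show "AE p in \<mu>. norm (H n (snd p) * transport_deriv v \<phi> p) \<le> \<bar>transport_deriv v \<phi> p\<bar>" for n
      using H(5,6) by (auto simp: abs_mult intro!: AE_I2 mult_left_le_one_le)
    show "integrable \<mu> (\<lambda>p. \<bar>transport_deriv v \<phi> p\<bar>)" using integrable_transport_deriv[OF \<phi>s(1)] by simp
    show "(\<lambda>p. indicator {s<..} (snd p) * transport_deriv v \<phi> p) \<in> borel_measurable \<mu>"
      by (intro borel_measurable_times snd_measurable borel_measurable_integrable[OF integrable_transport_deriv[OF \<phi>s(1)]]) simp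
  qed (rule borel_measurable_integrable[OF HD_int])
  have dis_eq: "set_integrable lborel {-T<..<T} (\<lambda>t. \<zeta> n t * g t)"
      "(LINT p|\<mu>. \<zeta> n (snd p) * \<phi> p) = (LINT t:{-T<..<T}|lborel. \<zeta> n t * g t)" for n
  proof -
    obtain K where K: "\<And>p. \<bar>\<zeta> n (snd p) * \<phi> p\<bar> \<le> K" using test_functions_bounded[OF L \<zeta>\<phi>] by blast
    show "set_integrable lborel {-T<..<T} (\<lambda>t. \<zeta> n t * g t)"
      "(LINT p|\<mu>. \<zeta> n (snd p) * \<phi> p) = (LINT t:{-T<..<T}|lborel. \<zeta> n t * g t)"
      using integral_disintegration[OF L \<mu> dis smooth_borel[OF test_functionsD(1)[OF \<zeta>\<phi>[of n]]] K]
      by (simp_all add: g_def)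
  qed
  have \<zeta>_int: "set_integrable lborel {-T<..<T} (\<zeta> n)" for n
  proof -
    have "set_integrable lborel {-T..T} (\<zeta> n)"
      by (rule borel_integrable_atLeastAtMost'[OF smooth_continuous[OF H(2)]])
    then show ?thesis by (rule set_integrable_subset) auto
  qed
  have \<zeta>_total: "(LINT t:{-T<..<T}|lborel. \<zeta> n t) = 1" for n
  proof -
    have "(LINT t:{-T<..<T}|lborel. \<zeta> n t) = (LINT t|lborel. \<zeta> n t * indicator {..<T} t)"
      unfolding set_lebesgue_integral_def
    proof (intro Bochner_Integration.integral_cong refl)
      fix t
      have "\<zeta> n t = 0" if "t \<le> - T" using that H(7)[of n] by (intro H(10)) auto
      then show "indicat_real {-T<..<T} t *\<^sub>R \<zeta> n t = \<zeta> n t * indicat_real {..<T} t"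
        by (auto simp: indicator_def)
    qed
    also have "\<dots> = H n T - H n (- T)"
      by (rule integral_step_primitive[OF H(3) smooth_continuous[OF H(2)] H(10) H(7)]) (use T in auto)
    also have "\<dots> = 1" using H(8)[of "- T" n] H(9)[of n T] H(7)[of n] by simp
    finally show ?thesis .
  qed
  have \<zeta>_mass: "(LINT t:{-T<..<T}|lborel. \<zeta> n t * c) = c" for n c using \<zeta>_total[of n] by simp
  \<comment> \<open>The bumps have mass \<open>1\<close> and concentrate at \<open>s\<close>, where
    \<open>g\<close> is continuous.\<close>
  have lim2: "(\<lambda>n. LINT t:{-T<..<T}|lborel. \<zeta> n t * g t) \<longlonglongrightarrow> g s"
  proof (rule LIMSEQ_I)
    fix e :: real assume e: "0 < e"
    from gc[unfolded continuous_on_iff, rule_format, OF s' half_gt_zero[OF e]]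
    obtain d where d: "0 < d" "\<forall>t\<in>{-T..T}. dist t s < d \<longrightarrow> dist (g t) (g s) < e / 2" by blast
    have "(\<lambda>n. 2 * T / real (n + 2)) \<longlonglongrightarrow> 0"
      by (rule LIMSEQ_ignore_initial_segment[OF lim_const_over_n])
    then obtain N where N: "\<And>n. N \<le> n \<Longrightarrow> 2 * T / real (n + 2) < d"
      using order_tendstoD(2)[of _ 0 sequentially d] d(1) by (auto simp: eventually_sequentially)
    have "norm ((LINT t:{-T<..<T}|lborel. \<zeta> n t * g t) - g s) < e" if n: "N \<le> n" for n
    proof -
      have bd: "\<bar>\<zeta> n t * g t - \<zeta> n t * g s\<bar> \<le> \<zeta> n t * (e / 2)" if "t \<in> {-T<..<T}" for t
      proof (cases "\<zeta> n t = 0")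
        case False
        then have "dist t s < d" using H(11)[of n t] N[OF n] by (simp add: dist_real_def)
        then have "\<bar>g t - g s\<bar> \<le> e / 2" using d(2)[rule_format, of t] that by (simp add: dist_real_def less_imp_le)
        then have "\<zeta> n t * \<bar>g t - g s\<bar> \<le> \<zeta> n t * (e / 2)" using H(4) by (rule mult_left_mono)
        then show ?thesis using H(4)[of n t] by (simp add: right_diff_distrib[symmetric] abs_mult)
      qed simp
      have bd1: "\<zeta> n t * g t - \<zeta> n t * g s \<le> \<zeta> n t * (e / 2)" if "t \<in> {-T<..<T}" for t
        by (rule abs_le_D1[OF bd[OF that]])
      have bd2: "\<zeta> n t * (- (e / 2)) \<le> \<zeta> n t * g t - \<zeta> n t * g s" if "t \<in> {-T<..<T}" for t
        using abs_le_D2[OF bd[OF that]] unfolding mult_minus_right by linarith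
      have i1: "set_integrable lborel {-T<..<T} (\<lambda>t. \<zeta> n t * c)" for c using \<zeta>_int by simp
      have i2: "set_integrable lborel {-T<..<T} (\<lambda>t. \<zeta> n t * g t - \<zeta> n t * g s)"
        by (rule set_integral_diff(1)[OF dis_eq(1) i1])
      have "(LINT t:{-T<..<T}|lborel. \<zeta> n t * g t) - g s
          = (LINT t:{-T<..<T}|lborel. \<zeta> n t * g t) - (LINT t:{-T<..<T}|lborel. \<zeta> n t * g s)"
        using \<zeta>_total[of n] by simp
      also have "\<dots> = (LINT t:{-T<..<T}|lborel. \<zeta> n t * g t - \<zeta> n t * g s)"
        by (rule set_integral_diff(2)[OF dis_eq(1) i1, symmetric])
      finally have "\<bar>(LINT t:{-T<..<T}|lborel. \<zeta> n t * g t) - g s\<bar> = \<bar>LINT t:{-T<..<T}|lborel. \<zeta> n t * g t - \<zeta> n t * g s\<bar>"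
        by simp
      also have "\<dots> \<le> (LINT t:{-T<..<T}|lborel. \<zeta> n t * (e / 2))"
      proof -
        have "(LINT t:{-T<..<T}|lborel. \<zeta> n t * g t - \<zeta> n t * g s) \<le> (LINT t:{-T<..<T}|lborel. \<zeta> n t * (e / 2))"
          by (intro set_integral_mono i2 i1 bd1)
        moreover have "(LINT t:{-T<..<T}|lborel. \<zeta> n t * (- (e / 2))) \<le> (LINT t:{-T<..<T}|lborel. \<zeta> n t * g t - \<zeta> n t * g s)"
          by (intro set_integral_mono i2 i1 bd2)
        ultimately show ?thesis unfolding \<zeta>_mass by (intro abs_leI; linarith)
      qed
      also have "\<dots> = e / 2" by (rule \<zeta>_mass)
      finally show ?thesis using e by simp
    qed
    then show "\<exists>N. \<forall>n\<ge>N. norm ((LINT t:{-T<..<T}|lborel. \<zeta> n t * g t) - g s) < e" by blast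
  qed
  have "(\<lambda>n. LINT p|\<mu>. H n (snd p) * transport_deriv v \<phi> p) \<longlonglongrightarrow> - g s"
    unfolding eq dis_eq(2) by (intro tendsto_minus lim2)
  then have "- g s = (LINT p|\<mu>. indicator {s<..} (snd p) * transport_deriv v \<phi> p)"
    using lim1 LIMSEQ_unique by blast
  then show ?thesis by (simp add: g_def)
qed

text \<open>
  \<open>\<integral> D \<phi> d\<mu> = 0\<close>, and the slice at time \<open>s\<close> is null.
\<close>

lemma integral_split_at:
  assumes \<phi>: "\<phi> \<in> test_functions L T"
  shows "(LINT p|\<mu>. indicator {..<s} (snd p) * transport_deriv v \<phi> p) =
     - (LINT p|\<mu>. indicator {s<..} (snd p) * transport_deriv v \<phi> p)"
proof -
  let ?D = "transport_deriv v \<phi>"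
  have int: "integrable \<mu> (\<lambda>p. indicator A (snd p) * ?D p)" if "A \<in> sets borel" for A
    using that by (intro integrable_bounded_mult[where K = 1] integrable_transport_deriv test_functionsD[OF \<phi>] snd_measurable)
      (auto simp: indicator_def)
  have "0 = (LINT p|\<mu>. ?D p)" using weak_eq[OF \<phi>] by simp
  also have "\<dots> = (LINT p|\<mu>. indicator {..<s} (snd p) * ?D p + indicator {s<..} (snd p) * ?D p)"
  proof (rule integral_cong_AE)
    show "AE p in \<mu>. ?D p = indicator {..<s} (snd p) * ?D p + indicator {s<..} (snd p) * ?D p"
      using null_slice[of s] by eventually_elim (auto simp: indicator_def)
  qed (auto intro!: borel_measurable_integrable integrable_transport_deriv test_functionsD[OF \<phi>]
      Bochner_Integration.integrable_add int)
  also have "\<dots> = (LINT p|\<mu>. indicator {..<s} (snd p) * ?D p) + (LINT p|\<mu>. indicator {s<..} (snd p) * ?D p)"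
    by (intro Bochner_Integration.integral_add int) auto
  finally show ?thesis by simp
qed

text \<open>
  The trace formula is applied to \<open>\<beta>(\<phi>)\<close>, which is nonnegative, so that the
  integral over the slice dominates the contribution of the point \<open>X\<close>; on the other
  side \<open>0 \<le> \<beta>' \<le> 1\<close> turns \<open>D (\<beta>(\<phi>)) = \<beta>'(\<phi>) D
  \<phi>\<close> into a bound by the negative or positive part of \<open>D \<phi>\<close>.
\<close>

lemma point_mass_bounds:
  assumes dis: "disintegration L T \<mu> \<rho>" and wc: "weakly_continuous L T \<rho>"
    and \<phi>: "\<phi> \<in> test_functions L T" and s: "s \<in> {-T<..<T}" and X: "X \<in> QL L"
  shows "measure (\<rho> s) {X} * \<phi> (X, s) \<le> (LINT p|\<mu>. max 0 (- (indicator {s<..} (snd p) * transport_deriv v \<phi> p)))"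
    and "measure (\<rho> s) {X} * \<phi> (X, s) \<le> (LINT p|\<mu>. max 0 (indicator {..<s} (snd p) * transport_deriv v \<phi> p))"
proof -
  let ?D = "transport_deriv v"
  define a where "a = measure (\<rho> s) {X}"
  have a0: "0 \<le> a" by (simp add: a_def)
  have s': "s \<in> {-T..T}" using s by auto
  note ker = disintegration_kernel[OF dis] and \<phi>s = test_functionsD[OF \<phi>]
  have int: "integrable \<mu> (\<lambda>p. indicator A (snd p) * ?D \<psi> p)" if "A \<in> sets borel" "smooth \<psi>" for A \<psi>
    using that by (intro integrable_bounded_mult[where K = 1] integrable_transport_deriv snd_measurable)
      (auto simp: indicator_def)
  have main: "a * (\<phi> (X, s) - e) \<le> (LINT p|\<mu>. max 0 (- (indicator {s<..} (snd p) * ?D \<phi> p))) \<and>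
      a * (\<phi> (X, s) - e) \<le> (LINT p|\<mu>. max 0 (indicator {..<s} (snd p) * ?D \<phi> p))" if e: "0 < e" for e
  proof -
    obtain \<beta> b where \<beta>: "smooth \<beta>" "\<And>y. (\<beta> has_real_derivative b y) (at y)"
      "\<And>y. 0 \<le> b y" "\<And>y. b y \<le> 1" "\<beta> 0 = 0" "\<And>y. 0 \<le> \<beta> y" "\<And>y. y - e \<le> \<beta> y"
      by (fact soft_positive_part[OF e])
    have \<beta>\<phi>: "(\<lambda>p. \<beta> (\<phi> p)) \<in> test_functions L T" by (rule test_functions_compose[OF \<phi> \<beta>(1,5)])
    note \<beta>s = test_functionsD[OF \<beta>\<phi>]
    have D: "?D (\<lambda>p. \<beta> (\<phi> p)) p = b (\<phi> p) * ?D \<phi> p" for p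
      by (rule transport_deriv_compose[OF \<beta>(2) \<phi>s(1)])
    have slice_int: "integrable (\<rho> s) (\<lambda>x. \<beta> (\<phi> (x, s)))"
    proof -
      interpret finite_measure "\<rho> s" by (rule kernel_onD(2)[OF ker s'])
      obtain K where K: "\<And>p. \<bar>\<beta> (\<phi> p)\<bar> \<le> K" using test_functions_bounded[OF L \<beta>\<phi>] by blast
      show ?thesis
        by (rule integrable_const_bound[where B = K])
          (use K in \<open>auto intro!: kernel_borel_measurable[OF ker s'] smooth_borel smooth_slice \<beta>s\<close>)
    qed
    have "a * (\<phi> (X, s) - e) \<le> a * \<beta> (\<phi> (X, s))" using \<beta>(7) a0 by (rule mult_left_mono)
    also have "\<dots> \<le> (LINT x|\<rho> s. \<beta> (\<phi> (x, s)))"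
      unfolding a_def
    proof (rule point_mass_le_integral[OF kernel_onD(2)[OF ker s'] _ slice_int \<beta>(6)])
      show "{X} \<in> sets (\<rho> s)" using X by (simp add: kernel_onD(1)[OF ker s'] sets_borel_QL)
    qed
    finally have le: "a * (\<phi> (X, s) - e) \<le> (LINT x|\<rho> s. \<beta> (\<phi> (x, s)))" .
    have fw: "(LINT x|\<rho> s. \<beta> (\<phi> (x, s))) = (LINT p|\<mu>. - (indicator {s<..} (snd p) * ?D (\<lambda>p. \<beta> (\<phi> p)) p))"
      using trace_formula[OF dis wc \<beta>\<phi> s] by simp
    have bw: "(LINT x|\<rho> s. \<beta> (\<phi> (x, s))) = (LINT p|\<mu>. indicator {..<s} (snd p) * ?D (\<lambda>p. \<beta> (\<phi> p)) p)"
      using trace_formula[OF dis wc \<beta>\<phi> s] integral_split_at[OF \<beta>\<phi>, of s] by simp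
    have c: "b y * z \<le> max 0 z" for y z
    proof (cases "0 \<le> z")
      case True then show ?thesis using mult_left_le_one_le[OF True \<beta>(3,4)] by simp
    next
      case False then show ?thesis using \<beta>(3)[of y] by (simp add: mult_nonneg_nonpos max_def)
    qed
    have "(LINT p|\<mu>. - (indicator {s<..} (snd p) * ?D (\<lambda>p. \<beta> (\<phi> p)) p)) \<le> (LINT p|\<mu>. max 0 (- (indicator {s<..} (snd p) * ?D \<phi> p)))"
    proof (rule integral_mono)
      show "- (indicator {s<..} (snd p) * ?D (\<lambda>p. \<beta> (\<phi> p)) p) \<le> max 0 (- (indicator {s<..} (snd p) * ?D \<phi> p))" for p
        using c[of "\<phi> p" "- (indicator {s<..} (snd p) * ?D \<phi> p)"] by (simp add: D mult.left_commute)
    qed (use int \<beta>s \<phi>s in auto)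
    moreover have "(LINT p|\<mu>. indicator {..<s} (snd p) * ?D (\<lambda>p. \<beta> (\<phi> p)) p) \<le> (LINT p|\<mu>. max 0 (indicator {..<s} (snd p) * ?D \<phi> p))"
    proof (rule integral_mono)
      show "indicator {..<s} (snd p) * ?D (\<lambda>p. \<beta> (\<phi> p)) p \<le> max 0 (indicator {..<s} (snd p) * ?D \<phi> p)" for p
        using c[of "\<phi> p" "indicator {..<s} (snd p) * ?D \<phi> p"] by (simp add: D mult.left_commute)
    qed (use int \<beta>s \<phi>s in auto)
    ultimately show ?thesis using le fw bw by auto
  qed
  have lim: "a * \<phi> (X, s) \<le> C" if "\<And>e. 0 < e \<Longrightarrow> a * (\<phi> (X, s) - e) \<le> C" for C
  proof (rule field_le_epsilon)
    fix e :: real assume e: "0 < e"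
    \<comment> \<open>The error \<open>e / (a + 1)\<close> is chosen so that it contributes at most
      \<open>e\<close> after multiplication by \<open>a\<close>.\<close>
    have "a * (\<phi> (X, s) - e / (a + 1)) \<le> C" using e a0 by (intro that) simp
    moreover have "a * (e / (a + 1)) \<le> e" using e a0 by (simp add: field_simps)
    ultimately show "a * \<phi> (X, s) \<le> C + e" by (simp add: right_diff_distrib)
  qed
  show "measure (\<rho> s) {X} * \<phi> (X, s) \<le> (LINT p|\<mu>. max 0 (- (indicator {s<..} (snd p) * ?D \<phi> p)))"
    "measure (\<rho> s) {X} * \<phi> (X, s) \<le> (LINT p|\<mu>. max 0 (indicator {..<s} (snd p) * ?D \<phi> p))"
    unfolding a_def[symmetric]
    by (rule lim, rule main[THEN conjunct1], assumption) (rule lim, rule main[THEN conjunct2], assumption)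
qed

end

section \<open>The subsystem emanating from a point\<close>

text \<open>
  The Hahn-Banach theorem is applied on the integrable functions with \<open>p f = \<integral>
  f\<^sup>+ d\<mu>\<close>, and with independent test functions \<open>\<phi>\<close> for the future
  and \<open>\<psi>\<close> for the past. The two parts have disjoint supports, so \<open>p\<close>
  of their sum is the sum of the two integrals bounded in \<open>point_mass_bounds\<close>.
\<close>

lemma (in transport) subsystem_density:
  assumes dis: "disintegration L T \<mu> \<rho>" and wc: "weakly_continuous L T \<rho>"
    and s: "s \<in> {-T<..<T}" and X: "X \<in> QL L"
  obtains g where "g \<in> borel_measurable \<mu>" "\<And>p. 0 \<le> g p" "\<And>p. g p \<le> 1"
    "\<And>\<phi>. \<phi> \<in> test_functions L T \<Longrightarrow> (LINT p|\<mu>. g p * transport_deriv v \<phi> p) = 0"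
    "\<And>\<phi>. \<phi> \<in> test_functions L T \<Longrightarrow>
       (LINT p|\<mu>. g p * (indicator {s<..} (snd p) * transport_deriv v \<phi> p)) = - (measure (\<rho> s) {X} * \<phi> (X, s))"
proof -
  let ?D = "transport_deriv v" and ?V = "{f. integrable \<mu> f}"
  define a where "a = measure (\<rho> s) {X}"
  define after where "after \<phi> p = indicator {s<..} (snd p) * ?D \<phi> p" for \<phi> p
  define before where "before \<phi> p = indicator {..<s} (snd p) * ?D \<phi> p" for \<phi> p
  have int: "integrable \<mu> (after \<phi>)" "integrable \<mu> (before \<phi>)" if "\<phi> \<in> test_functions L T" for \<phi>
    unfolding after_def before_def
    by (intro integrable_bounded_mult[where K = 1] integrable_transport_deriv test_functionsD[OF that]
        snd_measurable; auto simp: indicator_def)+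
  define p where "p f = (LINT x|\<mu>. max 0 (f x))" for f :: "_ \<Rightarrow> real"
  define R where "R = {(\<lambda>x. after \<phi> x + before \<psi> x, - (a * \<phi> (X, s)) + a * \<psi> (X, s)) | \<phi> \<psi>.
      \<phi> \<in> test_functions L T \<and> \<psi> \<in> test_functions L T}"
  have R_I: "(w, r) \<in> R"
    if "\<phi> \<in> test_functions L T" "\<psi> \<in> test_functions L T" "w = (\<lambda>x. after \<phi> x + before \<psi> x)"
      "r = - (a * \<phi> (X, s)) + a * \<psi> (X, s)" for w r \<phi> \<psi>
    using that unfolding R_def by blast
  have R_E: "\<exists>\<phi> \<psi>. \<phi> \<in> test_functions L T \<and> \<psi> \<in> test_functions L T \<and> w = (\<lambda>x. after \<phi> x + before \<psi> x) \<and>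
      r = - (a * \<phi> (X, s)) + a * \<psi> (X, s)" if "(w, r) \<in> R" for w r
    using that unfolding R_def by blast
  have D_add: "?D (\<lambda>p. \<phi> p + \<psi> p) x = ?D \<phi> x + ?D \<psi> x"
    if "\<phi> \<in> test_functions L T" "\<psi> \<in> test_functions L T" for \<phi> \<psi> x
    by (rule transport_deriv_add[OF test_functionsD(1)[OF that(1)] test_functionsD(1)[OF that(2)]])
  have D_cmult: "?D (\<lambda>p. c * \<phi> p) x = c * ?D \<phi> x" if "\<phi> \<in> test_functions L T" for \<phi> x c
    by (rule transport_deriv_cmult[OF test_functionsD(1)[OF that]])
  have V: "function_space ?V" unfolding function_space_def by auto
  have p_sub: "sublinear_on ?V p" unfolding sublinear_on_def
  proof (intro conjI ballI allI impI)
    fix f :: "(real^2) \<times> real \<Rightarrow> real" assume f: "f \<in> ?V"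
    show "p (\<lambda>x. f x + g x) \<le> p f + p g" if g: "g \<in> ?V" for g :: "(real^2) \<times> real \<Rightarrow> real"
    proof -
      have "p (\<lambda>x. f x + g x) \<le> (LINT x|\<mu>. max 0 (f x) + max 0 (g x))"
        unfolding p_def using f g by (intro integral_mono) auto
      then show ?thesis using f g by (simp add: p_def)
    qed
    show "p (\<lambda>x. c * f x) = c * p f" if "0 \<le> c" for c
    proof -
      have "max 0 (c * f x) = c * max 0 (f x)" for x
        using that by (simp add: max_mult_distrib_left)
      then show ?thesis by (simp add: p_def)
    qed
  qed
  obtain q where q: "linear_functional_on ?V q" "\<And>f. f \<in> ?V \<Longrightarrow> q f \<le> p f" "\<And>w r. (w, r) \<in> R \<Longrightarrow> q w = r"
  proof (rule hahn_banach_linear_relation[OF V p_sub, of R])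
    show "((\<lambda>_. 0), 0) \<in> R"
      by (rule R_I[OF test_functions_zero[OF T] test_functions_zero[OF T]])
        (simp_all add: after_def before_def transport_deriv_const)
    show "((\<lambda>x. w x + w' x), r + r') \<in> R" if wr: "(w, r) \<in> R" and wr': "(w', r') \<in> R" for w r w' r'
    proof -
      obtain \<phi> \<psi> where 1: "\<phi> \<in> test_functions L T" "\<psi> \<in> test_functions L T" "w = (\<lambda>x. after \<phi> x + before \<psi> x)"
        "r = - (a * \<phi> (X, s)) + a * \<psi> (X, s)" using R_E[OF wr] by blast
      obtain \<phi>' \<psi>' where 2: "\<phi>' \<in> test_functions L T" "\<psi>' \<in> test_functions L T" "w' = (\<lambda>x. after \<phi>' x + before \<psi>' x)"
        "r' = - (a * \<phi>' (X, s)) + a * \<psi>' (X, s)" using R_E[OF wr'] by blast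
      show ?thesis
        by (rule R_I[OF test_functions_add[OF 1(1) 2(1)] test_functions_add[OF 1(2) 2(2)]])
          (unfold 1(3,4) 2(3,4) after_def before_def D_add[OF 1(1) 2(1)] D_add[OF 1(2) 2(2)], simp_all add: algebra_simps)
    qed
    show "((\<lambda>x. c * w x), c * r) \<in> R" if wr: "(w, r) \<in> R" for w r c
    proof -
      obtain \<phi> \<psi> where 1: "\<phi> \<in> test_functions L T" "\<psi> \<in> test_functions L T" "w = (\<lambda>x. after \<phi> x + before \<psi> x)"
        "r = - (a * \<phi> (X, s)) + a * \<psi> (X, s)" using R_E[OF wr] by blast
      show ?thesis
        by (rule R_I[OF test_functions_cmult[OF 1(1), of c] test_functions_cmult[OF 1(2), of c]])
          (unfold 1(3,4) after_def before_def D_cmult[OF 1(1)] D_cmult[OF 1(2)], simp_all add: algebra_simps)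
    qed
    show "w \<in> ?V" if wr: "(w, r) \<in> R" for w r
      using R_E[OF wr] int by auto
    show "r \<le> p w" if wr: "(w, r) \<in> R" for w r
    proof -
      obtain \<phi> \<psi> where 1: "\<phi> \<in> test_functions L T" "\<psi> \<in> test_functions L T" "w = (\<lambda>x. after \<phi> x + before \<psi> x)"
        "r = - (a * \<phi> (X, s)) + a * \<psi> (X, s)" using R_E[OF wr] by blast
      have "a * (-1 * \<phi> (X, s)) \<le> (LINT x|\<mu>. max 0 (- (indicator {s<..} (snd x) * ?D (\<lambda>p. -1 * \<phi> p) x)))"
        unfolding a_def by (rule point_mass_bounds(1)[OF dis wc test_functions_cmult[OF 1(1)] s X])
      then have f: "- (a * \<phi> (X, s)) \<le> (LINT x|\<mu>. max 0 (after \<phi> x))"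
        unfolding D_cmult[OF 1(1)] by (simp add: after_def)
      have b: "a * \<psi> (X, s) \<le> (LINT x|\<mu>. max 0 (before \<psi> x))"
        unfolding a_def before_def by (rule point_mass_bounds(2)[OF dis wc 1(2) s X])
      have "p w = (LINT x|\<mu>. max 0 (after \<phi> x) + max 0 (before \<psi> x))"
        unfolding p_def 1(3)
        by (intro Bochner_Integration.integral_cong refl) (auto simp: after_def before_def indicator_def)
      also have "\<dots> = (LINT x|\<mu>. max 0 (after \<phi> x)) + (LINT x|\<mu>. max 0 (before \<psi> x))"
        using int[OF 1(1)] int[OF 1(2)] by (intro Bochner_Integration.integral_add) auto
      finally show ?thesis using f b 1(4) by simp
    qed
  qed blast
  obtain g where g: "g \<in> borel_measurable \<mu>" "\<And>x. 0 \<le> g x" "\<And>x. g x \<le> 1"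
    "\<And>f. integrable \<mu> f \<Longrightarrow> q f = (LINT x|\<mu>. g x * f x)"
    using dominated_functional_density[OF finite_measure_axioms q(1)] q(2) unfolding p_def by auto
  show thesis
  proof (rule that[OF g(1-3)])
    fix \<phi> assume \<phi>: "\<phi> \<in> test_functions L T"
    have "(\<lambda>x. after \<phi> x + before (\<lambda>_. 0) x) = after \<phi>" by (auto simp: before_def transport_deriv_const)
    then have "(after \<phi>, - (a * \<phi> (X, s))) \<in> R"
      by (intro R_I[OF \<phi> test_functions_zero[OF T]]) auto
    from q(3)[OF this] g(4)[OF int(1)[OF \<phi>]]
    show "(LINT p|\<mu>. g p * (indicator {s<..} (snd p) * ?D \<phi> p)) = - (measure (\<rho> s) {X} * \<phi> (X, s))"
      by (simp add: after_def a_def)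
    have "q (\<lambda>x. after \<phi> x + before \<phi> x) = 0" by (rule q(3)[OF R_I[OF \<phi> \<phi> refl]]) simp
    then have "0 = (LINT x|\<mu>. g x * (after \<phi> x + before \<phi> x))" using g(4) int[OF \<phi>] by simp
    also have "\<dots> = (LINT x|\<mu>. g x * ?D \<phi> x)"
    proof (rule integral_cong_AE)
      show "AE x in \<mu>. g x * (after \<phi> x + before \<phi> x) = g x * ?D \<phi> x"
        using null_slice[of s] by eventually_elim (auto simp: after_def before_def indicator_def)
    qed (use g(1) int[OF \<phi>] integrable_transport_deriv[OF test_functionsD(1)[OF \<phi>]] in auto)
    finally show "(LINT p|\<mu>. g p * ?D \<phi> p) = 0" by simp
  qed
qed

lemma disintegration_null_slice:
  assumes \<mu>: "sets \<mu> = sets (borel_QLT L T)" and dis: "disintegration L T \<mu> \<sigma>"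
  shows "AE p in \<mu>. snd p \<noteq> s"
proof (rule AE_I')
  let ?A = "{p \<in> QLT L T. snd p = s}"
  have A: "?A \<in> sets (borel_QLT L T)"
  proof -
    have "?A = QLT L T \<inter> (UNIV \<times> {s})" by auto
    also have "\<dots> \<in> sets borel" by (intro sets.Int QLT_borel) (simp add: borel_prod[symmetric])
    finally show ?thesis by (auto simp: sets_borel_QLT)
  qed
  have "emeasure \<mu> ?A = (\<integral>\<^sup>+t\<in>{-T<..<T}. emeasure (\<sigma> t) {x. (x, t) \<in> ?A} \<partial>lborel)"
    using dis A by (simp add: disintegration_def)
  also have "\<dots> = (\<integral>\<^sup>+(t::real). 0 \<partial>lborel)"
  proof (rule nn_integral_cong_AE)
    have "AE t in lborel. t \<noteq> s" by (rule AE_lborel_singleton)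
    then show "AE t in lborel. emeasure (\<sigma> t) {x. (x, t) \<in> ?A} * indicator {-T<..<T} t = 0"
      by eventually_elim simp
  qed
  finally show "?A \<in> null_sets \<mu>" using A \<mu> by auto
  show "{p \<in> space \<mu>. \<not> snd p \<noteq> s} \<subseteq> ?A" using sets_eq_imp_space_eq[OF \<mu>] by auto
qed

text \<open>
  For a flux with density \<open>v\<close>, the continuity equation is the weak equation used in the
  locale \<open>transport\<close>.
\<close>

lemma continuity_eq_iff:
  assumes \<mu>: "\<mu> \<in> pos_measures (borel_QLT L T)" and v: "integrable \<mu> v"
    and m: "vector_measure (borel_QLT L T) m" "\<And>A. A \<in> sets \<mu> \<Longrightarrow> m A = vm_density \<mu> v A"
  shows "continuity_eq L T \<mu> m \<longleftrightarrow> (\<forall>\<phi>\<in>test_functions L T. (LINT p|\<mu>. transport_deriv v \<phi> p) = 0)"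
proof -
  note \<mu>s = pos_measuresD[OF \<mu>]
  interpret finite_measure \<mu> by (rule \<mu>s(2))
  have "(LINT p|\<mu>. deriv3 \<phi> p) + vm_integral (borel_QLT L T) m (grad' \<phi>) = (LINT p|\<mu>. transport_deriv v \<phi> p)"
    if \<phi>: "\<phi> \<in> test_functions L T" for \<phi>
  proof -
    have s: "smooth \<phi>" by (rule test_functionsD(1)[OF \<phi>])
    have meas: "f \<in> borel_measurable \<mu>" if "smooth f" for f
      by (intro \<mu>s(4) measurable_restrict_space1 smooth_borel that)
    have "\<exists>K. \<forall>p\<in>QLT L T. \<bar>grad' \<phi> p $ i\<bar> \<le> K" for i
    proof -
      obtain K where "0 \<le> K" "\<And>p. p \<in> QLT L T \<Longrightarrow> \<bar>grad' \<phi> p $ i\<bar> \<le> K"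
        by (fact smooth_bounded_QLT[OF smooth_grad'_component[OF s]])
      then show ?thesis by blast
    qed
    then have "\<forall>i. \<exists>K. \<forall>p\<in>QLT L T. \<bar>grad' \<phi> p $ i\<bar> \<le> K" by blast
    from choice[OF this] obtain K where K: "\<And>i p. p \<in> QLT L T \<Longrightarrow> \<bar>grad' \<phi> p $ i\<bar> \<le> K i" by blast
    have Kb: "\<bar>grad' \<phi> p $ i\<bar> \<le> max (K 1) (K 2)" if "p \<in> space \<mu>" for p i
    proof -
      have "K i \<le> max (K 1) (K 2)" using exhaust_2[of i] by (elim disjE) simp_all
      then show ?thesis using K[of p i] that \<mu>s(3) by simp
    qed
    note D = vm_integral_density[OF v m(2) m(1) \<mu>s(1)[symmetric] \<mu>s(2) meas[OF smooth_grad'_component[OF s]] Kb]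
    obtain K3 where "\<And>p. p \<in> QLT L T \<Longrightarrow> \<bar>deriv3 \<phi> p\<bar> \<le> K3"
      using smooth_bounded_QLT[OF smooth_deriv3[OF s]] by blast
    then have "integrable \<mu> (deriv3 \<phi>)"
      using \<mu>s(3) by (intro integrable_const_bound[where B = K3] meas[OF smooth_deriv3[OF s]]) auto
    then show ?thesis using D by (simp add: transport_deriv_conv[OF s, abs_def])
  qed
  then show ?thesis by (auto simp: continuity_eq_def)
qed

text \<open>
  The dominated measure is carried by the countably many atoms of the larger one, of which those
  that keep positive mass are its atoms.
\<close>

lemma purely_atomic_dominated:
  assumes \<nu>: "\<nu> \<in> pos_measures (borel_QL L)" and \<sigma>: "purely_atomic L \<sigma>" "sets \<sigma> = sets (borel_QL L)"
    and le: "\<And>B. B \<in> sets (borel_QL L) \<Longrightarrow> emeasure \<nu> B \<le> emeasure \<sigma> B"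
  shows "purely_atomic L \<nu>"
proof -
  note \<nu>s = pos_measuresD[OF \<nu>]
  interpret finite_measure \<nu> by (rule \<nu>s(2))
  obtain S \<phi> where S: "countable S" "S \<subseteq> QL L" and em: "\<And>B. B \<in> sets (borel_QL L) \<Longrightarrow>
      emeasure \<sigma> B = (\<Sum>\<^sub>\<infinity>x\<in>S. ennreal (\<phi> x) * indicator B x)"
    using \<sigma>(1) unfolding purely_atomic_def by blast
  define S' where "S' = {x \<in> S. 0 < measure \<nu> {x}}"
  have cS': "countable S'" "S' \<subseteq> QL L" using S by (auto simp: S'_def)
  have pt: "{x} \<in> sets \<nu>" if "x \<in> QL L" for x using that by (simp add: \<nu>s(1) sets_borel_QL)
  have cnt: "A \<in> sets \<nu>" if "countable A" "A \<subseteq> QL L" for A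
  proof -
    have "A = (\<Union>x\<in>A. {x})" by auto
    also have "\<dots> \<in> sets \<nu>" using that by (intro sets.countable_UN'') (auto intro: pt)
    finally show ?thesis .
  qed
  have null: "emeasure \<nu> (B - S') = 0" if B: "B \<in> sets (borel_QL L)" for B
  proof -
    have S_sets: "S \<in> sets \<nu>" "S - S' \<in> sets \<nu>" using S by (auto intro: cnt)
    have "emeasure \<sigma> (B - S) = (\<Sum>\<^sub>\<infinity>x\<in>S. ennreal (\<phi> x) * indicator (B - S) x)"
      using B S_sets \<nu>s(1) by (intro em) auto
    also have "\<dots> = 0" by (rule infsum_0) simp
    finally have "emeasure \<nu> (B - S) = 0" using le[of "B - S"] B S_sets \<nu>s(1) by auto
    moreover have "emeasure \<nu> (S - S') = 0"
    proof -
      have "(\<Union>x\<in>S - S'. {x}) \<in> null_sets \<nu>"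
      proof (rule null_sets_UN')
        show "countable (S - S')" using S by auto
        show "{x} \<in> null_sets \<nu>" if "x \<in> S - S'" for x
          using that S pt[of x] measure_nonneg[of \<nu> "{x}"] by (auto simp: S'_def emeasure_eq_measure null_sets_def less_le)
      qed
      then show ?thesis by auto
    qed
    moreover have "B - S' \<subseteq> (B - S) \<union> (S - S')" by auto
    moreover have "B - S \<in> sets \<nu>" using B S_sets \<nu>s(1) by auto
    ultimately show ?thesis
      using S_sets by (metis emeasure_Un_null_set emeasure_eq_0 null_setsI sets.Un)
  qed
  have "emeasure \<nu> B = (\<Sum>\<^sub>\<infinity>x\<in>S'. ennreal (measure \<nu> {x}) * indicator B x)" if B: "B \<in> sets (borel_QL L)" for B
  proof -
    have Bn: "B \<in> sets \<nu>" using B \<nu>s(1) by simp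
    have S's: "S' \<in> sets \<nu>" by (rule cnt[OF cS'])
    have fin_sum: "(\<Sum>x\<in>F. ennreal (measure \<nu> {x}) * indicator B x) = emeasure \<nu> (F \<inter> B)"
      if "finite F" "F \<subseteq> S'" for F
    proof -
      have "(\<Sum>x\<in>F. ennreal (measure \<nu> {x}) * indicator B x) = (\<Sum>x\<in>F \<inter> B. emeasure \<nu> {x})"
        using that(1) by (auto simp: emeasure_eq_measure sum.inter_restrict indicator_def intro!: sum.cong)
      also have "\<dots> = emeasure \<nu> (F \<inter> B)"
        using that cS' pt by (intro emeasure_eq_sum_singleton[symmetric]) auto
      finally show ?thesis .
    qed
    have "emeasure \<nu> B = emeasure \<nu> (S' \<inter> B)"
    proof -
      have "emeasure \<nu> ((S' \<inter> B) \<union> (B - S')) = emeasure \<nu> (S' \<inter> B)"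
        by (rule emeasure_Un_null_set) (use null[OF B] Bn S's in \<open>auto intro: null_setsI\<close>)
      moreover have "(S' \<inter> B) \<union> (B - S') = B" by auto
      ultimately show ?thesis by simp
    qed
    also have "\<dots> = (SUP F\<in>{F. finite F \<and> F \<subseteq> S'}. emeasure \<nu> (F \<inter> B))"
    proof (rule antisym)
      show "(SUP F\<in>{F. finite F \<and> F \<subseteq> S'}. emeasure \<nu> (F \<inter> B)) \<le> emeasure \<nu> (S' \<inter> B)"
        using Bn S's by (intro SUP_least emeasure_mono) auto
      show "emeasure \<nu> (S' \<inter> B) \<le> (SUP F\<in>{F. finite F \<and> F \<subseteq> S'}. emeasure \<nu> (F \<inter> B))"
      proof (cases "S' = {}")
        case False
        define F where "F n = from_nat_into S' ` {..<n}" for n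
        have F: "finite (F n)" "F n \<subseteq> S'" for n
          using from_nat_into[OF False] by (auto simp: F_def)
        have Fs: "F n \<in> sets \<nu>" for n using F[of n] cS' by (intro cnt) (auto intro: countable_finite)
        have "(\<Union>n. F n) = range (from_nat_into S')" by (auto simp: F_def)
        then have U: "(\<Union>n. F n \<inter> B) = S' \<inter> B"
          using range_from_nat_into[OF False cS'(1)] by auto
        have "(SUP n. emeasure \<nu> (F n \<inter> B)) = emeasure \<nu> (\<Union>n. F n \<inter> B)"
          using Fs Bn by (intro SUP_emeasure_incseq) (auto simp: incseq_def F_def)
        then have "emeasure \<nu> (S' \<inter> B) = (SUP n. emeasure \<nu> (F n \<inter> B))" using U by simp
        also have "\<dots> \<le> (SUP F\<in>{F. finite F \<and> F \<subseteq> S'}. emeasure \<nu> (F \<inter> B))"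
          using F by (intro SUP_least SUP_upper) auto
        finally show ?thesis .
      qed simp
    qed
    also have "\<dots> = (SUP F\<in>{F. finite F \<and> F \<subseteq> S'}. \<Sum>x\<in>F. ennreal (measure \<nu> {x}) * indicator B x)"
      by (intro SUP_cong refl fin_sum[symmetric]) auto
    also have "\<dots> = (\<Sum>\<^sub>\<infinity>x\<in>S'. ennreal (measure \<nu> {x}) * indicator B x)"
      by (rule nonneg_infsum_complete[symmetric]) auto
    finally show ?thesis .
  qed
  then show ?thesis
    unfolding purely_atomic_def using cS' by (intro exI[of _ S'] exI[of _ "\<lambda>x. measure \<nu> {x}"]) (auto simp: S'_def)
qed

lemma integral_scaled_point_mass:
  fixes f :: "real^2 \<Rightarrow> real"
  assumes f: "f \<in> borel_measurable borel" and X: "X \<in> QL L" and a: "0 \<le> a"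
  shows "(LINT x|scale_measure (ennreal a) (return (borel_QL L) X). f x) = a * f X"
proof -
  let ?N = "return (borel_QL L) X"
  have fm: "f \<in> borel_measurable (borel_QL L)" by (rule measurable_restrict_space1[OF f])
  have "scale_measure (ennreal a) ?N = density ?N (\<lambda>_. ennreal a)"
    by (rule measure_eqI) (auto simp: emeasure_density nn_integral_cmult_indicator)
  then have "(LINT x|scale_measure (ennreal a) ?N. f x) = (LINT x|?N. a * f x)"
    using fm a by (simp add: integral_real_density)
  also have "\<dots> = a * f X"
    using X fm by (subst integral_return) auto
  finally show ?thesis .
qed

text \<open>
  A density on space-time acts slice by slice.
\<close>

lemma disintegration_density:
  fixes h :: "(real^2) \<times> real \<Rightarrow> ennreal"
  assumes L: "0 < L" and \<mu>: "\<mu> \<in> pos_measures (borel_QLT L T)" and dis: "disintegration L T \<mu> \<sigma>"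
    and h: "h \<in> borel_measurable borel" "\<And>p. h p \<le> 1"
  shows "disintegration L T (density \<mu> h) (\<lambda>t. density (\<sigma> t) (\<lambda>x. h (x, t)))"
    and "t \<in> {-T..T} \<Longrightarrow> density (\<sigma> t) (\<lambda>x. h (x, t)) \<in> pos_measures (borel_QL L)"
    and "t \<in> {-T..T} \<Longrightarrow> B \<in> sets (borel_QL L) \<Longrightarrow> emeasure (density (\<sigma> t) (\<lambda>x. h (x, t))) B \<le> emeasure (\<sigma> t) B"
proof -
  note ker = disintegration_kernel[OF dis] and \<mu>s = pos_measuresD[OF \<mu>]
  have hs: "(\<lambda>x. h (x, t)) \<in> borel_measurable (\<sigma> t)" if "t \<in> {-T..T}" for t
    by (rule kernel_borel_measurable[OF ker that measurable_slice[OF h(1)]])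
  have em: "emeasure (density (\<sigma> t) (\<lambda>x. h (x, t))) B = (\<integral>\<^sup>+x. h (x, t) * indicator B x \<partial>\<sigma> t)"
    if "t \<in> {-T..T}" "B \<in> sets (borel_QL L)" for t B
    using that kernel_onD(1)[OF ker that(1)] by (intro emeasure_density hs) auto
  show le: "emeasure (density (\<sigma> t) (\<lambda>x. h (x, t))) B \<le> emeasure (\<sigma> t) B"
    if t: "t \<in> {-T..T}" and B: "B \<in> sets (borel_QL L)" for t B
  proof -
    have "(\<integral>\<^sup>+x. h (x, t) * indicator B x \<partial>\<sigma> t) \<le> (\<integral>\<^sup>+x. indicator B x \<partial>\<sigma> t)"
      using h(2) by (intro nn_integral_mono) (auto split: split_indicator)
    then show ?thesis using em[OF t B] B kernel_onD(1)[OF ker t] by simp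
  qed
  show pm: "density (\<sigma> t) (\<lambda>x. h (x, t)) \<in> pos_measures (borel_QL L)" if t: "t \<in> {-T..T}" for t
  proof -
    have "emeasure (density (\<sigma> t) (\<lambda>x. h (x, t))) (QL L) \<le> emeasure (\<sigma> t) (QL L)"
      by (rule le[OF t]) (simp add: sets_borel_QL)
    also have "\<dots> < \<infinity>"
      using finite_measure.emeasure_finite[OF kernel_onD(2)[OF ker t]] by (simp add: less_top[symmetric])
    finally have "finite_measure (density (\<sigma> t) (\<lambda>x. h (x, t)))"
      using kernel_onD(3)[OF ker t] by (intro finite_measureI) auto
    then show ?thesis using kernel_onD(1)[OF ker t] by (simp add: pos_measures_def)
  qed
  show "disintegration L T (density \<mu> h) (\<lambda>t. density (\<sigma> t) (\<lambda>x. h (x, t)))"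
    unfolding disintegration_def
  proof (intro conjI ballI)
    show "density (\<sigma> t) (\<lambda>x. h (x, t)) \<in> pos_measures (borel_QL L)" if "t \<in> {-T..T}" for t
      by (rule pm[OF that])
    fix B assume B: "B \<in> sets (borel_QL L)"
    have Bb: "B \<in> sets borel" using B by (simp add: sets_borel_QL)
    have "(\<lambda>p. h p * indicator B (fst p)) \<in> borel_measurable borel"
      using h(1) Bb unfolding borel_prod[symmetric] by measurable
    from kernel_measurable_nn_integral[OF L ker this]
    show "(\<lambda>t. emeasure (density (\<sigma> t) (\<lambda>x. h (x, t))) B) \<in> borel_measurable (restrict_space borel {-T..T})"
      by (rule measurable_cong[THEN iffD1, rotated]) (simp add: em B space_restrict_space)
  next
    fix A assume A: "A \<in> sets (borel_QLT L T)"
    have Ab: "A \<in> sets borel" using A by (simp add: sets_borel_QLT)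
    have "h \<in> borel_measurable \<mu>"
      using measurable_cong_sets[OF \<mu>s(1) refl] measurable_restrict_space1[OF h(1)] by blast
    then have "emeasure (density \<mu> h) A = (\<integral>\<^sup>+p. h p * indicator A p \<partial>\<mu>)"
      using A \<mu>s(1) by (intro emeasure_density) auto
    also have "\<dots> = (\<integral>\<^sup>+t\<in>{-T<..<T}. (\<integral>\<^sup>+x. h (x, t) * indicator A (x, t) \<partial>\<sigma> t) \<partial>lborel)"
      using h(1) Ab by (intro nn_integral_disintegration[OF L \<mu>s(1) dis]) auto
    also have "\<dots> = (\<integral>\<^sup>+t\<in>{-T<..<T}. emeasure (density (\<sigma> t) (\<lambda>x. h (x, t))) {x. (x, t) \<in> A} \<partial>lborel)"
    proof (intro nn_integral_cong)
      fix t
      show "(\<integral>\<^sup>+x. h (x, t) * indicator A (x, t) \<partial>\<sigma> t) * indicator {-T<..<T} t =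
          emeasure (density (\<sigma> t) (\<lambda>x. h (x, t))) {x. (x, t) \<in> A} * indicator {-T<..<T} t"
      proof (cases "t \<in> {-T<..<T}")
        case True
        then have "t \<in> {-T..T}" by auto
        from em[OF this slice_borel_QLT[OF A]] show ?thesis
          by (simp add: indicator_def)
      qed simp
    qed
    finally show "emeasure (density \<mu> h) A =
        (\<integral>\<^sup>+t\<in>{-T<..<T}. emeasure (density (\<sigma> t) (\<lambda>x. h (x, t))) {x. (x, t) \<in> A} \<partial>lborel)" .
  qed
qed

theorem proposition5p7:
  fixes L T x3 :: real and X :: "real^2"
    and \<mu> :: "((real^2) \<times> real) measure" and m :: "((real^2) \<times> real) set \<Rightarrow> real^2"
  assumes "0 < L" and "0 < T"
    and "(X, x3) \<in> QLT L T"
    and "\<mu> \<in> A_star L T"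
    and "min_energy L T \<mu> < \<infinity>"
    and "optimal_flux L T \<mu> m"
  shows "\<exists>\<mu>'\<in>A_star L T.
    (\<forall>A\<in>sets (borel_QLT L T). emeasure \<mu>' A \<le> emeasure \<mu> A) \<and>
    slices L T \<mu>' x3 = scale_measure (emeasure (slices L T \<mu> x3) {X}) (return (borel_QL L) X) \<and>
    integrable \<mu>' (vm_RN \<mu> m) \<and>
    continuity_eq L T \<mu>' (vm_density \<mu>' (vm_RN \<mu> m))"
proof -
  note L = assms(1) and T = assms(2)
  define v where "v = vm_RN \<mu> m"
  have X: "X \<in> QL L" and x3: "x3 \<in> {-T<..<T}" using assms(3) by (auto simp: QLT_def)
  have x3': "x3 \<in> {-T..T}" using x3 by auto
  have m: "m \<in> fluxes L T \<mu>" using assms(6) by (simp add: optimal_flux_def)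
  obtain \<sigma> where \<mu>: "\<mu> \<in> pos_measures (borel_QLT L T)" and \<sigma>: "disintegration L T \<mu> \<sigma>"
    and atomic: "AE t in lborel. t \<in> {-T<..<T} \<longrightarrow> purely_atomic L (\<sigma> t)"
    using assms(4) by (auto simp: A_star_def A_LT_def)
  note \<mu>s = pos_measuresD[OF \<mu>]
  have mv: "vector_measure (borel_QLT L T) m" "vm_abs_cont m \<mu>" "continuity_eq L T \<mu> m"
    using m by (auto simp: fluxes_def)
  have v: "integrable \<mu> v" "\<And>A. A \<in> sets \<mu> \<Longrightarrow> m A = vm_density \<mu> v A"
    unfolding v_def using vm_RN_exists[OF mv(1) \<mu>s(1)[symmetric] \<mu>s(2) mv(2)] by blast+
  interpret transport L T \<mu> v
    using L T \<mu> v(1) mv(3) continuity_eq_iff[OF \<mu> v(1) mv(1) v(2)] disintegration_null_slice[OF \<mu>s(1) \<sigma>]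
    by unfold_locales auto
  let ?\<rho> = "slices L T \<mu>"
  note \<rho> = slices_weakly_continuous
  obtain g where g: "g \<in> borel_measurable \<mu>" "\<And>p. 0 \<le> g p" "\<And>p. g p \<le> 1"
    "\<And>\<phi>. \<phi> \<in> test_functions L T \<Longrightarrow> (LINT p|\<mu>. g p * transport_deriv v \<phi> p) = 0"
    "\<And>\<phi>. \<phi> \<in> test_functions L T \<Longrightarrow>
       (LINT p|\<mu>. g p * (indicator {x3<..} (snd p) * transport_deriv v \<phi> p)) = - (measure (?\<rho> x3) {X} * \<phi> (X, x3))"
    by (fact subsystem_density[OF \<rho> x3 X])
  \<comment> \<open>The density is extended by \<open>0\<close> to a Borel function on the whole space, as its
    slices are also taken at the times \<open>- T\<close> and \<open>T\<close>.\<close>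
  define h where "h p = ennreal (g p) * indicator (QLT L T) p" for p
  define \<mu>' where "\<mu>' = density \<mu> h"
  have h: "h \<in> borel_measurable borel" "\<And>p. h p \<le> 1"
  proof -
    have "g \<in> borel_measurable (borel_QLT L T)"
      using g(1) measurable_cong_sets[OF \<mu>s(1) refl] by blast
    then have "(\<lambda>p. ennreal (g p)) \<in> borel_measurable (borel_QLT L T)" by measurable
    then show "h \<in> borel_measurable borel"
      unfolding h_def by (subst (asm) borel_measurable_restrict_space_iff_ennreal) auto
    show "h p \<le> 1" for p using g(3)[of p] by (auto simp: h_def ennreal_le_1 split: split_indicator)
  qed
  have \<mu>'_g: "\<mu>' = density \<mu> (\<lambda>p. ennreal (g p))"
  proof -
    have "h \<in> borel_measurable \<mu>"
      using measurable_cong_sets[OF \<mu>s(1) refl] measurable_restrict_space1[OF h(1)] by blast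
    then show ?thesis
      unfolding \<mu>'_def by (rule density_cong) (use g(1) \<mu>s(3) in \<open>auto simp: h_def\<close>)
  qed
  have \<mu>'_int: "(LINT p|\<mu>'. f p) = (LINT p|\<mu>. g p * f p)" if "f \<in> borel_measurable \<mu>" for f :: "_ \<Rightarrow> real"
    unfolding \<mu>'_g using that g by (simp add: integral_real_density)
  have le: "emeasure \<mu>' A \<le> emeasure \<mu> A" if A: "A \<in> sets (borel_QLT L T)" for A
  proof -
    have "emeasure \<mu>' A = (\<integral>\<^sup>+p. ennreal (g p) * indicator A p \<partial>\<mu>)"
      unfolding \<mu>'_g using g(1) A \<mu>s(1) by (intro emeasure_density) auto
    also have "\<dots> \<le> (\<integral>\<^sup>+p. indicator A p \<partial>\<mu>)"
      using g(3) by (intro nn_integral_mono) (auto simp: ennreal_le_1 split: split_indicator)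
    finally show ?thesis using A \<mu>s(1) by simp
  qed
  have \<mu>': "\<mu>' \<in> pos_measures (borel_QLT L T)"
  proof -
    have "emeasure \<mu>' (QLT L T) \<le> emeasure \<mu> (QLT L T)" by (rule le) (simp add: sets_borel_QLT)
    also have "\<dots> < \<infinity>" by (simp add: less_top[symmetric])
    finally have "finite_measure \<mu>'" using \<mu>s(3) by (intro finite_measureI) (auto simp: \<mu>'_def)
    then show ?thesis using \<mu>s(1) by (simp add: pos_measures_def \<mu>'_def)
  qed
  have v': "integrable \<mu>' v"
  proof -
    have "integrable \<mu> (\<lambda>p. g p *\<^sub>R v p)"
      by (rule Bochner_Integration.integrable_bound[OF v(1)])
        (use v(1) g in \<open>auto intro!: AE_I2 mult_left_le_one_le\<close>)
    then show ?thesis unfolding \<mu>'_g using v(1) g by (subst integrable_density) auto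
  qed
  define \<sigma>' where "\<sigma>' t = density (\<sigma> t) (\<lambda>x. h (x, t))" for t
  have \<sigma>': "disintegration L T \<mu>' \<sigma>'"
    unfolding \<mu>'_def \<sigma>'_def by (rule disintegration_density(1)[OF L \<mu> \<sigma> h])
  have atomic': "AE t in lborel. t \<in> {-T<..<T} \<longrightarrow> purely_atomic L (\<sigma>' t)"
    using atomic
  proof eventually_elim
    case (elim t)
    show ?case
    proof
      assume t: "t \<in> {-T<..<T}"
      then have t': "t \<in> {-T..T}" by auto
      show "purely_atomic L (\<sigma>' t)"
        unfolding \<sigma>'_def
      proof (rule purely_atomic_dominated[where \<sigma> = "\<sigma> t"])
        show "purely_atomic L (\<sigma> t)" using elim t by blast
        show "sets (\<sigma> t) = sets (borel_QL L)" by (rule kernel_onD(1)[OF disintegration_kernel[OF \<sigma>] t'])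
      qed (rule disintegration_density(2,3)[OF L \<mu> \<sigma> h t'], assumption?)+
    qed
  qed
  have weak: "(LINT p|\<mu>'. transport_deriv v \<phi> p) = 0" if \<phi>: "\<phi> \<in> test_functions L T" for \<phi>
    using \<mu>'_int[OF borel_measurable_integrable[OF integrable_transport_deriv[OF test_functionsD(1)[OF \<phi>]]]] g(4)[OF \<phi>]
    by simp
  interpret S: transport L T \<mu>' v
    by unfold_locales (use L T \<mu>' v' weak disintegration_null_slice[OF pos_measuresD(1)[OF \<mu>'] \<sigma>'] in auto)
  have flux: "vm_density \<mu>' v \<in> fluxes L T \<mu>'" "continuity_eq L T \<mu>' (vm_density \<mu>' v)"
  proof -
    have vm: "vector_measure (borel_QLT L T) (vm_density \<mu>' v)"
      by (rule vm_density_vector_measure[OF v']) (rule pos_measuresD(1)[OF \<mu>', symmetric])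
    show ce: "continuity_eq L T \<mu>' (vm_density \<mu>' v)"
      using continuity_eq_iff[OF \<mu>' v' vm refl] weak by blast
    show "vm_density \<mu>' v \<in> fluxes L T \<mu>'"
      using vm ce vm_density_abs_cont by (auto simp: fluxes_def)
  qed
  have "\<mu>' \<in> A_star L T"
    using \<mu>' flux \<sigma>' atomic' by (auto simp: A_star_def A_LT_def)
  moreover have "slices L T \<mu>' x3 = scale_measure (emeasure (?\<rho> x3) {X}) (return (borel_QL L) X)"
  proof (rule measure_eqI_smooth_periodic[OF L])
    define a where "a = measure (?\<rho> x3) {X}"
    have a: "emeasure (?\<rho> x3) {X} = ennreal a" "0 \<le> a"
      using finite_measure.emeasure_eq_measure[OF kernel_onD(2)[OF disintegration_kernel[OF \<rho>(1)] x3']]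
      by (auto simp: a_def)
    show "slices L T \<mu>' x3 \<in> pos_measures (borel_QL L)"
      by (rule kernel_onD(4)[OF disintegration_kernel[OF S.slices_weakly_continuous(1)] x3'])
    show "scale_measure (emeasure (?\<rho> x3) {X}) (return (borel_QL L) X) \<in> pos_measures (borel_QL L)"
    proof -
      have "emeasure (return (borel_QL L) X) (QL L) = 1"
        using X by (subst emeasure_return) (auto simp: sets_borel_QL)
      then show ?thesis
        unfolding a(1) pos_measures_def
        by (auto intro!: finite_measureI simp: space_scale_measure ennreal_mult_eq_top_iff)
    qed
    fix f assume f: "f \<in> smooth_periodic L"
    obtain \<zeta> :: "nat \<Rightarrow> real \<Rightarrow> real" and r where z: "\<And>n. smooth (\<zeta> n)" "\<And>n t. 0 \<le> \<zeta> n t" "\<And>n. r n < T"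
      "\<And>n t. r n \<le> \<bar>t\<bar> \<Longrightarrow> \<zeta> n t = 0" "\<And>t. \<bar>t\<bar> < T \<Longrightarrow> \<exists>n. 0 < \<zeta> n t"
      by (fact exhausting_time_cutoffs[OF T])
    have "\<bar>x3\<bar> < T" using x3 by auto
    then obtain n where n: "0 < \<zeta> n x3" using z(5) by blast
    \<comment> \<open>A smooth periodic function becomes a test function through a time cutoff that is
      positive at \<open>x3\<close>.\<close>
    have \<phi>: "(\<lambda>p. \<zeta> n (snd p) * f (fst p)) \<in> test_functions L T" (is "?\<phi> \<in> _")
      by (rule time_cutoff_test_function[OF smooth_space[OF f] _ z(1,3,4)]) (use smooth_periodicD(2)[OF f] in auto)
    have "\<zeta> n x3 * (LINT x|slices L T \<mu>' x3. f x) = (LINT x|slices L T \<mu>' x3. ?\<phi> (x, x3))" by simp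
    also have "\<dots> = - (LINT p|\<mu>'. indicator {x3<..} (snd p) * transport_deriv v ?\<phi> p)"
      by (rule S.trace_formula[OF S.slices_weakly_continuous \<phi> x3])
    also have "\<dots> = a * ?\<phi> (X, x3)"
    proof -
      have "(\<lambda>p. indicator {x3<..} (snd p) * transport_deriv v ?\<phi> p) \<in> borel_measurable \<mu>"
        by (intro borel_measurable_times snd_measurable
            borel_measurable_integrable[OF integrable_transport_deriv[OF test_functionsD(1)[OF \<phi>]]]) simp
      from \<mu>'_int[OF this] g(5)[OF \<phi>] show ?thesis by (simp add: a_def)
    qed
    also have "\<dots> = \<zeta> n x3 * (a * f X)" by simp
    finally have "(LINT x|slices L T \<mu>' x3. f x) = a * f X" using n by simp
    also have "\<dots> = (LINT x|scale_measure (emeasure (?\<rho> x3) {X}) (return (borel_QL L) X). f x)"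
      unfolding a(1) by (rule integral_scaled_point_mass[OF smooth_periodic_borel[OF f] X a(2), symmetric])
    finally show "(LINT x|slices L T \<mu>' x3. f x) =
        (LINT x|scale_measure (emeasure (?\<rho> x3) {X}) (return (borel_QL L) X). f x)" .
  qed
  ultimately show ?thesis
    using le v' flux(2) unfolding v_def by blast
qed

end
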